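(* Let $\varphi \colon \mathbb S \to \mathbb S$ be a homeomorphism of the unit circle $\mathbb S=\partial\mathbb D$ onto itself, and let $h \colon \overline{\mathbb D} \to \overline{\mathbb D}$ be the harmonic extension of $\varphi$ (which is a homeomorphism of $\overline{\mathbb D}$ onto itself). Let $p\in(1,\infty)$. Then $h \in \mathscr{W}^{1,p}(\mathbb D,\mathbb C)$ if and only if $\varphi$ satisfies the $p$-Douglas condition \[ \int_{\mathbb S}\int_{\mathbb S} \left|\frac{\varphi(\xi)-\varphi(\eta)}{\xi-\eta}\right|^p \, |\mathrm d\xi|\, |\mathrm d\eta| < \infty . \]
   Context: $\mathbb D$ is the open unit disk in $\mathbb C$ and $\mathbb S$ the unit circle; integrals over $\mathbb S$ are with respect to arc length. The harmonic extension of $\varphi$ is the map $h$ equal to $\varphi$ on $\mathbb S$ and given in $\mathbb D$ by the Poisson integral of $\varphi$, $h(z)=\frac{1}{2\pi}\int_0^{2\pi}\frac{1-|z|^2}{|z-e^{i\theta}|^2}\varphi(e^{i\theta})\,d\theta$; by the Radó–Kneser–Choquet theorem it is a homeomorphism of $\overline{\mathbb D}$ onto itself. $\mathscr W^{1,p}(\mathbb D,\mathbb C)$ is the Sobolev space of complex-valued functions on $\mathbb D$ that together with their first weak derivatives belong to $L^p(\mathbb D)$. *)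

theory Defs
  imports "HOL-Analysis.Analysis"
begin

definition partial_dir :: "(complex \<Rightarrow> real) \<Rightarrow> complex \<Rightarrow> complex \<Rightarrow> real" where
  "partial_dir \<psi> v z = frechet_derivative \<psi> (at z) v"

definition smooth_fun :: "(complex \<Rightarrow> real) \<Rightarrow> bool" where
  "smooth_fun \<psi> \<longleftrightarrow>
     (\<forall>ds :: complex list. set ds \<subseteq> {1, \<i>} \<longrightarrow>
        (\<forall>z. fold (\<lambda>v g. partial_dir g v) ds \<psi> differentiable (at z)))"

definition test_fun :: "complex set \<Rightarrow> (complex \<Rightarrow> real) \<Rightarrow> bool" where
  "test_fun U \<psi> \<longleftrightarrow> smooth_fun \<psi> \<and> compact (closure {z. \<psi> z \<noteq> 0})
                      \<and> closure {z. \<psi> z \<noteq> 0} \<subseteq> U"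

definition Lp_on :: "complex set \<Rightarrow> real \<Rightarrow> (complex \<Rightarrow> complex) \<Rightarrow> bool" where
  "Lp_on U p f \<longleftrightarrow> f \<in> borel_measurable (lebesgue_on U)
     \<and> (\<integral>\<^sup>+ z. ennreal (indicator U z * norm (f z) powr p) \<partial>lebesgue) < \<infinity>"

definition weak_deriv_on :: "complex set \<Rightarrow> complex \<Rightarrow> (complex \<Rightarrow> complex) \<Rightarrow> (complex \<Rightarrow> complex) \<Rightarrow> bool" where
  "weak_deriv_on U v f g \<longleftrightarrow>
     (\<forall>\<psi>. test_fun U \<psi> \<longrightarrow>
        (LINT z:U|lebesgue. f z * of_real (partial_dir \<psi> v z))
          = - (LINT z:U|lebesgue. g z * of_real (\<psi> z)))"

definition sobolev_W1p :: "complex set \<Rightarrow> real \<Rightarrow> (complex \<Rightarrow> complex) \<Rightarrow> bool" where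
  "sobolev_W1p U p f \<longleftrightarrow> Lp_on U p f \<and>
     (\<exists>g1 g2. Lp_on U p g1 \<and> Lp_on U p g2
        \<and> weak_deriv_on U 1 f g1 \<and> weak_deriv_on U \<i> f g2)"

text \<open>Harmonic extension: phi on the circle, Poisson integral inside the disk.\<close>
definition harmonic_ext :: "(complex \<Rightarrow> complex) \<Rightarrow> complex \<Rightarrow> complex" where
  "harmonic_ext f z =
     (if norm z < 1 then
        complex_of_real (1 / (2 * pi)) * integral {0..2*pi}
          (\<lambda>\<theta>. of_real ((1 - (norm z)\<^sup>2) / (norm (z - cis \<theta>))\<^sup>2) * f (cis \<theta>))
      else f z)"

definition douglas_cond :: "real \<Rightarrow> (complex \<Rightarrow> complex) \<Rightarrow> bool" where
  "douglas_cond p f \<longleftrightarrow>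
     (\<integral>\<^sup>+ s. \<integral>\<^sup>+ t. ennreal (indicator {0..2*pi} s * indicator {0..2*pi} t *
        norm ((f (cis s) - f (cis t)) / (cis s - cis t)) powr p) \<partial>lborel \<partial>lborel) < \<infinity>"

end

theory Submission
  imports Defs
begin

text \<open>
  Write \<open>h = A + cnj B + const\<close> in the disk, where \<open>A\<close>, \<open>B\<close> are Cauchy integrals of \<open>\<phi>\<close> and
  \<open>cnj \<phi>\<close>. The classical derivatives of \<open>h\<close> are its weak ones, and weak derivatives are unique, so the
  Sobolev condition says that \<open>G = \<bar>A'\<bar> + \<bar>B'\<bar>\<close> lies in \<open>L\<^sup>p\<close>; passing to polar coordinates, what
  remains is the trace theorem for the exponent \<open>1 - 1/p\<close>.

  If the Douglas integral is finite: \<open>G (r e\<^sup>i\<^sup>t)\<close> is bounded by the integral of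
  \<open>\<bar>\<phi> \<theta> - \<phi> t\<bar> / (\<delta> + \<rho>)\<^sup>2\<close> with \<open>\<delta> = 1 - r\<close> and \<open>\<rho> = \<bar>e\<^sup>i\<^sup>\<theta> - e\<^sup>i\<^sup>t\<bar>\<close>. Hoelder's inequality, with the
  kernel split so that both factors stay integrable, and integration over \<open>\<delta>\<close> produce
  \<open>\<bar>\<phi> \<theta> - \<phi> t\<bar>\<^sup>p / \<rho>\<^sup>p\<close>.

  Conversely, join \<open>e\<^sup>i\<^sup>t\<close> to \<open>e\<^sup>i\<^sup>(\<^sup>t\<^sup>+\<^sup>s\<^sup>)\<close> by a radial segment of length \<open>s\<close>, an arc of radius \<open>1 - s\<close> and
  another radial segment. The radial pieces are controlled by Hardy's inequality and the arc by
  Jensen's inequality.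
\<close>

section \<open>Hoelder's inequality and polar coordinates\<close>

text \<open>Both halves hinge on a choice of exponents. The kernel of the first half has mass of
  order 1/\<delta>, so Jensen's inequality applied to it as it stands would leave the weight
  \<open>\<delta> powr (1 - p)\<close>, which is not integrable near the circle once p >= 2; the
  uneven split replaces it by \<open>\<delta> powr (-1/2)\<close> for every p > 1. Differences of
  \<phi> can appear under the integral because the Cauchy integral of a constant has derivative 0.
  In the second half the depth of the path equals the angle s that it bridges. The arc then becomes
  an average over an interval of length s, and the radial pieces scale in the same way; the constant
  2/(p - 1) of the Hardy step shows where p > 1 enters. Paths are used only for angles up to 1/2,
  since for larger ones the difference quotient is bounded by 8. Estimates are made with extended
  nonnegative integrals wherever possible, so that orders of integration may be exchanged before
  anything is known to be finite.\<close>

lemma Holder_nn_integral: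
  fixes f g :: "'a \<Rightarrow> real"
  assumes [measurable]: "f \<in> borel_measurable M" "g \<in> borel_measurable M"
    and f: "\<And>x. 0 \<le> f x" and g: "\<And>x. 0 \<le> g x" and p: "1 < p"
    and a: "0 \<le> a" "ennreal a \<le> (\<integral>\<^sup>+x. ennreal (f x * g x) \<partial>M)"
    and K: "0 < K" "(\<integral>\<^sup>+x. ennreal (g x powr (p / (p - 1))) \<partial>M) \<le> ennreal K"
  shows "ennreal (a powr p) \<le> ennreal (K powr (p - 1)) * (\<integral>\<^sup>+x. ennreal (f x powr p) \<partial>M)"
proof (cases "(\<integral>\<^sup>+x. ennreal (f x powr p) \<partial>M)")
  case top
  then show ?thesis
    using K by (simp add: ennreal_mult_top)
next
  case (real A)
  define q where "q = p / (p - 1)"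
  have q: "1 < q" "1 / p + 1 / q = 1" "p - 1 = p / q"
    using p by (auto simp: q_def field_simps)
  show ?thesis
  proof (cases "A = 0")
    case True
    then have "AE x in M. f x powr p = 0"
      using real nn_integral_0_iff_AE[of "\<lambda>x. ennreal (f x powr p)" M] by auto
    then have "AE x in M. ennreal (f x * g x) = 0"
      by eventually_elim auto
    then have "(\<integral>\<^sup>+x. ennreal (f x * g x) \<partial>M) = 0"
      by (subst nn_integral_0_iff_AE) auto
    then have "a = 0"
      using a by simp
    then show ?thesis using p by simp
  next
    case False
    with real have A: "A > 0" by simp
    \<comment> \<open>The scale \<open>l\<close> balances Young's inequality for
      \<open>l * f\<close> and \<open>g / l\<close>: up to the weights \<open>1/p\<close> and
      \<open>1/q\<close> both terms become \<open>A powr (1/p) * K powr (1/q)\<close>, and the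
      weights add up to 1. It divides by \<open>A\<close>, hence the separate case
      \<open>A = 0\<close>.\<close>
    define l where "l = (K / A) powr (1 / (p * q))"
    have l: "l > 0" using A K by (simp add: l_def)
    have lp: "l powr p * A = A powr (1/p) * K powr (1/q)"
    proof -
      have "l powr p = (K / A) powr (1/q)"
        using p q by (simp add: l_def powr_powr)
      also have "\<dots> * A = K powr (1/q) * (A powr (1 - 1/q))"
        using A K by (simp add: powr_divide powr_diff)
      also have "1 - 1/q = 1/p" using q by simp
      finally show ?thesis by simp
    qed
    have lq: "(1/l) powr q * K = A powr (1/p) * K powr (1/q)"
    proof -
      have "(1/l) powr q = (A / K) powr (1/p)"
        using p q A K by (simp add: l_def powr_powr powr_divide)
      also have "\<dots> * K = A powr (1/p) * (K powr (1 - 1/p))"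
        using A K by (simp add: powr_divide powr_diff)
      also have "1 - 1/p = 1/q" using q by simp
      finally show ?thesis by simp
    qed
    have "ennreal a \<le> (\<integral>\<^sup>+x. ennreal (f x * g x) \<partial>M)" by fact
    also have "\<dots> \<le> (\<integral>\<^sup>+x. ennreal (l powr p / p) * ennreal (f x powr p) + ennreal ((1/l) powr q / q) * ennreal (g x powr q) \<partial>M)"
    proof (rule nn_integral_mono)
      fix x
      have "f x * g x = (l * f x) * (1/l * g x)"
        using l by simp
      also have "\<dots> \<le> (l * f x) powr p / p + (1/l * g x) powr q / q"
        using p q f g l by (intro Youngs_inequality) auto
      also have "\<dots> = (l powr p / p) * (f x powr p) + ((1/l) powr q / q) * (g x powr q)"
        using f g l by (simp add: powr_mult powr_divide)
      finally show "ennreal (f x * g x) \<le> ennreal (l powr p / p) * ennreal (f x powr p) + ennreal ((1/l) powr q / q) * ennreal (g x powr q)"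
        using p q by (simp add: ennreal_mult' ennreal_plus[symmetric] ennreal_mult[symmetric] del: ennreal_plus)
    qed
    also have "\<dots> = ennreal (l powr p / p) * ennreal A + ennreal ((1/l) powr q / q) * (\<integral>\<^sup>+x. ennreal (g x powr q) \<partial>M)"
      using real by (simp add: nn_integral_add nn_integral_cmult)
    also have "\<dots> \<le> ennreal (l powr p / p) * ennreal A + ennreal ((1/l) powr q / q) * ennreal K"
      using K by (intro add_left_mono mult_left_mono) (auto simp: q_def)
    also have "\<dots> = ennreal (l powr p * A / p + (1/l) powr q * K / q)"
      using p q A K by (simp add: ennreal_mult[symmetric] ennreal_plus[symmetric] del: ennreal_plus)
    also have "l powr p * A / p + (1/l) powr q * K / q = A powr (1/p) * K powr (1/q) * (1/p + 1/q)"
      unfolding lp lq by (simp add: algebra_simps)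
    also have "\<dots> = A powr (1/p) * K powr (1/q)"
      by (simp only: q)
    finally have "a \<le> A powr (1/p) * K powr (1/q)"
      by (simp add: ennreal_le_iff)
    then have "a powr p \<le> (A powr (1/p) * K powr (1/q)) powr p"
      using a p by (intro powr_mono2) auto
    also have "\<dots> = K powr (p - 1) * A"
      using p q A K by (simp add: powr_mult powr_powr)
    finally show ?thesis
      using real K by (simp add: ennreal_mult[symmetric])
  qed
qed

section \<open>Polar coordinates in the plane\<close>

lemma borel_measurable_cis [measurable]: "cis \<in> borel_measurable borel"
  by (auto intro!: borel_measurable_continuous_onI continuous_intros)

text \<open>Lebesgue measure is determined by its values on boxes, and under \<open>Complex\<close>
  a box of the plane is a product of two intervals. This gives access to iterated integrals in the
  real and imaginary part.\<close>

lemma lborel_complex_eq: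
  "lborel = distr (lborel \<Otimes>\<^sub>M lborel) borel (\<lambda>(x, y). Complex x y)"
proof (rule lborel_eqI)
  have [measurable]: "(\<lambda>(x, y). Complex x y) \<in> borel_measurable (lborel \<Otimes>\<^sub>M lborel)"
    by (auto simp: lborel_prod split_beta Complex_eq intro!: borel_measurable_continuous_onI continuous_intros)
  fix l u :: complex
  assume lu: "\<And>b. b \<in> Basis \<Longrightarrow> l \<bullet> b \<le> u \<bullet> b"
  have lu': "Re l \<le> Re u" "Im l \<le> Im u"
    using lu[of 1] lu[of \<i>] by (auto simp: Basis_complex_def)
  have "emeasure (distr (lborel \<Otimes>\<^sub>M lborel) borel (\<lambda>(x, y). Complex x y)) (box l u)
      = emeasure (lborel \<Otimes>\<^sub>M lborel) ({Re l<..<Re u} \<times> {Im l<..<Im u})"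
    by (subst emeasure_distr) (auto intro!: arg_cong[where f="emeasure _"] simp: box_complex_eq in_box_complex_iff space_pair_measure)
  also have "\<dots> = ennreal (\<Prod>b\<in>Basis. (u - l) \<bullet> b)"
    using lu' by (simp add: lborel.emeasure_pair_measure_Times Basis_complex_def ennreal_mult)
  finally show "emeasure (distr (lborel \<Otimes>\<^sub>M lborel) borel (\<lambda>(x, y). Complex x y)) (box l u) = ennreal (\<Prod>b\<in>Basis. (u - l) \<bullet> b)" .
qed simp

lemma nn_integral_complex_iterated:
  assumes [measurable]: "f \<in> borel_measurable borel"
  shows "(\<integral>\<^sup>+z. f z \<partial>lborel) = (\<integral>\<^sup>+x. \<integral>\<^sup>+y. f (Complex x y) \<partial>lborel \<partial>lborel)"
proof -
  have [measurable]: "(\<lambda>(x, y). Complex x y) \<in> borel_measurable (lborel \<Otimes>\<^sub>M lborel)"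
    by (auto simp: lborel_prod split_beta Complex_eq intro!: borel_measurable_continuous_onI continuous_intros)
  have "(\<integral>\<^sup>+z. f z \<partial>lborel) = (\<integral>\<^sup>+z. f (case z of (x, y) \<Rightarrow> Complex x y) \<partial>(lborel \<Otimes>\<^sub>M lborel))"
    by (subst lborel_complex_eq, subst nn_integral_distr) auto
  also have "\<dots> = (\<integral>\<^sup>+x. \<integral>\<^sup>+y. f (Complex x y) \<partial>lborel \<partial>lborel)"
    by (subst lborel.nn_integral_fst[symmetric]) auto
  finally show ?thesis .
qed

text \<open>The substitution is run as \<open>\<theta> = arctan u\<close>, whose derivative is the
  weight \<open>1 / (1 + u\<^sup>2)\<close>, on compact intervals; monotone convergence along
  growing ones gives the whole line. \<open>Suc n\<close> instead of \<open>n\<close> avoids a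
  degenerate interval.\<close>

lemma nn_integral_tan_substitution:
  fixes H :: "real \<Rightarrow> ennreal"
  assumes [measurable]: "H \<in> borel_measurable borel"
  shows "(\<integral>\<^sup>+u. H u * ennreal (1 / (1 + u\<^sup>2)) \<partial>lborel)
       = (\<integral>\<^sup>+\<theta>. H (tan \<theta>) * indicator {-pi/2<..<pi/2} \<theta> \<partial>lborel)"
proof -
  have [measurable]: "tan \<in> borel_measurable (borel :: real measure)"
    unfolding tan_def[abs_def] by measurable
  have sub: "(\<integral>\<^sup>+\<theta>. H (tan \<theta>) * indicator {arctan (- real (Suc n))..arctan (real (Suc n))} \<theta> \<partial>lborel)
      = (\<integral>\<^sup>+u. H u * ennreal (1 / (1 + u\<^sup>2)) * indicator {-real (Suc n)..real (Suc n)} u \<partial>lborel)" for n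
  proof -
    have "(\<integral>\<^sup>+\<theta>. H (tan \<theta>) * indicator {arctan (- real (Suc n))..arctan (real (Suc n))} \<theta> \<partial>lborel)
      = (\<integral>\<^sup>+u. H (tan (arctan u)) * ennreal (1 / (1 + u\<^sup>2)) * indicator {-real (Suc n)..real (Suc n)} u \<partial>lborel)"
      by (intro nn_integral_substitution_aux)
        (auto intro!: derivative_eq_intros continuous_intros simp: field_simps add_nonneg_eq_0_iff intro: add_nonneg_nonneg)
    then show ?thesis by (simp add: tan_arctan)
  qed
  have "(\<lambda>n. \<integral>\<^sup>+u. H u * ennreal (1 / (1 + u\<^sup>2)) * indicator {-real (Suc n)..real (Suc n)} u \<partial>lborel)
     \<longlonglongrightarrow> (\<integral>\<^sup>+u. H u * ennreal (1 / (1 + u\<^sup>2)) \<partial>lborel)"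
  proof (rule nn_integral_LIMSEQ)
    show "incseq (\<lambda>n u. H u * ennreal (1 / (1 + u\<^sup>2)) * indicator {-real (Suc n)..real (Suc n)} u)"
      by (auto simp: incseq_def le_fun_def split: split_indicator)
    fix u
    obtain N where "\<bar>u\<bar> \<le> real N" by (meson real_arch_simple)
    then have "\<forall>\<^sub>F n in sequentially. H u * ennreal (1 / (1 + u\<^sup>2)) * indicator {-real (Suc n)..real (Suc n)} u = H u * ennreal (1 / (1 + u\<^sup>2))"
      by (intro eventually_sequentiallyI[of N]) (auto split: split_indicator)
    then show "(\<lambda>n. H u * ennreal (1 / (1 + u\<^sup>2)) * indicator {-real (Suc n)..real (Suc n)} u) \<longlonglongrightarrow> H u * ennreal (1 / (1 + u\<^sup>2))"
      by (rule tendsto_eventually)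
  qed auto
  moreover have "(\<lambda>n. \<integral>\<^sup>+\<theta>. H (tan \<theta>) * indicator {arctan (- real (Suc n))..arctan (real (Suc n))} \<theta> \<partial>lborel)
     \<longlonglongrightarrow> (\<integral>\<^sup>+\<theta>. H (tan \<theta>) * indicator {-pi/2<..<pi/2} \<theta> \<partial>lborel)"
  proof (rule nn_integral_LIMSEQ)
    define I where "I n = {arctan (- real (Suc n))..arctan (real (Suc n))}" for n
    have "I n \<subseteq> I m" if "n \<le> m" for n m
      using that unfolding I_def by (intro iffD2[OF atLeastatMost_subset_iff] disjI2) (simp add: arctan_le_iff)
    then have "H (tan \<theta>) * indicator (I m) \<theta> \<le> H (tan \<theta>) * indicator (I n) \<theta>" if "m \<le> n" for m n \<theta>
      using that by (intro mult_left_mono) (auto split: split_indicator)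
    then show "incseq (\<lambda>n \<theta>. H (tan \<theta>) * indicator {arctan (- real (Suc n))..arctan (real (Suc n))} \<theta>)"
      by (simp add: incseq_def le_fun_def I_def)
    fix \<theta> :: real
    have "\<forall>\<^sub>F n in sequentially. H (tan \<theta>) * indicator {arctan (- real (Suc n))..arctan (real (Suc n))} \<theta> = H (tan \<theta>) * indicator {-pi/2<..<pi/2} \<theta>"
    proof (cases "\<theta> \<in> {-pi/2<..<pi/2}")
      case True
      obtain N where N: "\<bar>tan \<theta>\<bar> \<le> real N" by (meson real_arch_simple)
      have "\<theta> \<in> {arctan (- real (Suc n))..arctan (real (Suc n))}" if "n \<ge> N" for n
      proof -
        have "arctan (- real (Suc n)) \<le> arctan (tan \<theta>)" "arctan (tan \<theta>) \<le> arctan (real (Suc n))"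
          using that N by (auto simp: arctan_le_iff simp del: arctan_minus)
        then show ?thesis using True by (simp add: arctan_tan)
      qed
      then show ?thesis using True
        by (intro eventually_sequentiallyI[of N]) (auto split: split_indicator)
    next
      case False
      have "\<theta> \<notin> {arctan (- real (Suc n))..arctan (real (Suc n))}" for n
        using False arctan_lbound[of "-real (Suc n)"] arctan_ubound[of "real (Suc n)"] by auto
      then show ?thesis using False by simp
    qed
    then show "(\<lambda>n. H (tan \<theta>) * indicator {arctan (- real (Suc n))..arctan (real (Suc n))} \<theta>) \<longlonglongrightarrow> H (tan \<theta>) * indicator {-pi/2<..<pi/2} \<theta>"
      by (rule tendsto_eventually)
  qed auto
  ultimately show ?thesis
    unfolding sub by (rule LIMSEQ_unique)
qed

text \<open>
  Substitute \<open>y = x u\<close>, then \<open>x = r / sqrt (1 + u\<^sup>2)\<close>, then \<open>u = tan \<theta>\<close>; negative \<open>r\<close> cover the left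
  half-plane.
\<close>

lemma nn_integral_polar_line:
  fixes f :: "complex \<Rightarrow> ennreal"
  assumes [measurable]: "f \<in> borel_measurable borel"
  shows "(\<integral>\<^sup>+z. f z \<partial>lborel) =
    (\<integral>\<^sup>+\<theta>. (\<integral>\<^sup>+r. ennreal \<bar>r\<bar> * f (of_real r * cis \<theta>) \<partial>lborel) * indicator {-pi/2<..<pi/2} \<theta> \<partial>lborel)"
proof -
  have [measurable]: "arctan \<in> borel_measurable borel"
    by (auto intro!: borel_measurable_continuous_onI continuous_intros)
  define H where "H u = (\<integral>\<^sup>+r. ennreal \<bar>r\<bar> * f (of_real r * cis (arctan u)) \<partial>lborel)" for u
  have [measurable]: "H \<in> borel_measurable borel"
    unfolding H_def by measurable
  have C[measurable]: "(\<lambda>x. Complex (fst x) (snd x)) \<in> borel_measurable borel"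
    by (auto simp: Complex_eq intro!: borel_measurable_continuous_onI continuous_intros)
  have [measurable]: "(\<lambda>x. Complex (a x) (b x)) \<in> borel_measurable M"
    if [measurable]: "a \<in> borel_measurable M" "b \<in> borel_measurable M" for a b and M :: "'z measure"
    using measurable_compose[OF borel_measurable_Pair[OF that] C] by simp
  have "(\<integral>\<^sup>+z. f z \<partial>lborel) = (\<integral>\<^sup>+x. \<integral>\<^sup>+y. f (Complex x y) \<partial>lborel \<partial>lborel)"
    by (rule nn_integral_complex_iterated) fact
  also have "\<dots> = (\<integral>\<^sup>+x. \<integral>\<^sup>+u. ennreal \<bar>x\<bar> * f (Complex x (x * u)) \<partial>lborel \<partial>lborel)"
  proof (rule nn_integral_cong_AE)
    have "AE x in lborel. x \<notin> {0::real}"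
      by (rule AE_not_in) (auto intro!: null_setsI)
    then show "AE x in lborel. (\<integral>\<^sup>+y. f (Complex x y) \<partial>lborel) = (\<integral>\<^sup>+u. ennreal \<bar>x\<bar> * f (Complex x (x * u)) \<partial>lborel)"
    proof eventually_elim
      fix x :: real assume "x \<notin> {0}"
      then show "(\<integral>\<^sup>+y. f (Complex x y) \<partial>lborel) = (\<integral>\<^sup>+u. ennreal \<bar>x\<bar> * f (Complex x (x * u)) \<partial>lborel)"
        using nn_integral_real_affine[of "\<lambda>y. f (Complex x y)" x 0] by (simp add: nn_integral_cmult)
    qed
  qed
  also have "\<dots> = (\<integral>\<^sup>+u. \<integral>\<^sup>+x. ennreal \<bar>x\<bar> * f (Complex x (x * u)) \<partial>lborel \<partial>lborel)"
    by (rule lborel_pair.Fubini') measurable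
  also have "\<dots> = (\<integral>\<^sup>+u. H u * ennreal (1 / (1 + u\<^sup>2)) \<partial>lborel)"
  proof (rule nn_integral_cong)
    fix u :: real
    define c where "c = 1 / sqrt (1 + u\<^sup>2)"
    have c: "c > 0" "c * c = 1 / (1 + u\<^sup>2)"
      by (auto simp: c_def add_pos_nonneg)
    have *: "Complex (c * r) (c * r * u) = of_real r * cis (arctan u)" for r
      by (simp add: complex_eq_iff c_def cos_arctan sin_arctan)
    have "(\<integral>\<^sup>+x. ennreal \<bar>x\<bar> * f (Complex x (x * u)) \<partial>lborel)
        = ennreal c * (\<integral>\<^sup>+r. ennreal \<bar>c * r\<bar> * f (of_real r * cis (arctan u)) \<partial>lborel)"
      using c nn_integral_real_affine[of "\<lambda>x. ennreal \<bar>x\<bar> * f (Complex x (x * u))" c 0] by (simp add: *)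
    also have "\<dots> = ennreal c * (\<integral>\<^sup>+r. ennreal c * (ennreal \<bar>r\<bar> * f (of_real r * cis (arctan u))) \<partial>lborel)"
      using c by (simp add: abs_mult ennreal_mult mult.assoc)
    also have "\<dots> = ennreal c * (ennreal c * H u)"
      by (simp add: nn_integral_cmult H_def)
    also have "\<dots> = H u * ennreal (c * c)"
      using c(1) by (subst ennreal_mult) (auto simp: ac_simps)
    finally show "(\<integral>\<^sup>+x. ennreal \<bar>x\<bar> * f (Complex x (x * u)) \<partial>lborel) = H u * ennreal (1 / (1 + u\<^sup>2))"
      by (simp add: c)
  qed
  also have "\<dots> = (\<integral>\<^sup>+\<theta>. H (tan \<theta>) * indicator {-pi/2<..<pi/2} \<theta> \<partial>lborel)"
    by (rule nn_integral_tan_substitution) measurable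
  also have "\<dots> = (\<integral>\<^sup>+\<theta>. (\<integral>\<^sup>+r. ennreal \<bar>r\<bar> * f (of_real r * cis \<theta>) \<partial>lborel) * indicator {-pi/2<..<pi/2} \<theta> \<partial>lborel)"
    by (rule nn_integral_cong) (auto simp: H_def arctan_tan split: split_indicator)
  finally show ?thesis .
qed

lemma nn_integral_real_shift:
  fixes f :: "real \<Rightarrow> ennreal"
  assumes "f \<in> borel_measurable borel"
  shows "(\<integral>\<^sup>+x. f (c + x) \<partial>lborel) = (\<integral>\<^sup>+x. f x \<partial>lborel)"
  using nn_integral_real_affine[OF assms, of 1 c] by simp

text \<open>In \<open>nn_integral_polar_line\<close> every line through 0 carries both signs of
  \<open>r\<close>; a negative \<open>r\<close> at angle \<theta> is a positive radius at
  \<open>pi + \<theta>\<close>. The two halves fill an angular range of length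
  \<open>2 * pi\<close>, which periodicity moves to \<open>{0..2*pi}\<close> up to finitely many
  angles.\<close>

theorem nn_integral_polar:
  fixes f :: "complex \<Rightarrow> ennreal"
  assumes [measurable]: "f \<in> borel_measurable borel"
  shows "(\<integral>\<^sup>+z. f z \<partial>lborel) =
    (\<integral>\<^sup>+\<theta>. (\<integral>\<^sup>+r. ennreal r * f (of_real r * cis \<theta>) * indicator {0<..} r \<partial>lborel) * indicator {0..2*pi} \<theta> \<partial>lborel)"
proof -
  define W where "W \<theta> = (\<integral>\<^sup>+r. ennreal r * f (of_real r * cis \<theta>) * indicator {0<..} r \<partial>lborel)" for \<theta>
  have [measurable]: "W \<in> borel_measurable borel"
    unfolding W_def by measurable
  have W2: "W (-2*pi + \<theta>) = W \<theta>" for \<theta>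
    by (simp add: W_def cis_mult[symmetric] cis_divide[symmetric])
  have W3: "W (\<theta> - 2*pi) = W \<theta>" for \<theta>
    using W2[of \<theta>] by simp
  have half: "(\<integral>\<^sup>+r. ennreal \<bar>r\<bar> * f (of_real r * cis \<theta>) \<partial>lborel) = W \<theta> + W (pi + \<theta>)" for \<theta>
  proof -
    have "(\<integral>\<^sup>+r. ennreal \<bar>r\<bar> * f (of_real r * cis \<theta>) \<partial>lborel) =
      (\<integral>\<^sup>+r. ennreal r * f (of_real r * cis \<theta>) * indicator {0<..} r + ennreal (-r) * f (of_real r * cis \<theta>) * indicator {..<0} r \<partial>lborel)"
      by (intro nn_integral_cong) (auto split: split_indicator)
    also have "\<dots> = W \<theta> + (\<integral>\<^sup>+r. ennreal (-r) * f (of_real r * cis \<theta>) * indicator {..<0} r \<partial>lborel)"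
      by (subst nn_integral_add) (auto simp: W_def)
    also have "(\<integral>\<^sup>+r. ennreal (-r) * f (of_real r * cis \<theta>) * indicator {..<0} r \<partial>lborel) = W (pi + \<theta>)"
      unfolding W_def
      by (subst nn_integral_real_affine[where c="-1" and t=0])
         (auto intro!: nn_integral_cong simp: cis_mult[symmetric] split: split_indicator)
    finally show ?thesis .
  qed
  have "(\<integral>\<^sup>+z. f z \<partial>lborel) = (\<integral>\<^sup>+\<theta>. W \<theta> * indicator {-pi/2<..<pi/2} \<theta> + W (pi + \<theta>) * indicator {-pi/2<..<pi/2} \<theta> \<partial>lborel)"
    unfolding nn_integral_polar_line[OF assms] half by (simp add: distrib_right)
  also have "\<dots> = (\<integral>\<^sup>+\<theta>. W \<theta> * indicator {-pi/2<..<0} \<theta> + W \<theta> * indicator {0..<pi/2} \<theta> + W (pi + \<theta>) * indicator {-pi/2<..<pi/2} \<theta> \<partial>lborel)"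
    by (intro nn_integral_cong) (auto split: split_indicator)
  also have "\<dots> = (\<integral>\<^sup>+\<theta>. W \<theta> * indicator {-pi/2<..<0} \<theta> \<partial>lborel) + (\<integral>\<^sup>+\<theta>. W \<theta> * indicator {0..<pi/2} \<theta> \<partial>lborel)
      + (\<integral>\<^sup>+\<theta>. W (pi + \<theta>) * indicator {-pi/2<..<pi/2} \<theta> \<partial>lborel)"
    by (simp add: nn_integral_add)
  also have "(\<integral>\<^sup>+\<theta>. W \<theta> * indicator {-pi/2<..<0} \<theta> \<partial>lborel) = (\<integral>\<^sup>+\<theta>. W \<theta> * indicator {3*pi/2<..<2*pi} \<theta> \<partial>lborel)"
    by (subst nn_integral_real_shift[where c="-2*pi", symmetric])
       (auto intro!: nn_integral_cong simp del: mult_minus_left simp: W3 split: split_indicator)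
  also have "(\<integral>\<^sup>+\<theta>. W (pi + \<theta>) * indicator {-pi/2<..<pi/2} \<theta> \<partial>lborel) = (\<integral>\<^sup>+\<theta>. W \<theta> * indicator {pi/2<..<3*pi/2} \<theta> \<partial>lborel)"
    by (subst nn_integral_real_shift[where c="pi", symmetric])
       (auto intro!: nn_integral_cong split: split_indicator)
  also have "(\<integral>\<^sup>+\<theta>. W \<theta> * indicator {3*pi/2<..<2*pi} \<theta> \<partial>lborel) + (\<integral>\<^sup>+\<theta>. W \<theta> * indicator {0..<pi/2} \<theta> \<partial>lborel)
      + (\<integral>\<^sup>+\<theta>. W \<theta> * indicator {pi/2<..<3*pi/2} \<theta> \<partial>lborel)
    = (\<integral>\<^sup>+\<theta>. W \<theta> * indicator {3*pi/2<..<2*pi} \<theta> + W \<theta> * indicator {0..<pi/2} \<theta> + W \<theta> * indicator {pi/2<..<3*pi/2} \<theta> \<partial>lborel)"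
    by (simp add: nn_integral_add)
  also have "\<dots> = (\<integral>\<^sup>+\<theta>. W \<theta> * indicator {0..2*pi} \<theta> \<partial>lborel)"
  proof (rule nn_integral_cong_AE)
    have "AE x in lborel. x \<notin> {pi/2, 3*pi/2, 2*pi}"
      by (rule AE_not_in) (auto intro!: null_setsI emeasure_lborel_countable)
    then show "AE \<theta> in lborel. W \<theta> * indicator {3*pi/2<..<2*pi} \<theta> + W \<theta> * indicator {0..<pi/2} \<theta> + W \<theta> * indicator {pi/2<..<3*pi/2} \<theta>
       = W \<theta> * indicator {0..2*pi} \<theta>"
      by eventually_elim (auto split: split_indicator)
  qed
  finally show ?thesis unfolding W_def .
qed

section \<open>Integrals of power kernels\<close>

lemma nn_integral_powr_from_0:
  fixes a c :: real
  assumes "-1 < a" "0 \<le> c"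
  shows "(\<integral>\<^sup>+x. ennreal (x powr a) * indicator {0..c} x \<partial>lborel) = ennreal (c powr (a + 1) / (a + 1))"
  by (rule nn_integral_has_integral_lebesgue'[OF _ has_integral_powr_from_0[OF assms]]) auto

lemma nn_integral_powr_to_inf:
  fixes a e :: real
  assumes "e < -1" "0 < a"
  shows "(\<integral>\<^sup>+x. ennreal (x powr e) * indicator {a..} x \<partial>lborel) = ennreal (- (a powr (e + 1)) / (e + 1))"
  by (rule nn_integral_has_integral_lebesgue'[OF _ has_integral_powr_to_inf[OF assms]]) auto

text \<open>The bound does not see the centre \<open>c\<close>, which a translation removes; the two
  half-lines give the factor 2.\<close>

lemma nn_integral_powr_abs_le:
  fixes d b c :: real
  assumes "0 < d" "1 < b"
  shows "(\<integral>\<^sup>+x. ennreal ((d + \<bar>c + x\<bar>) powr (-b)) \<partial>lborel) \<le> ennreal (2 * d powr (1 - b) / (b - 1))"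
proof -
  let ?I = "\<integral>\<^sup>+x. ennreal (x powr (-b)) * indicator {d..} x \<partial>lborel"
  have "(\<integral>\<^sup>+x. ennreal ((d + \<bar>c + x\<bar>) powr (-b)) \<partial>lborel) = (\<integral>\<^sup>+x. ennreal ((d + \<bar>x\<bar>) powr (-b)) \<partial>lborel)"
    by (rule nn_integral_real_shift) measurable
  also have "\<dots> \<le> (\<integral>\<^sup>+x. ennreal ((d + x) powr (-b)) * indicator {d..} (d + x) + ennreal ((d + (- 1) * x) powr (-b)) * indicator {d..} (d + (-1) * x) \<partial>lborel)"
    by (intro nn_integral_mono) (auto split: split_indicator)
  also have "\<dots> = (\<integral>\<^sup>+x. ennreal ((d + x) powr (-b)) * indicator {d..} (d + x) \<partial>lborel) + (\<integral>\<^sup>+x. ennreal ((d + (- 1) * x) powr (-b)) * indicator {d..} (d + (-1) * x) \<partial>lborel)"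
    by (rule nn_integral_add) measurable
  also have "(\<integral>\<^sup>+x. ennreal ((d + x) powr (-b)) * indicator {d..} (d + x) \<partial>lborel) = ?I"
    by (rule nn_integral_real_shift) measurable
  also have "(\<integral>\<^sup>+x. ennreal ((d + (- 1) * x) powr (-b)) * indicator {d..} (d + (-1) * x) \<partial>lborel) = ?I"
    using nn_integral_real_affine[of "\<lambda>x. ennreal (x powr (-b)) * indicator {d..} x" "-1" d] by simp
  also have "?I + ?I = ennreal (2 * d powr (1 - b) / (b - 1))"
  proof -
    have "- (d powr (- b + 1)) / (- b + 1) = d powr (1 - b) / (b - 1)"
      using assms by (simp add: field_simps)
    then show ?thesis
      using assms by (simp add: nn_integral_powr_to_inf ennreal_plus[symmetric] del: ennreal_plus)
  qed
  finally show ?thesis .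
qed

text \<open>Below \<rho> the factor \<open>d + \<rho>\<close> counts as \<rho> and
  \<open>d powr (-1/2)\<close> is integrable at 0, which contributes
  \<open>2 * \<rho> powr (-p)\<close>; above \<rho> it counts as \<open>d\<close>, which contributes
  \<open>\<rho> powr (-p) / p\<close>. As \<open>p > 1\<close>, the constant 3 covers both.\<close>

lemma nn_integral_powr_product_le:
  fixes p \<rho> :: real
  assumes "1 < p" "0 < \<rho>"
  shows "(\<integral>\<^sup>+d. ennreal (d powr (-1/2) * (d + \<rho>) powr (-p - 1/2)) * indicator {0<..} d \<partial>lborel)
    \<le> ennreal (3 * \<rho> powr (-p))"
proof -
  have "(\<integral>\<^sup>+d. ennreal (d powr (-1/2) * (d + \<rho>) powr (-p - 1/2)) * indicator {0<..} d \<partial>lborel)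
    \<le> (\<integral>\<^sup>+d. ennreal (\<rho> powr (-p - 1/2)) * (ennreal (d powr (-1/2)) * indicator {0..\<rho>} d) + ennreal (d powr (-p - 1)) * indicator {\<rho>..} d \<partial>lborel)"
  proof (rule nn_integral_mono)
    fix d :: real
    have 1: "d powr (-1/2) * (d + \<rho>) powr (-p - 1/2) \<le> \<rho> powr (-p - 1/2) * d powr (-1/2)" if "0 < d"
    proof -
      have "(d + \<rho>) powr (-p - 1/2) \<le> \<rho> powr (-p - 1/2)"
        using that assms by (intro powr_mono2') auto
      then show ?thesis by (simp add: mult.commute mult_left_mono)
    qed
    have 2: "d powr (-1/2) * (d + \<rho>) powr (-p - 1/2) \<le> d powr (-p - 1)" if "0 < d"
    proof -
      have "(d + \<rho>) powr (-p - 1/2) \<le> d powr (-p - 1/2)"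
        using that assms by (intro powr_mono2') auto
      then have "d powr (-1/2) * (d + \<rho>) powr (-p - 1/2) \<le> d powr (-1/2) * d powr (-p - 1/2)"
        by (intro mult_left_mono) auto
      also have "\<dots> = d powr (-1/2 + (-p - 1/2))"
        by (simp only: powr_add)
      also have "-1/2 + (-p - 1/2) = -p - 1" by simp
      finally show ?thesis .
    qed
    show "ennreal (d powr (-1/2) * (d + \<rho>) powr (-p - 1/2)) * indicator {0<..} d \<le>
      ennreal (\<rho> powr (-p - 1/2)) * (ennreal (d powr (-1/2)) * indicator {0..\<rho>} d) + ennreal (d powr (-p - 1)) * indicator {\<rho>..} d"
    proof (cases "d \<le> \<rho>")
      case True
      then show ?thesis
        using 1 by (cases "d > 0") (auto simp: ennreal_mult[symmetric] intro!: add_increasing2 ennreal_leI split: split_indicator)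
    next
      case False
      then show ?thesis
        using 2 assms by (auto intro!: ennreal_leI split: split_indicator)
    qed
  qed
  also have "\<dots> = ennreal (\<rho> powr (-p - 1/2)) * (\<integral>\<^sup>+d. ennreal (d powr (-1/2)) * indicator {0..\<rho>} d \<partial>lborel) + (\<integral>\<^sup>+d. ennreal (d powr (-p - 1)) * indicator {\<rho>..} d \<partial>lborel)"
    by (simp add: nn_integral_add nn_integral_cmult)
  also have "\<dots> = ennreal (\<rho> powr (-p - 1/2)) * ennreal (\<rho> powr (1/2) * 2) + ennreal (\<rho> powr (-p) / p)"
    using assms by (simp add: nn_integral_powr_from_0 nn_integral_powr_to_inf)
  also have "\<dots> = ennreal (2 * (\<rho> powr (-p - 1/2) * \<rho> powr (1/2)) + \<rho> powr (-p) / p)"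
    using assms by (simp add: ennreal_mult[symmetric] ennreal_plus[symmetric] mult.left_commute del: ennreal_plus)
  also have "\<dots> \<le> ennreal (3 * \<rho> powr (-p))"
  proof -
    have "\<rho> powr (-p) / p \<le> \<rho> powr (-p)"
      using assms by (simp add: field_simps mult_le_cancel_left1)
    moreover have "\<rho> powr (-p - 1/2) * \<rho> powr (1/2) = \<rho> powr (-p)"
      by (simp add: powr_add[symmetric])
    ultimately show ?thesis by (intro ennreal_leI) simp
  qed
  finally show ?thesis .
qed

section \<open>Chords of the circle against angles\<close>

lemma sin_ge_half:
  fixes y :: real
  assumes "0 \<le> y" "y \<le> pi / 2"
  shows "y / 2 \<le> sin y"
\<comment> \<open>The derivative \<open>cos y - 1/2\<close> of \<open>sin y - y / 2\<close> is
  nonnegative up to \<open>pi / 3\<close>; beyond, \<open>sin y\<close> is at least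
  \<open>sqrt 3 / 2\<close>, which exceeds \<open>pi / 4\<close>, the largest value of
  \<open>y / 2\<close>.\<close>
proof (cases "y \<le> pi / 3")
  case True
  have "sin 0 - 0 / 2 \<le> sin y - y / 2"
  proof (rule DERIV_nonneg_imp_nondecreasing[OF assms(1)])
    fix x assume x: "0 \<le> x" "x \<le> y"
    have "cos (pi / 3) \<le> cos x"
      using x True by (intro cos_monotone_0_pi_le) auto
    then show "\<exists>z. ((\<lambda>x. sin x - x / 2) has_real_derivative z) (at x) \<and> 0 \<le> z"
      by (intro exI[of _ "cos x - 1/2"]) (auto intro!: derivative_eq_intros simp: cos_60)
  qed
  then show ?thesis by simp
next
  case False
  have "sin (pi / 3) \<le> sin y"
    using False assms by (intro sin_monotone_2pi_le) auto
  moreover have "pi / 4 \<le> sqrt 3 / 2"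
  proof -
    have "pi \<le> 3.2" using pi_approx by simp
    moreover have "1.6 \<le> sqrt (3::real)" by (rule real_le_rsqrt) (simp add: power2_eq_square)
    ultimately show ?thesis by simp
  qed
  ultimately show ?thesis using assms by (simp add: sin_60)
qed

lemma norm_cis_diff: "norm (cis s - cis t) = 2 * \<bar>sin ((s - t) / 2)\<bar>"
proof -
  have "cis s - cis t = cis t * (exp (\<i> * of_real (s - t)) - 1)"
    by (simp add: cis_conv_exp algebra_simps exp_diff)
  then show ?thesis
    using dist_exp_i_1[of "s - t"] by (simp add: norm_mult)
qed

lemma norm_cis_diff_ge:
  assumes "\<bar>s - t\<bar> \<le> pi"
  shows "\<bar>s - t\<bar> / 2 \<le> norm (cis s - cis t)"
proof -
  have "\<bar>sin (\<bar>x\<bar> / 2)\<bar> = \<bar>sin (x / 2)\<bar>" for x :: real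
    using sin_minus[of "x / 2"] by (cases "0 \<le> x") auto
  moreover have "0 \<le> sin (\<bar>s - t\<bar> / 2)"
    using assms by (intro sin_ge_zero) auto
  ultimately have "\<bar>sin ((s - t) / 2)\<bar> = sin (\<bar>s - t\<bar> / 2)"
    by (metis abs_of_nonneg)
  then show ?thesis
    using sin_ge_half[of "\<bar>s - t\<bar> / 2"] assms by (simp add: norm_cis_diff)
qed

lemma cis_add_2pi_int [simp]: "cis (x + 2 * pi * of_int k) = cis x"
  by (simp add: cis_mult[symmetric])

text \<open>A chord sees angles only modulo \<open>2 * pi\<close>, so \<open>s - t\<close> is
  replaced by a representative in \<open>{-pi..pi}\<close>. As \<open>s\<close> and \<open>t\<close>
  lie in one period, three values of \<open>k\<close> suffice, and later sums over \<open>k\<close>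
  are finite.\<close>

lemma norm_cis_diff_ge_periodic:
  assumes "s \<in> {0..2*pi}" "t \<in> {0..2*pi}"
  obtains k :: int where "k \<in> {-1, 0, 1}" "\<bar>s - t + 2 * pi * of_int k\<bar> \<le> pi"
    "\<bar>s - t + 2 * pi * of_int k\<bar> / 2 \<le> norm (cis s - cis t)"
proof -
  define k :: int where "k = (if s - t > pi then -1 else if s - t < - pi then 1 else 0)"
  have 1: "\<bar>s - t + 2 * pi * of_int k\<bar> \<le> pi" and 2: "k \<in> {-1, 0, 1}"
    using assms by (auto simp: k_def)
  have "\<bar>(s + 2 * pi * of_int k) - t\<bar> / 2 \<le> norm (cis (s + 2 * pi * of_int k) - cis t)"
    using 1 by (intro norm_cis_diff_ge) (simp add: algebra_simps)
  moreover have "(s + 2 * pi * of_int k) - t = s - t + 2 * pi * of_int k"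
    by simp
  ultimately show thesis
    using that[OF 2 1] by (simp only: cis_add_2pi_int)
qed

text \<open>Which \<open>k\<close> occurs depends on \<theta>; adding the bounds for all three
  removes this dependence and lets each integral run over the whole line. \<open>2 powr b\<close>
  comes from replacing the chord by half the angle, and 6 from three translates with two half-lines
  each.\<close>

lemma nn_integral_cis_kernel_le:
  assumes "0 < d" "1 < b" "t \<in> {0..2*pi}"
  shows "(\<integral>\<^sup>+\<theta>. ennreal ((d + norm (cis \<theta> - cis t)) powr (-b)) * indicator {0..2*pi} \<theta> \<partial>lborel)
      \<le> ennreal (6 * 2 powr b / (b - 1) * d powr (1 - b))"
proof -
  let ?g = "\<lambda>c \<theta>. ennreal (2 powr b) * ennreal ((d + \<bar>c + \<theta>\<bar>) powr (-b))"
  let ?c = "\<lambda>k. - t + 2 * pi * real_of_int k"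
  have "(\<integral>\<^sup>+\<theta>. ennreal ((d + norm (cis \<theta> - cis t)) powr (-b)) * indicator {0..2*pi} \<theta> \<partial>lborel)
    \<le> (\<integral>\<^sup>+\<theta>. (\<Sum>k\<in>{-1, 0, 1}. ?g (?c k) \<theta>) \<partial>lborel)"
  proof (rule nn_integral_mono)
    fix \<theta> :: real
    show "ennreal ((d + norm (cis \<theta> - cis t)) powr (-b)) * indicator {0..2*pi} \<theta> \<le> (\<Sum>k\<in>{-1, 0, 1}. ?g (?c k) \<theta>)"
    proof (cases "\<theta> \<in> {0..2*pi}")
      case True
      obtain k :: int where k: "k \<in> {-1, 0, 1}" "\<bar>\<theta> - t + 2 * pi * of_int k\<bar> / 2 \<le> norm (cis \<theta> - cis t)"
        using norm_cis_diff_ge_periodic[OF True assms(3)] by metis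
      have "(d + norm (cis \<theta> - cis t)) powr (-b) \<le> ((d + \<bar>?c k + \<theta>\<bar>) / 2) powr (-b)"
        using assms k by (intro powr_mono2') (auto simp: algebra_simps)
      also have "\<dots> = 2 powr b * (d + \<bar>?c k + \<theta>\<bar>) powr (-b)"
        using assms by (simp add: powr_divide powr_minus field_simps)
      finally have "ennreal ((d + norm (cis \<theta> - cis t)) powr (-b)) \<le> ?g (?c k) \<theta>"
        by (simp add: ennreal_mult[symmetric] ennreal_leI)
      also have "\<dots> \<le> (\<Sum>k\<in>{-1, 0, 1}. ?g (?c k) \<theta>)"
        using k(1) by (intro member_le_sum) auto
      finally show ?thesis using True by simp
    qed simp
  qed
  also have "\<dots> = (\<Sum>k\<in>{-1, 0, 1::int}. ennreal (2 powr b) * (\<integral>\<^sup>+\<theta>. ennreal ((d + \<bar>?c k + \<theta>\<bar>) powr (-b)) \<partial>lborel))"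
    by (subst nn_integral_sum) (auto simp: nn_integral_cmult)
  also have "\<dots> \<le> (\<Sum>k\<in>{-1, 0, 1::int}. ennreal (2 powr b) * ennreal (2 * d powr (1 - b) / (b - 1)))"
    using assms by (intro sum_mono mult_left_mono nn_integral_powr_abs_le) auto
  also have "\<dots> = ennreal (\<Sum>k\<in>{-1, 0, 1::int}. 2 powr b * (2 * d powr (1 - b) / (b - 1)))"
    using assms by (subst sum_ennreal[symmetric]) (auto simp: ennreal_mult[symmetric])
  also have "\<dots> = ennreal (6 * 2 powr b / (b - 1) * d powr (1 - b))"
    by (simp add: mult.assoc)
  finally show ?thesis .
qed

section \<open>Smooth bump functions\<close>

text \<open>The powers of \<open>1/x\<close> make the family closed under differentiation; index 0
  is the classical smooth function that is flat at 0.\<close>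

definition flat_exp :: "nat \<Rightarrow> real \<Rightarrow> real" where
  "flat_exp n x = (if x > 0 then (1/x)^n * exp (-1/x) else 0)"

lemma flat_exp_tendsto_0: "((\<lambda>h. flat_exp n h) \<longlongrightarrow> 0) (at 0)"
proof -
  have "((\<lambda>h. flat_exp n h) \<longlongrightarrow> 0) (at_right 0)"
  proof -
    have "((\<lambda>h::real. (inverse h)^n / exp (inverse h)) \<longlongrightarrow> 0) (at_right 0)"
      by (rule filterlim_compose[OF tendsto_power_div_exp_0 filterlim_inverse_at_top_right])
    moreover have "\<forall>\<^sub>F h in at_right 0. (inverse h)^n / exp (inverse h) = flat_exp n h"
      by (auto simp: flat_exp_def eventually_at_right_field exp_minus field_simps inverse_eq_divide intro!: exI[of _ 1])
    ultimately show ?thesis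
      by (rule Lim_transform_eventually)
  qed
  moreover have "((\<lambda>h. flat_exp n h) \<longlongrightarrow> 0) (at_left 0)"
    by (rule tendsto_eventually) (auto simp: flat_exp_def eventually_at_left_field intro!: exI[of _ "-1"])
  ultimately show ?thesis
    by (simp add: filterlim_split_at)
qed

lemma flat_exp_has_real_derivative:
  "(flat_exp n has_real_derivative (flat_exp (n+2) x - real n * flat_exp (n+1) x)) (at x)"
proof -
  consider "x > 0" | "x < 0" | "x = 0" by linarith
  then show ?thesis
  proof cases
    case 1
    have "((\<lambda>x. (1/x)^n * exp (-1/x)) has_real_derivative (flat_exp (n+2) x - real n * flat_exp (n+1) x)) (at x)"
    proof (cases n)
      case 0
      then show ?thesis using 1
        by (auto intro!: derivative_eq_intros simp: flat_exp_def field_simps power2_eq_square)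
    next
      case (Suc m)
      have "((\<lambda>x. (1/x)^n) has_real_derivative (real n * (1/x)^m * (- ((1/x)^2)))) (at x)"
      proof -
        have "((\<lambda>x. 1/x) has_real_derivative (- ((1/x)^2))) (at x)"
          using 1 by (auto intro!: derivative_eq_intros simp: divide_simps power2_eq_square)
        from DERIV_power[OF this, of n] show ?thesis
          using Suc by (simp add: mult.commute mult.left_commute)
      qed
      moreover have "((\<lambda>x. exp (-1/x)) has_real_derivative (exp (-1/x) * (1/x)^2)) (at x)"
        using 1 by (auto intro!: derivative_eq_intros simp: divide_simps power2_eq_square)
      ultimately have "((\<lambda>x. (1/x)^n * exp (-1/x)) has_real_derivative
         (1/x)^n * (exp (-1/x) * (1/x)^2) + (real n * (1/x)^m * (- ((1/x)^2))) * exp (-1/x)) (at x)"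
        by (rule DERIV_mult')
      moreover have "(1/x)^n * (exp (-1/x) * (1/x)^2) + (real n * (1/x)^m * (- ((1/x)^2))) * exp (-1/x)
        = flat_exp (n+2) x - real n * flat_exp (n+1) x"
        using 1 Suc by (simp add: flat_exp_def power_add power2_eq_square del: power_Suc) (simp add: algebra_simps)
      ultimately show ?thesis by simp
    qed
    then show ?thesis
      by (rule has_field_derivative_transform_within_open[where S="{0<..}"]) (use 1 in \<open>auto simp: flat_exp_def\<close>)
  next
    case 2
    have "((\<lambda>x. 0) has_real_derivative (flat_exp (n+2) x - real n * flat_exp (n+1) x)) (at x)"
      using 2 by (auto simp: flat_exp_def)
    then show ?thesis
      by (rule has_field_derivative_transform_within_open[where S="{..<0}"]) (use 2 in \<open>auto simp: flat_exp_def\<close>)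
  next
    case 3
    have z: "flat_exp k 0 = 0" for k
      by (simp add: flat_exp_def)
    \<comment> \<open>Since \<open>x / 0 = 0\<close>, the difference quotient at 0 is the next
      member of the family, everywhere, so its limit is \<open>flat_exp_tendsto_0\<close>.\<close>
    have eq: "(\<lambda>h. (flat_exp n (0 + h) - flat_exp n 0) / h) = flat_exp (Suc n)"
      by (auto simp: flat_exp_def)
    show ?thesis
      unfolding DERIV_def 3 eq using flat_exp_tendsto_0[of "Suc n"] by (simp add: z)
  qed
qed

text \<open>A class closed under partial derivatives, whence all of its members are smooth.\<close>

inductive smooth_class :: "(complex \<Rightarrow> real) \<Rightarrow> bool" where
  const: "smooth_class (\<lambda>_. c)"
| Re: "smooth_class Re"
| Im: "smooth_class Im"
| add: "smooth_class f \<Longrightarrow> smooth_class g \<Longrightarrow> smooth_class (\<lambda>z. f z + g z)"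
| mult: "smooth_class f \<Longrightarrow> smooth_class g \<Longrightarrow> smooth_class (\<lambda>z. f z * g z)"
| flat_exp: "smooth_class f \<Longrightarrow> smooth_class (\<lambda>z. flat_exp n (f z))"

lemma smooth_class_diff: "smooth_class f \<Longrightarrow> smooth_class g \<Longrightarrow> smooth_class (\<lambda>z. f z - g z)"
  using smooth_class.add[OF _ smooth_class.mult[OF smooth_class.const[of "-1"]], of f g] by simp

lemma smooth_class_has_derivative:
  assumes "smooth_class f"
  shows "\<exists>f'. (\<forall>z. (f has_derivative f' z) (at z)) \<and> (\<forall>v. smooth_class (\<lambda>z. f' z v))"
  using assms
proof induction
  case (const c)
  show ?case by (rule exI[of _ "\<lambda>_ _. 0"]) (auto intro: smooth_class.const)
next
  case Re
  show ?case by (rule exI[of _ "\<lambda>_ v. Re v"]) (auto intro: smooth_class.const intro!: derivative_eq_intros)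
next
  case Im
  show ?case by (rule exI[of _ "\<lambda>_ v. Im v"]) (auto intro: smooth_class.const intro!: derivative_eq_intros)
next
  case (add f g)
  then obtain f' g' where "\<forall>z. (f has_derivative f' z) (at z)" "\<forall>v. smooth_class (\<lambda>z. f' z v)"
    "\<forall>z. (g has_derivative g' z) (at z)" "\<forall>v. smooth_class (\<lambda>z. g' z v)" by auto
  then show ?case
    by (intro exI[of _ "\<lambda>z v. f' z v + g' z v"]) (auto intro!: derivative_intros smooth_class.add)
next
  case (mult f g)
  then obtain f' g' where "\<forall>z. (f has_derivative f' z) (at z)" "\<forall>v. smooth_class (\<lambda>z. f' z v)"
    "\<forall>z. (g has_derivative g' z) (at z)" "\<forall>v. smooth_class (\<lambda>z. g' z v)" by auto
  then show ?case
    using mult by (intro exI[of _ "\<lambda>z v. f z * g' z v + f' z v * g z"])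
      (auto intro!: derivative_intros smooth_class.add smooth_class.mult)
next
  case (flat_exp f n)
  then obtain f' where f': "\<And>z. (f has_derivative f' z) (at z)" "\<And>v. smooth_class (\<lambda>z. f' z v)" by auto
  let ?d = "\<lambda>z. flat_exp (n+2) (f z) - real n * flat_exp (n+1) (f z)"
  have "((\<lambda>z. flat_exp n (f z)) has_derivative (\<lambda>v. f' z v * ?d z)) (at z)" for z
    using has_derivative_compose[OF f'(1)[of z], of "flat_exp n" "(*) (?d z)"] flat_exp_has_real_derivative[of n "f z"]
    by (simp add: has_field_derivative_def mult.commute)
  then show ?case
    using flat_exp f'(2)
    by (intro exI[of _ "\<lambda>z v. f' z v * ?d z"])
       (auto intro!: smooth_class.mult smooth_class_diff smooth_class.const smooth_class.flat_exp)
qed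

lemma smooth_class_partial_dir: "smooth_class f \<Longrightarrow> smooth_class (partial_dir f v)"
proof -
  assume "smooth_class f"
  then obtain f' where f': "\<forall>z. (f has_derivative f' z) (at z)" "\<forall>v. smooth_class (\<lambda>z. f' z v)"
    using smooth_class_has_derivative by blast
  have "partial_dir f v = (\<lambda>z. f' z v)"
    using frechet_derivative_at[OF f'(1)[rule_format]] by (auto simp: partial_dir_def fun_eq_iff)
  then show ?thesis using f' by simp
qed

lemma smooth_class_smooth_fun:
  assumes "smooth_class f" shows "smooth_fun f"
proof -
  have "smooth_class (fold (\<lambda>v g. partial_dir g v) ds f)" for ds
    using assms by (induction ds arbitrary: f) (auto intro: smooth_class_partial_dir)
  then show ?thesis
    unfolding smooth_fun_def differentiable_def using smooth_class_has_derivative by blast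
qed

text \<open>One factor per side, so that for \<open>n > 0\<close> the function is positive exactly
  on the open box. As \<open>n\<close> grows, every factor tends to 1 inside while the support stays
  put; the limit is the indicator of the box.\<close>

definition box_bump :: "complex \<Rightarrow> complex \<Rightarrow> nat \<Rightarrow> complex \<Rightarrow> real" where
  "box_bump a b n z = flat_exp 0 (real n * (Re z - Re a)) * flat_exp 0 (real n * (Re b - Re z)) *
     (flat_exp 0 (real n * (Im z - Im a)) * flat_exp 0 (real n * (Im b - Im z)))"

lemma flat_exp_0_bounds: "0 \<le> flat_exp 0 x" "flat_exp 0 x \<le> 1"
  by (auto simp: flat_exp_def)

lemma flat_exp_0_scale_tendsto: "(\<lambda>n. flat_exp 0 (real n * x)) \<longlonglongrightarrow> indicator {0<..} x"
proof (cases "x > 0")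
  case True
  have "(\<lambda>n. exp (- (1/x) * inverse (real n))) \<longlonglongrightarrow> exp (- (1/x) * 0)"
    by (intro tendsto_intros LIMSEQ_inverse_real_of_nat lim_inverse_n)
  moreover have "\<forall>\<^sub>F n in sequentially. exp (- (1/x) * inverse (real n)) = flat_exp 0 (real n * x)"
    using True by (intro eventually_sequentiallyI[of 1]) (auto simp: flat_exp_def field_simps)
  ultimately show ?thesis
    using True by (auto simp: tendsto_cong)
next
  case False
  then have "flat_exp 0 (real n * x) = 0" for n
    by (auto simp: flat_exp_def zero_less_mult_iff)
  then show ?thesis using False by simp
qed

lemma box_bump_bounds: "0 \<le> box_bump a b n z" "box_bump a b n z \<le> 1"
  unfolding box_bump_def by (auto intro!: mult_nonneg_nonneg mult_le_one flat_exp_0_bounds)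

lemma box_bump_tendsto: "(\<lambda>n. box_bump a b n z) \<longlonglongrightarrow> indicator (box a b) z"
proof -
  have "(\<lambda>n. box_bump a b n z) \<longlonglongrightarrow> indicator {0<..} (Re z - Re a) * indicator {0<..} (Re b - Re z) *
     (indicator {0<..} (Im z - Im a) * indicator {0<..} (Im b - Im z))"
    unfolding box_bump_def by (intro tendsto_mult flat_exp_0_scale_tendsto)
  also have "indicator {0<..} (Re z - Re a) * indicator {0<..} (Re b - Re z) *
     (indicator {0<..} (Im z - Im a) * indicator {0<..} (Im b - Im z)) = (indicator (box a b) z :: real)"
    by (auto simp: in_box_complex_iff split: split_indicator)
  finally show ?thesis .
qed

lemma box_bump_nonzero: "box_bump a b n z \<noteq> 0 \<Longrightarrow> z \<in> box a b"
  by (auto simp: box_bump_def flat_exp_def in_box_complex_iff zero_less_mult_iff split: if_splits)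

lemma test_fun_box_bump:
  assumes "cbox a b \<subseteq> U"
  shows "test_fun U (box_bump a b n)"
proof -
  have "smooth_class (box_bump a b n)"
    unfolding box_bump_def[abs_def]
    by (intro smooth_class.intros smooth_class_diff)
  moreover have "closure {z. box_bump a b n z \<noteq> 0} \<subseteq> cbox a b"
    using box_subset_cbox[of a b] box_bump_nonzero[of a b n] by (intro closure_minimal) auto
  moreover have "bounded {z. box_bump a b n z \<noteq> 0}"
    using box_bump_nonzero[of a b n] by (intro bounded_subset[OF bounded_box[of a b]]) auto
  ultimately show ?thesis
    using assms by (auto simp: test_fun_def smooth_class_smooth_fun)
qed

section \<open>Cauchy and Poisson integrals\<close>

text \<open>\<open>2 * pi\<close> times the Cauchy integral of \<open>g\<close> along the circle,
  with \<open>d\<zeta> = \<i> * cis \<theta> d\<theta>\<close> substituted.\<close>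

definition cauchy_int :: "(real \<Rightarrow> complex) \<Rightarrow> complex \<Rightarrow> complex" where
  "cauchy_int g z = integral {0..2*pi} (\<lambda>\<theta>. g \<theta> * cis \<theta> / (cis \<theta> - z))"

definition cauchy_int_deriv :: "(real \<Rightarrow> complex) \<Rightarrow> complex \<Rightarrow> complex" where
  "cauchy_int_deriv g z = integral {0..2*pi} (\<lambda>\<theta>. g \<theta> * cis \<theta> / (cis \<theta> - z)\<^sup>2)"

lemma cis_neq_ball: "norm z < 1 \<Longrightarrow> cis \<theta> \<noteq> z"
  by auto

lemma continuous_on_cauchy_kernel:
  assumes "continuous_on UNIV g"
  shows "continuous_on (ball 0 1 \<times> cbox 0 (2*pi)) (\<lambda>(z, \<theta>). g \<theta> * cis \<theta> / (cis \<theta> - z)\<^sup>2)"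
  unfolding split_beta
  by (intro continuous_intros continuous_on_compose2[OF assms]) (auto simp: cis_neq_ball)

lemma cauchy_int_integrable:
  assumes "continuous_on UNIV g" "norm z < 1"
  shows "(\<lambda>\<theta>. g \<theta> * cis \<theta> / (cis \<theta> - z) ^ n) integrable_on {0..2*pi}"
  using cis_neq_ball[OF assms(2)]
  by (intro integrable_continuous_interval continuous_intros continuous_on_subset[OF assms(1)]) auto

lemma cauchy_int_has_field_derivative:
  assumes "continuous_on UNIV g" "norm z < 1"
  shows "(cauchy_int g has_field_derivative cauchy_int_deriv g z) (at z)"
proof -
  have "((\<lambda>z. integral (cbox 0 (2*pi)) (\<lambda>\<theta>. g \<theta> * cis \<theta> / (cis \<theta> - z))) has_field_derivative
     integral (cbox 0 (2*pi)) (\<lambda>\<theta>. g \<theta> * cis \<theta> / (cis \<theta> - z)\<^sup>2)) (at z within ball 0 1)"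
  proof (rule leibniz_rule_field_derivative)
    fix x :: complex and t :: real assume x: "x \<in> ball 0 1"
    have "cis t \<noteq> x" using cis_neq_ball x by simp
    then show "((\<lambda>x. g t * cis t / (cis t - x)) has_field_derivative g t * cis t / (cis t - x)\<^sup>2) (at x within ball 0 1)"
      by (auto intro!: derivative_eq_intros simp: power2_eq_square)
    show "(\<lambda>\<theta>. g \<theta> * cis \<theta> / (cis \<theta> - x)) integrable_on cbox 0 (2*pi)"
      using cauchy_int_integrable[OF assms(1), of x 1] x by simp
  qed (use assms continuous_on_cauchy_kernel in auto)
  moreover have "at z within ball 0 1 = at z"
    using assms by (intro at_within_open) auto
  ultimately show ?thesis
    unfolding cauchy_int_def[abs_def] cauchy_int_deriv_def by (simp only: cbox_interval)
qed

lemma continuous_on_cauchy_int_deriv: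
  assumes "continuous_on UNIV g"
  shows "continuous_on (ball 0 1) (cauchy_int_deriv g)"
  using integral_continuous_on_param[OF continuous_on_cauchy_kernel[OF assms]]
  by (simp add: cauchy_int_deriv_def[abs_def])

text \<open>The integrand has the primitive \<open>c * \<i> / (cis \<theta> - z)\<close>, which
  takes the same value at both ends of the period.\<close>

lemma cauchy_int_deriv_const:
  assumes "norm z < 1"
  shows "cauchy_int_deriv (\<lambda>_. c) z = 0"
proof -
  have "((\<lambda>\<theta>. c * cis \<theta> / (cis \<theta> - z)\<^sup>2) has_integral (c * \<i> / (cis (2*pi) - z) - c * \<i> / (cis 0 - z))) {0..2*pi}"
  proof (rule fundamental_theorem_of_calculus)
    fix x :: real
    have "cis x \<noteq> z" using cis_neq_ball assms by simp
    moreover have "c * \<i> * (E * \<i>) = - (c * E)" for E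
    proof -
      have "c * \<i> * (E * \<i>) = (c * E) * (\<i> * \<i>)" by (simp only: mult_ac)
      then show ?thesis by simp
    qed
    ultimately have "((\<lambda>w. c * \<i> / (exp (\<i> * w) - z)) has_field_derivative c * cis x / (cis x - z)\<^sup>2) (at (of_real x))"
      by (auto intro!: derivative_eq_intros simp: power2_eq_square cis_conv_exp)
    from has_vector_derivative_real_field[OF this]
    show "((\<lambda>\<theta>. c * \<i> / (cis \<theta> - z)) has_vector_derivative c * cis x / (cis x - z)\<^sup>2) (at x within {0..2*pi})"
      by (simp add: cis_conv_exp)
  qed auto
  then show ?thesis by (simp add: cauchy_int_deriv_def integral_unique)
qed

text \<open>The derivative vanishes by \<open>cauchy_int_deriv_const\<close>, so the value is that
  at the centre, where the integrand is 1.\<close>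

lemma cauchy_int_one:
  assumes "norm z < 1"
  shows "cauchy_int (\<lambda>_. 1) z = of_real (2 * pi)"
proof -
  have "\<exists>c. \<forall>w\<in>ball 0 1. cauchy_int (\<lambda>_. 1) w = c"
  proof (rule has_field_derivative_zero_constant)
    fix w :: complex assume "w \<in> ball 0 1"
    then show "(cauchy_int (\<lambda>_. 1) has_field_derivative 0) (at w within ball 0 1)"
      using cauchy_int_has_field_derivative[of "\<lambda>_. 1" w] cauchy_int_deriv_const[of w 1]
      by (auto intro: has_field_derivative_at_within)
  qed auto
  then have "cauchy_int (\<lambda>_. 1) z = cauchy_int (\<lambda>_. 1) 0"
    using assms by (metis centre_in_ball dist_0_norm mem_ball zero_less_one)
  then show ?thesis by (simp add: cauchy_int_def of_real_def)
qed

text \<open>The cancellation behind all differences \<open>\<phi> \<theta> - \<phi> t\<close>: with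
  \<open>c = g t\<close> the near-singularity of the kernel meets a factor that vanishes at
  \<open>t\<close>.\<close>

lemma cauchy_int_deriv_diff_const:
  assumes "continuous_on UNIV g" "norm z < 1"
  shows "cauchy_int_deriv (\<lambda>\<theta>. g \<theta> - c) z = cauchy_int_deriv g z"
proof -
  have "cauchy_int_deriv (\<lambda>\<theta>. g \<theta> - c) z = integral {0..2*pi} (\<lambda>\<theta>. g \<theta> * cis \<theta> / (cis \<theta> - z)\<^sup>2 - c * cis \<theta> / (cis \<theta> - z)\<^sup>2)"
    by (simp add: cauchy_int_deriv_def left_diff_distrib diff_divide_distrib)
  also have "\<dots> = cauchy_int_deriv g z - cauchy_int_deriv (\<lambda>_. c) z"
    unfolding cauchy_int_deriv_def
    by (intro integral_diff cauchy_int_integrable assms) auto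
  finally show ?thesis using cauchy_int_deriv_const assms by simp
qed

lemma norm_cauchy_int_deriv_le:
  assumes g: "continuous_on UNIV g" and z: "norm z < 1"
  shows "ennreal (norm (cauchy_int_deriv g z)) \<le>
    (\<integral>\<^sup>+\<theta>. ennreal (norm (g \<theta> - c) / (norm (cis \<theta> - z))\<^sup>2) * indicator {0..2*pi} \<theta> \<partial>lborel)"
proof -
  have g': "continuous_on UNIV (\<lambda>\<theta>. g \<theta> - c)"
    by (intro continuous_intros g)
  let ?N = "\<lambda>\<theta>. norm (g \<theta> - c) / (norm (cis \<theta> - z))\<^sup>2"
  have int: "?N integrable_on {0..2*pi}"
    using cis_neq_ball[OF z]
    by (intro integrable_continuous_interval continuous_intros continuous_on_subset[OF g]) auto
  have "norm (cauchy_int_deriv g z) = norm (cauchy_int_deriv (\<lambda>\<theta>. g \<theta> - c) z)"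
    using cauchy_int_deriv_diff_const[OF g z] by simp
  also have "\<dots> \<le> integral {0..2*pi} ?N"
    unfolding cauchy_int_deriv_def
    by (rule integral_norm_bound_integral[OF cauchy_int_integrable[OF g' z] int])
       (simp add: norm_divide norm_mult norm_power)
  finally have "ennreal (norm (cauchy_int_deriv g z)) \<le> ennreal (integral {0..2*pi} ?N)"
    by (rule ennreal_leI)
  also have "\<dots> = (\<integral>\<^sup>+\<theta>. ennreal (?N \<theta>) * indicator {0..2*pi} \<theta> \<partial>lborel)"
    using int by (intro nn_integral_has_integral_lebesgue'[symmetric]) (auto simp: integrable_integral)
  finally show ?thesis .
qed

section \<open>The Poisson kernel\<close>

definition poisson_kernel :: "complex \<Rightarrow> real \<Rightarrow> real" where
  "poisson_kernel z \<theta> = (1 - (norm z)\<^sup>2) / (norm (z - cis \<theta>))\<^sup>2"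

text \<open>The kernel is \<open>2 * Re (\<zeta> / (\<zeta> - z)) - 1\<close> with
  \<open>\<zeta> = cis \<theta>\<close>. The first term is holomorphic in \<open>z\<close> and the
  second antiholomorphic, which splits the Poisson integral into a Cauchy integral, a conjugated one
  and a constant.\<close>

lemma poisson_kernel_eq:
  assumes "norm z < 1"
  shows "of_real (poisson_kernel z \<theta>) = cis \<theta> / (cis \<theta> - z) + cnj (cis \<theta> / (cis \<theta> - z)) - 1"
proof -
  have ne: "cis \<theta> - z \<noteq> 0" using cis_neq_ball[OF assms] by simp
  then have ne': "cnj (cis \<theta>) - cnj z \<noteq> 0"
    by (metis complex_cnj_diff complex_cnj_zero_iff)
  have c1: "cis \<theta> * cnj (cis \<theta>) = 1"
    by (simp add: complex_norm_square[symmetric])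
  have "of_real ((norm (z - cis \<theta>))\<^sup>2) = (cis \<theta> - z) * (cnj (cis \<theta>) - cnj z)"
    unfolding norm_minus_commute[of z] complex_norm_square by simp
  moreover have "of_real ((norm z)\<^sup>2) = z * cnj z"
    by (rule complex_norm_square)
  ultimately have "of_real (poisson_kernel z \<theta>) = (1 - z * cnj z) / ((cis \<theta> - z) * (cnj (cis \<theta>) - cnj z))"
    unfolding poisson_kernel_def by (simp only: of_real_divide of_real_diff of_real_1)
  also have "1 - z * cnj z = cis \<theta> * (cnj (cis \<theta>) - cnj z) + cnj (cis \<theta>) * (cis \<theta> - z) - (cis \<theta> - z) * (cnj (cis \<theta>) - cnj z)"
    using c1 by (simp add: algebra_simps)
  also have "\<dots> / ((cis \<theta> - z) * (cnj (cis \<theta>) - cnj z)) = cis \<theta> / (cis \<theta> - z) + cnj (cis \<theta>) / (cnj (cis \<theta>) - cnj z) - 1"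
    using ne ne' by (simp add: add_divide_distrib diff_divide_distrib)
  finally show ?thesis by simp
qed

lemma integral_cnj': "g integrable_on S \<Longrightarrow> integral S (\<lambda>x. cnj (g x)) = cnj (integral S g)"
  using integral_linear[OF _ bounded_linear_cnj, of g S] by (simp add: o_def)

lemma poisson_kernel_nonneg: "norm z < 1 \<Longrightarrow> 0 \<le> poisson_kernel z \<theta>"
  by (simp add: poisson_kernel_def abs_square_le_1 less_imp_le)

lemma continuous_on_poisson_kernel: "norm z < 1 \<Longrightarrow> continuous_on S (poisson_kernel z)"
  unfolding poisson_kernel_def using cis_neq_ball[of z]
  by (intro continuous_intros ballI) (metis cis_neq_ball norm_eq_zero power_eq_0_iff right_minus_eq)

lemma integral_poisson_kernel_mult:
  assumes g: "continuous_on UNIV g" and z: "norm z < 1"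
  shows "integral {0..2*pi} (\<lambda>\<theta>. of_real (poisson_kernel z \<theta>) * g \<theta>) =
     cauchy_int g z + cnj (cauchy_int (\<lambda>\<theta>. cnj (g \<theta>)) z) - integral {0..2*pi} g"
proof -
  have g': "continuous_on UNIV (\<lambda>\<theta>. cnj (g \<theta>))" by (intro continuous_intros g)
  note i = cauchy_int_integrable[OF g z, of 1, simplified] cauchy_int_integrable[OF g' z, of 1, simplified]
  have i3: "g integrable_on {0..2*pi}"
    by (intro integrable_continuous_interval continuous_on_subset[OF g]) auto
  have i4: "(\<lambda>\<theta>. cnj (cnj (g \<theta>) * cis \<theta> / (cis \<theta> - z))) integrable_on {0..2*pi}"
    using integrable_linear[OF i(2) bounded_linear_cnj] by (simp add: o_def)
  have "integral {0..2*pi} (\<lambda>\<theta>. of_real (poisson_kernel z \<theta>) * g \<theta>) =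
    integral {0..2*pi} (\<lambda>\<theta>. (g \<theta> * cis \<theta> / (cis \<theta> - z) + cnj (cnj (g \<theta>) * cis \<theta> / (cis \<theta> - z))) - g \<theta>)"
    by (intro integral_cong) (simp add: poisson_kernel_eq[OF z] algebra_simps)
  also have "\<dots> = cauchy_int g z + integral {0..2*pi} (\<lambda>\<theta>. cnj (cnj (g \<theta>) * cis \<theta> / (cis \<theta> - z))) - integral {0..2*pi} g"
    unfolding cauchy_int_def
    by (subst integral_diff[OF integrable_add[OF i(1) i4] i3], subst integral_add[OF i(1) i4]) simp
  also have "integral {0..2*pi} (\<lambda>\<theta>. cnj (cnj (g \<theta>) * cis \<theta> / (cis \<theta> - z))) = cnj (cauchy_int (\<lambda>\<theta>. cnj (g \<theta>)) z)"
    unfolding cauchy_int_def by (rule integral_cnj'[OF i(2)])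
  finally show ?thesis .
qed

lemma integral_poisson_kernel:
  assumes z: "norm z < 1"
  shows "(poisson_kernel z has_integral 2 * pi) {0..2*pi}"
proof -
  have i: "poisson_kernel z integrable_on {0..2*pi}"
    by (intro integrable_continuous_interval continuous_on_poisson_kernel z)
  have "of_real (integral {0..2*pi} (poisson_kernel z)) = integral {0..2*pi} (\<lambda>\<theta>. complex_of_real (poisson_kernel z \<theta>))"
    using integral_linear[OF i bounded_linear_of_real[where 'a=complex]] by (simp add: o_def)
  also have "\<dots> = of_real (2 * pi)"
    using integral_poisson_kernel_mult[of "\<lambda>_. 1" z] z by (simp add: cauchy_int_one of_real_def)
  finally have "integral {0..2*pi} (poisson_kernel z) = 2 * pi"
    by (simp only: of_real_eq_iff)
  then show ?thesis using i by (metis integrable_integral)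
qed

section \<open>The harmonic extension of a circle-valued map\<close>

locale circle_map =
  fixes f :: "complex \<Rightarrow> complex"
  assumes continuous: "continuous_on (sphere 0 1) f"
    and maps: "\<And>z. norm z = 1 \<Longrightarrow> norm (f z) = 1"
begin

definition \<phi> :: "real \<Rightarrow> complex" where "\<phi> \<theta> = f (cis \<theta>)"

lemma continuous_\<phi>: "continuous_on S \<phi>"
  unfolding \<phi>_def[abs_def]
  by (intro continuous_on_compose2[OF continuous] continuous_intros) auto

lemma borel_measurable_\<phi> [measurable]: "\<phi> \<in> borel_measurable borel"
  using continuous_\<phi> by (rule borel_measurable_continuous_onI)

lemma norm_\<phi> [simp]: "norm (\<phi> \<theta>) = 1"
  by (simp add: \<phi>_def maps)

text \<open>\<open>\<alpha> = \<partial>h/\<partial>z\<close> and \<open>cnj \<beta> = \<partial>h/\<partial>(cnj z)\<close> for \<open>h = harmonic_ext f\<close>.\<close>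

definition \<alpha> :: "complex \<Rightarrow> complex" where
  "\<alpha> z = cauchy_int_deriv \<phi> z / of_real (2 * pi)"

definition \<beta> :: "complex \<Rightarrow> complex" where
  "\<beta> z = cauchy_int_deriv (\<lambda>\<theta>. cnj (\<phi> \<theta>)) z / of_real (2 * pi)"

lemma continuous_on_\<alpha>: "continuous_on (ball 0 1) \<alpha>"
  unfolding \<alpha>_def[abs_def]
  by (intro continuous_intros continuous_on_cauchy_int_deriv continuous_\<phi>) auto

lemma continuous_on_\<beta>: "continuous_on (ball 0 1) \<beta>"
  unfolding \<beta>_def[abs_def]
  by (intro continuous_intros continuous_on_cauchy_int_deriv continuous_\<phi>) auto

lemma harmonic_ext_eq_poisson:
  assumes "norm z < 1"
  shows "harmonic_ext f z = integral {0..2*pi} (\<lambda>\<theta>. of_real (poisson_kernel z \<theta>) * \<phi> \<theta>) / of_real (2 * pi)"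
  using assms by (simp add: harmonic_ext_def poisson_kernel_def \<phi>_def)

lemma harmonic_ext_has_derivative:
  assumes z: "norm z < 1"
  shows "(harmonic_ext f has_derivative (\<lambda>v. \<alpha> z * v + cnj (\<beta> z * v))) (at z)"
proof -
  have c': "continuous_on UNIV (\<lambda>\<theta>. cnj (\<phi> \<theta>))"
    by (intro continuous_intros continuous_\<phi>)
  let ?B = "cauchy_int (\<lambda>\<theta>. cnj (\<phi> \<theta>))" and ?B' = "cauchy_int_deriv (\<lambda>\<theta>. cnj (\<phi> \<theta>)) z"
  let ?h = "\<lambda>z. (1 / of_real (2 * pi)) * (cauchy_int \<phi> z + cnj (?B z) - integral {0..2*pi} \<phi>)"
  have 1: "(cauchy_int \<phi> has_derivative (*) (cauchy_int_deriv \<phi> z)) (at z)"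
    using cauchy_int_has_field_derivative[OF continuous_\<phi> z] unfolding has_field_derivative_def .
  have 2: "(?B has_derivative (*) ?B') (at z)"
    using cauchy_int_has_field_derivative[OF c' z] unfolding has_field_derivative_def .
  have "(?h has_derivative (\<lambda>v. (1 / of_real (2 * pi)) * (cauchy_int_deriv \<phi> z * v + cnj (?B' * v) - 0))) (at z)"
    by (intro has_derivative_mult_right has_derivative_diff has_derivative_add has_derivative_cnj has_derivative_const 1 2)
  also have "(\<lambda>v. (1 / of_real (2 * pi)) * (cauchy_int_deriv \<phi> z * v + cnj (?B' * v) - 0)) = (\<lambda>v. \<alpha> z * v + cnj (\<beta> z * v))"
    by (auto simp: \<alpha>_def \<beta>_def add_divide_distrib)
  finally show ?thesis
    by (rule has_derivative_transform_within_open[where s="ball 0 1"])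
       (use z in \<open>auto simp: harmonic_ext_eq_poisson integral_poisson_kernel_mult[OF continuous_\<phi>]\<close>)
qed

lemma continuous_on_harmonic_ext: "continuous_on (ball 0 1) (harmonic_ext f)"
  by (intro continuous_at_imp_continuous_on ballI has_derivative_continuous[OF harmonic_ext_has_derivative]) auto

text \<open>The kernel has total mass \<open>2 * pi\<close>, so \<open>w\<close> may be moved under
  the integral. Used with \<open>w = 0\<close> for boundedness and with \<open>w = \<phi> t\<close>
  for boundary values.\<close>

lemma norm_harmonic_ext_diff_le:
  assumes z: "norm z < 1"
  shows "norm (harmonic_ext f z - w) \<le> integral {0..2*pi} (\<lambda>\<theta>. poisson_kernel z \<theta> * norm (\<phi> \<theta> - w)) / (2 * pi)"
proof -
  have i1: "(\<lambda>\<theta>. of_real (poisson_kernel z \<theta>) * \<phi> \<theta>) integrable_on {0..2*pi}"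
    and i2: "(\<lambda>\<theta>. of_real (poisson_kernel z \<theta>) * w) integrable_on {0..2*pi}"
    and i3: "(\<lambda>\<theta>. poisson_kernel z \<theta> * norm (\<phi> \<theta> - w)) integrable_on {0..2*pi}"
    by (intro integrable_continuous_interval continuous_intros continuous_on_poisson_kernel z continuous_\<phi>)+
  have i4: "(\<lambda>\<theta>. of_real (poisson_kernel z \<theta>) * (\<phi> \<theta> - w)) integrable_on {0..2*pi}"
    by (intro integrable_continuous_interval continuous_intros continuous_on_poisson_kernel z continuous_\<phi>)
  have "((\<lambda>\<theta>. poisson_kernel z \<theta> *\<^sub>R w) has_integral (2 * pi) *\<^sub>R w) {0..2*pi}"
    using has_integral_linear[OF integral_poisson_kernel[OF z] bounded_linear_scaleR_left[of w]] by (simp add: o_def)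
  then have "integral {0..2*pi} (\<lambda>\<theta>. of_real (poisson_kernel z \<theta>) * w) = of_real (2 * pi) * w"
    using integral_unique by (simp only: scaleR_conv_of_real)
  then have "harmonic_ext f z - w = integral {0..2*pi} (\<lambda>\<theta>. of_real (poisson_kernel z \<theta>) * (\<phi> \<theta> - w)) / of_real (2 * pi)"
    using z integral_diff[OF i1 i2] by (auto simp add: harmonic_ext_eq_poisson right_diff_distrib diff_divide_distrib)
  moreover have "norm (integral {0..2*pi} (\<lambda>\<theta>. of_real (poisson_kernel z \<theta>) * (\<phi> \<theta> - w)))
     \<le> integral {0..2*pi} (\<lambda>\<theta>. poisson_kernel z \<theta> * norm (\<phi> \<theta> - w))"
    by (rule integral_norm_bound_integral[OF i4 i3]) (simp add: norm_mult poisson_kernel_nonneg z)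
  ultimately show ?thesis
    by (simp add: norm_divide divide_right_mono)
qed

lemma norm_harmonic_ext_le:
  assumes z: "norm z < 1"
  shows "norm (harmonic_ext f z) \<le> 1"
  using norm_harmonic_ext_diff_le[OF z, of 0] integral_unique[OF integral_poisson_kernel[OF z]]
  by simp

text \<open>An approximate identity: near \<open>cis t\<close> continuity makes the difference
  small, and away from it the kernel tends to 0 with \<open>1 - r\<close>. The limit is needed
  because integrating the derivative along a radius stays inside the open disk.\<close>

lemma harmonic_ext_radial_limit:
  "((\<lambda>r. harmonic_ext f (of_real r * cis t)) \<longlongrightarrow> \<phi> t) (at_left 1)"
proof (rule tendstoI)
  fix e :: real assume e: "e > 0"
  obtain d where d: "d > 0" "\<And>w. norm w = 1 \<Longrightarrow> dist w (cis t) < d \<Longrightarrow> dist (f w) (f (cis t)) < e / 2"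
    using continuous e unfolding continuous_on_iff by (metis dist_0_norm half_gt_zero_iff mem_sphere norm_cis)
  have "((\<lambda>r. 8 * (1 - r\<^sup>2) / d\<^sup>2) \<longlongrightarrow> 8 * (1 - 1\<^sup>2) / d\<^sup>2) (at_left (1::real))"
    by (intro tendsto_intros) (use d in auto)
  then have "\<forall>\<^sub>F r in at_left 1. 8 * (1 - r\<^sup>2) / d\<^sup>2 < e / 2"
    using e by (intro order_tendstoD(2)) auto
  \<comment> \<open>This puts \<open>z\<close> within \<open>d / 2\<close> of \<open>cis t\<close>,
    hence at least \<open>d / 2\<close> away from each circle point outside the
    \<open>d\<close>-neighbourhood; \<open>r > 0\<close> gives \<open>norm z = r\<close>.\<close>
  moreover have "\<forall>\<^sub>F r in at_left (1::real). r > max 0 (1 - d / 2)"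
    using d by (auto simp: eventually_at_left_field intro!: exI[of _ "max 0 (1 - d / 2)"])
  moreover have "\<forall>\<^sub>F r in at_left (1::real). r < 1"
    by (simp add: eventually_at_left_field) (metis zero_less_one)
  ultimately show "\<forall>\<^sub>F r in at_left 1. dist (harmonic_ext f (of_real r * cis t)) (\<phi> t) < e"
  proof eventually_elim
    case (elim r)
    define z where "z = of_real r * cis t"
    have nz: "norm z = r" using elim by (simp add: z_def norm_mult)
    then have z: "norm z < 1" using elim by simp
    have i: "poisson_kernel z integrable_on {0..2*pi}"
      by (intro integrable_continuous_interval continuous_on_poisson_kernel z)
    have zt: "norm (z - cis t) = 1 - r"
    proof -
      have "z - cis t = of_real (r - 1) * cis t" by (simp add: z_def algebra_simps)
      then show ?thesis using elim by (simp add: norm_mult del: of_real_diff)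
    qed
    have r2: "0 \<le> 1 - r\<^sup>2" using elim by (simp add: power_le_one)
    \<comment> \<open>Near and far bounds are added, so the integral need not be split; 8 is the
      largest difference 2 times the 4 from \<open>(d / 2)\<^sup>2\<close>.\<close>
    have pw: "poisson_kernel z \<theta> * norm (\<phi> \<theta> - \<phi> t) \<le> e / 2 * poisson_kernel z \<theta> + 8 * (1 - r\<^sup>2) / d\<^sup>2" for \<theta>
    proof (cases "dist (cis \<theta>) (cis t) < d")
      case True
      then have "norm (\<phi> \<theta> - \<phi> t) \<le> e / 2"
        using d(2)[of "cis \<theta>"] by (simp add: \<phi>_def dist_norm)
      then have "poisson_kernel z \<theta> * norm (\<phi> \<theta> - \<phi> t) \<le> poisson_kernel z \<theta> * (e / 2)"
        by (intro mult_left_mono poisson_kernel_nonneg z)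
      moreover have "0 \<le> 8 * (1 - r\<^sup>2) / d\<^sup>2"
        by (intro divide_nonneg_nonneg mult_nonneg_nonneg r2) auto
      ultimately show ?thesis by (simp add: mult.commute)
    next
      case False
      have "d \<le> norm (cis \<theta> - cis t)" using False by (simp add: dist_norm)
      also have "\<dots> \<le> norm (z - cis \<theta>) + norm (z - cis t)"
        using norm_triangle_ineq4[of "z - cis t" "z - cis \<theta>"] by (simp add: add.commute)
      finally have "d / 2 \<le> norm (z - cis \<theta>)" using zt elim by simp
      then have *: "(d / 2)\<^sup>2 \<le> (norm (z - cis \<theta>))\<^sup>2" using d by (intro power_mono) auto
      have "poisson_kernel z \<theta> \<le> (1 - r\<^sup>2) / (d / 2)\<^sup>2"
        unfolding poisson_kernel_def nz using * d r2 by (intro divide_left_mono) (auto intro!: mult_pos_pos intro: less_le_trans)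
      moreover have "norm (\<phi> \<theta> - \<phi> t) \<le> 2"
        using norm_triangle_ineq4[of "\<phi> \<theta>" "\<phi> t"] by simp
      ultimately have "poisson_kernel z \<theta> * norm (\<phi> \<theta> - \<phi> t) \<le> (1 - r\<^sup>2) / (d / 2)\<^sup>2 * 2"
        using r2 by (intro mult_mono) auto
      also have "\<dots> = 8 * (1 - r\<^sup>2) / d\<^sup>2" by (simp add: power_divide)
      finally show ?thesis
        using poisson_kernel_nonneg[OF z] e by (simp add: add_increasing)
    qed
    have "norm (harmonic_ext f z - \<phi> t) \<le> integral {0..2*pi} (\<lambda>\<theta>. poisson_kernel z \<theta> * norm (\<phi> \<theta> - \<phi> t)) / (2 * pi)"
      by (rule norm_harmonic_ext_diff_le[OF z])
    also have "\<dots> \<le> integral {0..2*pi} (\<lambda>\<theta>. e / 2 * poisson_kernel z \<theta> + 8 * (1 - r\<^sup>2) / d\<^sup>2) / (2 * pi)"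
      using pw by (intro divide_right_mono integral_le integrable_continuous_interval continuous_intros continuous_on_poisson_kernel z continuous_\<phi>) auto
    also have "integral {0..2*pi} (\<lambda>\<theta>. e / 2 * poisson_kernel z \<theta> + 8 * (1 - r\<^sup>2) / d\<^sup>2) = e / 2 * (2 * pi) + (2 * pi) * (8 * (1 - r\<^sup>2) / d\<^sup>2)"
      using integrable_cmul[OF i, of e]
      by (subst integral_add) (auto simp: integral_unique[OF integral_poisson_kernel[OF z]])
    also have "\<dots> / (2 * pi) = e / 2 + 8 * (1 - r\<^sup>2) / d\<^sup>2"
      by (simp add: field_simps)
    finally show ?case
      using elim(1) unfolding dist_norm z_def by linarith
  qed
qed

end

section \<open>Weak derivatives\<close>

text \<open>Difference quotients integrate to 0 by translation invariance; pass to the limit.\<close>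

lemma integral_directional_derivative_eq_0:
  fixes w :: "'a::euclidean_space \<Rightarrow> 'b::euclidean_space"
  assumes der: "\<And>z. (w has_derivative w' z) (at z)"
    and cont: "continuous_on UNIV (\<lambda>z. w' z v)"
    and K: "compact K" "\<And>z. z \<notin> K \<Longrightarrow> w z = 0" "\<And>z. z \<notin> K \<Longrightarrow> w' z v = 0"
  shows "(LINT z|lborel. w' z v) = 0"
proof -
  have contw: "continuous_on UNIV w"
    using der has_derivative_continuous continuous_at_imp_continuous_on by blast
  obtain R where R: "R > 0" "\<And>z. z \<in> K \<Longrightarrow> norm z \<le> R"
    using compact_imp_bounded[OF K(1)] by (auto simp: bounded_pos)
  have "compact ((\<lambda>z. w' z v) ` K)"
    by (intro compact_continuous_image K continuous_on_subset[OF cont]) auto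
  then obtain L where L: "L > 0" "\<And>z. z \<in> K \<Longrightarrow> norm (w' z v) \<le> L"
    by (force dest!: compact_imp_bounded simp: bounded_pos)
  have L': "norm (w' z v) \<le> L" for z
    using L K(3)[of z] by (cases "z \<in> K") auto
  have intw: "integrable lborel w"
  proof -
    have "integrable lborel (\<lambda>z. indicator K z *\<^sub>R w z)"
      by (intro borel_integrable_compact K continuous_on_subset[OF contw]) auto
    moreover have "(\<lambda>z. indicator K z *\<^sub>R w z) = w"
      using K(2) by (auto simp: fun_eq_iff split: split_indicator)
    ultimately show ?thesis by simp
  qed
  have line: "((\<lambda>s. w (z + s *\<^sub>R v)) has_vector_derivative w' (z + s *\<^sub>R v) v) (at s within S)" for z s S
  proof -
    have "((\<lambda>s. z + s *\<^sub>R v) has_derivative (\<lambda>s. s *\<^sub>R v)) (at s within S)"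
      by (auto intro!: derivative_eq_intros)
    from has_derivative_compose[OF this der]
    have "((\<lambda>s. w (z + s *\<^sub>R v)) has_derivative (\<lambda>x. w' (z + s *\<^sub>R v) (x *\<^sub>R v))) (at s within S)" .
    moreover have "linear (w' (z + s *\<^sub>R v))"
      using der has_derivative_linear by blast
    ultimately show ?thesis
      by (simp add: has_vector_derivative_def linear_cmul)
  qed
  have lip: "norm (w (z + t *\<^sub>R v) - w z) \<le> L * t" if "t \<ge> 0" for z t
  proof -
    have "((\<lambda>s. w' (z + s *\<^sub>R v) v) has_integral (w (z + t *\<^sub>R v) - w (z + 0 *\<^sub>R v))) {0..t}"
      by (rule fundamental_theorem_of_calculus[OF that line])
    then have "norm (w (z + t *\<^sub>R v) - w (z + 0 *\<^sub>R v)) \<le> L * measure lborel (cbox 0 t)"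
      using L L' by (intro has_integral_bound[where f="\<lambda>s. w' (z + s *\<^sub>R v) v"]) auto
    then show ?thesis using that by simp
  qed
  define d where "d n z = real (Suc n) *\<^sub>R (w (z + inverse (real (Suc n)) *\<^sub>R v) - w z)" for n z
  have zero: "(LINT z|lborel. d n z) = 0" for n
  proof -
    let ?c = "inverse (real (Suc n)) *\<^sub>R v"
    have [measurable]: "w \<in> borel_measurable borel"
      using contw by (rule borel_measurable_continuous_onI)
    have i: "integrable lborel (\<lambda>z. w (?c + z))"
      using intw by (subst (asm) lborel_distr_plus[of ?c, symmetric]) (simp add: integrable_distr_eq)
    have "(LINT z|lborel. w (?c + z)) = (LINT z|lborel. w z)"
      by (subst (2) lborel_distr_plus[of ?c, symmetric]) (simp add: integral_distr)
    then have "(LINT z|lborel. w (z + ?c) - w z) = 0"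
      using i intw by (simp add: Bochner_Integration.integral_diff add.commute)
    then show ?thesis unfolding d_def by simp
  qed
  have "(\<lambda>n. LINT z|lborel. d n z) \<longlonglongrightarrow> (LINT z|lborel. w' z v)"
  \<comment> \<open>The steps are at most 1 in direction \<open>v\<close>, so all quotients vanish
    outside the ball of radius \<open>R + norm v\<close>; inside it the mean value bound
    \<open>lip\<close> gives \<open>L\<close>.\<close>
  proof (rule integral_dominated_convergence[where w="\<lambda>z. indicator (cball 0 (R + norm v)) z *\<^sub>R L"])
    show "(\<lambda>z. w' z v) \<in> borel_measurable lborel"
      using borel_measurable_continuous_onI[OF cont] by simp
    have [measurable]: "w \<in> borel_measurable borel"
      using contw by (rule borel_measurable_continuous_onI)
    show "d n \<in> borel_measurable lborel" for n
      unfolding d_def[abs_def] by measurable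
    show "integrable lborel (\<lambda>z. indicator (cball 0 (R + norm v)) z *\<^sub>R L)"
      by (intro borel_integrable_compact continuous_intros) auto
    show "AE z in lborel. (\<lambda>n. d n z) \<longlonglongrightarrow> w' z v"
    proof (rule AE_I2)
      fix z
      have "((\<lambda>s. w (z + s *\<^sub>R v)) has_vector_derivative w' (z + 0 *\<^sub>R v) v) (at 0)"
        by (rule line)
      then have "(\<lambda>h. norm (w (z + h *\<^sub>R v) - w z - h *\<^sub>R w' z v) / norm h) \<midarrow>0\<rightarrow> 0"
        by (simp add: has_vector_derivative_def has_derivative_at)
      moreover have "\<forall>\<^sub>F h in at 0. norm (w (z + h *\<^sub>R v) - w z - h *\<^sub>R w' z v) / norm h
          = norm ((w (z + h *\<^sub>R v) - w z) /\<^sub>R h - w' z v)"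
      proof (rule eventually_at_filter[THEN iffD2], intro always_eventually allI impI)
        fix h :: real assume "h \<noteq> 0"
        then have "(w (z + h *\<^sub>R v) - w z) /\<^sub>R h - w' z v = (w (z + h *\<^sub>R v) - w z - h *\<^sub>R w' z v) /\<^sub>R h"
          by (simp add: scaleR_diff_right)
        then show "norm (w (z + h *\<^sub>R v) - w z - h *\<^sub>R w' z v) / norm h
          = norm ((w (z + h *\<^sub>R v) - w z) /\<^sub>R h - w' z v)"
          by (simp add: divide_inverse_commute)
      qed
      ultimately have "(\<lambda>h. norm ((w (z + h *\<^sub>R v) - w z) /\<^sub>R h - w' z v)) \<midarrow>0\<rightarrow> 0"
        by (rule Lim_transform_eventually)
      then have "(\<lambda>h. (w (z + h *\<^sub>R v) - w z) /\<^sub>R h) \<midarrow>0\<rightarrow> w' z v"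
        unfolding tendsto_norm_zero_iff LIM_zero_iff .
      moreover have "filterlim (\<lambda>n. inverse (real (Suc n))) (at 0) sequentially"
        unfolding filterlim_at using LIMSEQ_inverse_real_of_nat by auto
      ultimately have "(\<lambda>n. (w (z + inverse (real (Suc n)) *\<^sub>R v) - w z) /\<^sub>R inverse (real (Suc n))) \<longlonglongrightarrow> w' z v"
        by (rule filterlim_compose)
      then show "(\<lambda>n. d n z) \<longlonglongrightarrow> w' z v"
        by (simp add: d_def)
    qed
    show "AE z in lborel. norm (d n z) \<le> indicator (cball 0 (R + norm v)) z *\<^sub>R L" for n
    proof (rule AE_I2)
      fix z
      let ?c = "inverse (real (Suc n))"
      show "norm (d n z) \<le> indicator (cball 0 (R + norm v)) z *\<^sub>R L"
      proof (cases "z \<in> cball 0 (R + norm v)")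
        case True
        have "norm (d n z) \<le> real (Suc n) * (L * ?c)"
          unfolding d_def norm_scaleR using lip[of ?c z] by (intro mult_mono) auto
        also have "\<dots> = L" by (simp add: field_simps)
        finally show ?thesis using True by simp
      next
        case False
        then have z: "norm z > R + norm v" by simp
        then have "z \<notin> K" using R(2)[of z] norm_ge_zero[of v] by (auto simp del: norm_ge_zero)
        moreover have "z + ?c *\<^sub>R v \<notin> K"
        proof
          assume "z + ?c *\<^sub>R v \<in> K"
          then have "norm (z + ?c *\<^sub>R v) \<le> R" using R by auto
          moreover have "norm z - norm (?c *\<^sub>R v) \<le> norm (z + ?c *\<^sub>R v)"
            by (metis norm_diff_ineq)
          moreover have "norm (?c *\<^sub>R v) \<le> 1 * norm v"
            unfolding norm_scaleR by (intro mult_right_mono) (auto simp: field_simps)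
          ultimately show False using z by simp
        qed
        ultimately show ?thesis using False K(2) by (simp add: d_def)
      qed
    qed
  qed
  then show ?thesis
    unfolding zero by (simp add: LIMSEQ_const_iff)
qed

text \<open>\<open>U\<close> and \<open>- K\<close> are open and cover the space, and the extension
  is continuous on each: it is \<open>g\<close> on the first and 0 on the second.\<close>

lemma continuous_on_extend_by_zero:
  fixes g :: "'a::euclidean_space \<Rightarrow> 'b::real_normed_vector"
  assumes "continuous_on U g" "open U" "compact K" "K \<subseteq> U" "\<And>z. z \<in> U - K \<Longrightarrow> g z = 0"
  shows "continuous_on UNIV (\<lambda>z. if z \<in> U then g z else 0)"
proof -
  have "continuous_on (U \<union> - K) (\<lambda>z. if z \<in> U then g z else 0)"
  proof (rule continuous_on_open_Un)
    show "continuous_on U (\<lambda>z. if z \<in> U then g z else 0)"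
      using assms(1) by (rule continuous_on_eq) auto
    show "continuous_on (- K) (\<lambda>z. if z \<in> U then g z else 0)"
      using continuous_on_const[of "-K" 0] by (rule continuous_on_eq) (use assms in auto)
  qed (use assms compact_imp_closed in auto)
  moreover have "U \<union> - K = UNIV" using assms by auto
  ultimately show ?thesis by simp
qed

lemma integrable_extend_by_zero:
  fixes g :: "'a::euclidean_space \<Rightarrow> 'b::euclidean_space"
  assumes "continuous_on U g" "open U" "compact K" "K \<subseteq> U" "\<And>z. z \<in> U - K \<Longrightarrow> g z = 0"
  shows "integrable lborel (\<lambda>z. if z \<in> U then g z else 0)"
proof -
  have "integrable lborel (\<lambda>z. indicator K z *\<^sub>R g z)"
    using assms by (intro borel_integrable_compact) (auto intro: continuous_on_subset)
  moreover have "(\<lambda>z. indicator K z *\<^sub>R g z) = (\<lambda>z. if z \<in> U then g z else 0)"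
    using assms by (auto simp: fun_eq_iff split: split_indicator)
  ultimately show ?thesis by simp
qed

text \<open>The product of \<open>h\<close> and \<psi>, extended by 0, is differentiable on the
  whole plane, has compact support and a continuous derivative along \<open>v\<close>; that
  derivative therefore has integral 0, and the product rule splits it into the two sides of the
  identity.\<close>

theorem weak_deriv_on_classical:
  fixes h :: "complex \<Rightarrow> complex"
  assumes U: "open U" and der: "\<And>z. z \<in> U \<Longrightarrow> (h has_derivative h' z) (at z)"
    and cont: "continuous_on U (\<lambda>z. h' z v)" and v: "v \<in> {1, \<i>}"
  shows "weak_deriv_on U v h (\<lambda>z. h' z v)"
  unfolding weak_deriv_on_def
proof (intro allI impI)
  fix \<psi> assume \<psi>: "test_fun U \<psi>"
  define K where "K = closure {z. \<psi> z \<noteq> 0}"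
  have K: "compact K" "K \<subseteq> U" using \<psi> by (auto simp: test_fun_def K_def)
  have \<psi>0: "\<psi> z = 0" if "z \<notin> K" for z
    using that closure_subset[of "{z. \<psi> z \<noteq> 0}"] by (auto simp: K_def)
  define \<psi>' where "\<psi>' z = frechet_derivative \<psi> (at z)" for z
  have d\<psi>: "(\<psi> has_derivative \<psi>' z) (at z)" for z
    using \<psi> unfolding test_fun_def smooth_fun_def \<psi>'_def
    by (metis empty_subsetI fold_simps(1) frechet_derivative_works list.set(1))
  have pd: "partial_dir \<psi> v z = \<psi>' z v" for z
    by (simp add: partial_dir_def \<psi>'_def)
  \<comment> \<open>Smoothness enters through two lists: \<open>[]\<close> gave the derivative of
    \<psi>, and \<open>[v]\<close> gives the continuity of its component along
    \<open>v\<close>.\<close>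
  have "partial_dir \<psi> v differentiable (at z)" for z
    using \<psi> v unfolding test_fun_def smooth_fun_def by (auto dest!: spec[of _ "[v]"])
  then have cont\<psi>': "continuous_on UNIV (\<lambda>z. \<psi>' z v)"
    using differentiable_imp_continuous_within continuous_at_imp_continuous_on pd
    by (metis (no_types, lifting) ext)
  have cont\<psi>: "continuous_on UNIV \<psi>"
    using d\<psi> has_derivative_continuous continuous_at_imp_continuous_on by blast
  have \<psi>'0: "\<psi>' z v = 0" if "z \<notin> K" for z
  proof -
    have "((\<lambda>_. 0) has_derivative (\<lambda>_. 0)) (at z)" by simp
    then have "(\<psi> has_derivative (\<lambda>_. 0)) (at z)"
      by (rule has_derivative_transform_within_open[where s="-K"])
         (use that \<psi>0 K compact_imp_closed in auto)
    then show ?thesis using d\<psi> has_derivative_unique by metis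
  qed
  have conth: "continuous_on U h"
    using der has_derivative_continuous continuous_at_imp_continuous_on by blast
  let ?w = "\<lambda>z. if z \<in> U then h z * of_real (\<psi> z) else 0"
  let ?w' = "\<lambda>z u. if z \<in> U then h z * of_real (\<psi>' z u) + h' z u * of_real (\<psi> z) else 0"
  let ?k1 = "\<lambda>z. if z \<in> U then h z * of_real (\<psi>' z v) else 0"
  let ?k2 = "\<lambda>z. if z \<in> U then h' z v * of_real (\<psi> z) else 0"
  have i1: "integrable lborel ?k1"
    by (rule integrable_extend_by_zero[OF _ U K]) (auto intro!: continuous_intros conth continuous_on_subset[OF cont\<psi>'] simp: \<psi>'0)
  have i2: "integrable lborel ?k2"
    by (rule integrable_extend_by_zero[OF _ U K]) (auto intro!: continuous_intros cont continuous_on_subset[OF cont\<psi>] simp: \<psi>0)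
  have "(LINT z|lborel. ?w' z v) = 0"
  proof (rule integral_directional_derivative_eq_0[where w = ?w and w' = ?w' and v = v and K = K])
    show "(?w has_derivative ?w' z) (at z)" for z
    proof (cases "z \<in> U")
      case True
      have "((\<lambda>z. h z * of_real (\<psi> z)) has_derivative ?w' z) (at z)"
        using True by (auto intro!: derivative_eq_intros der d\<psi>)
      then show ?thesis
        by (rule has_derivative_transform_within_open[where s=U]) (use True U in auto)
    next
      case False
      have "((\<lambda>_. 0) has_derivative (\<lambda>_. 0)) (at z)" by simp
      then have "(?w has_derivative (\<lambda>_. 0)) (at z)"
        by (rule has_derivative_transform_within_open[where s="-K"])
           (use False \<psi>0 K compact_imp_closed in auto)
      then show ?thesis using False by simp
    qed
    show "continuous_on UNIV (\<lambda>z. ?w' z v)"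
      by (rule continuous_on_extend_by_zero[OF _ U K])
         (auto intro!: continuous_intros conth cont continuous_on_subset[OF cont\<psi>] continuous_on_subset[OF cont\<psi>'] simp: \<psi>0 \<psi>'0)
  qed (use K \<psi>0 \<psi>'0 in auto)
  also have "(\<lambda>z. ?w' z v) = (\<lambda>z. ?k1 z + ?k2 z)"
    by auto
  also have "(LINT z|lborel. ?k1 z + ?k2 z) = (LINT z|lborel. ?k1 z) + (LINT z|lborel. ?k2 z)"
    using i1 i2 by (rule Bochner_Integration.integral_add)
  finally have sum0: "(LINT z|lborel. ?k1 z) = - (LINT z|lborel. ?k2 z)"
    by (simp add: eq_neg_iff_add_eq_0)
  have "(LINT z:U|lebesgue. h z * of_real (partial_dir \<psi> v z)) = (LINT z|lebesgue. ?k1 z)"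
    unfolding set_lebesgue_integral_def pd by (rule Bochner_Integration.integral_cong) auto
  also have "\<dots> = (LINT z|lborel. ?k1 z)"
    using i1 by (intro integral_completion) auto
  also have "\<dots> = - (LINT z|lebesgue. ?k2 z)"
    unfolding sum0 using i2 by (subst integral_completion) auto
  also have "(LINT z|lebesgue. ?k2 z) = (LINT z:U|lebesgue. h' z v * of_real (\<psi> z))"
    unfolding set_lebesgue_integral_def by (rule Bochner_Integration.integral_cong) auto
  finally show "(LINT z:U|lebesgue. h z * of_real (partial_dir \<psi> v z)) = - (LINT z:U|lebesgue. h' z v * of_real (\<psi> z))" .
qed

section \<open>Uniqueness of weak derivatives\<close>

lemma sigma_finite_lebesgue: "sigma_finite_measure (lebesgue :: 'a::euclidean_space measure)"
proof
  obtain A :: "'a set set" where A: "countable A" "A \<subseteq> sets lborel" "\<Union>A = space lborel" "\<forall>a\<in>A. emeasure lborel a \<noteq> \<infinity>"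
    using lborel.sigma_finite_countable by blast
  then have "A \<subseteq> sets lebesgue" "\<forall>a\<in>A. emeasure lebesgue a \<noteq> \<infinity>"
    by auto
  then show "\<exists>A::'a set set. countable A \<and> A \<subseteq> sets lebesgue \<and> \<Union>A = space lebesgue \<and> (\<forall>a\<in>A. emeasure lebesgue a \<noteq> \<infinity>)"
    using A by (intro exI[of _ A]) auto
qed

text \<open>Dynkin's argument: the Borel sets over which \<open>u\<close> integrates to 0 contain
  the boxes, an intersection-stable generator, and are closed under countable disjoint unions. The
  whole space is not a box, so \<open>tot\<close> supplies the complements. Lebesgue sets differ
  from Borel sets by null sets.\<close>

lemma AE_zero_if_box_integrals_zero:
  fixes u :: "'a::euclidean_space \<Rightarrow> 'b::{banach, second_countable_topology}"
  assumes u: "integrable lebesgue u"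
    and box: "\<And>a b. (LINT z:box a b|lebesgue. u z) = 0" and tot: "(LINT z|lebesgue. u z) = 0"
  shows "AE z in lebesgue. u z = 0"
proof -
  interpret sigma_finite_measure "lebesgue :: 'a measure" by (rule sigma_finite_lebesgue)
  have si: "set_integrable lebesgue A u" if "A \<in> sets lebesgue" for A
    unfolding set_integrable_def using u that by (intro integrable_mult_indicator)
  have borel: "(LINT z:A|lebesgue. u z) = 0" if "A \<in> sets borel" for A
  proof -
    have "Int_stable (range (\<lambda>(a, b). box a b :: 'a set))"
      by (auto simp: Int_stable_def box_Int_box)
    moreover have "range (\<lambda>(a, b). box a b :: 'a set) \<subseteq> Pow UNIV" by simp
    moreover have "A \<in> sigma_sets UNIV (range (\<lambda>(a, b). box a b))"
      using that unfolding borel_eq_box by simp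
    ultimately show ?thesis
    proof (induction rule: sigma_sets_induct_disjoint)
      case (basic A)
      then show ?case using box by auto
    next
      case empty
      show ?case by (simp add: set_lebesgue_integral_def)
    next
      case (compl A)
      then have A: "A \<in> sets lebesgue" using borel_eq_box by (metis sets_completionI_sets sets_lborel sets_measure_of top_greatest Pow_UNIV)
      have "(LINT z|lebesgue. u z) = (LINT z:(A \<union> (UNIV - A))|lebesgue. u z)"
        by (simp add: set_lebesgue_integral_def)
      also have "\<dots> = (LINT z:A|lebesgue. u z) + (LINT z:UNIV - A|lebesgue. u z)"
        using A by (intro set_integral_Un si) auto
      finally show ?case using compl tot by simp
    next
      case (union A)
      then have A: "A i \<in> sets lebesgue" for i using borel_eq_box by (metis range_subsetD sets_completionI_sets sets_lborel sets_measure_of top_greatest Pow_UNIV)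
      have "(LINT z:(\<Union>i. A i)|lebesgue. u z) = (\<Sum>i. (LINT z:A i|lebesgue. u z))"
        using union A by (intro lebesgue_integral_countable_add si) (auto simp: disjoint_family_on_def)
      then show ?case using union by simp
    qed
  qed
  show ?thesis
  proof (rule density_zero[OF u])
    fix A :: "'a set" assume "A \<in> sets lebesgue"
    then obtain S N N' where A: "A = S \<union> N" "N \<subseteq> N'" "N' \<in> null_sets lborel" "S \<in> sets lborel"
      by (rule sets_completionE)
    have S: "S \<in> sets lebesgue" using A by simp
    have "AE z in lebesgue. z \<notin> N'"
      using A by (intro AE_completion AE_not_in)
    then have "AE z in lebesgue. indicator A z *\<^sub>R u z = indicator S z *\<^sub>R u z"
      by eventually_elim (use A in \<open>auto split: split_indicator\<close>)
    then have "(LINT z:A|lebesgue. u z) = (LINT z:S|lebesgue. u z)"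
      unfolding set_lebesgue_integral_def
      using si[OF S] si[OF \<open>A \<in> sets lebesgue\<close>]
      by (intro integral_cong_AE) (auto simp: set_integrable_def)
    then show "(LINT z:A|lebesgue. u z) = 0" using borel A by simp
  qed
qed

text \<open>Bumps converge to the indicator of a box, so dominated convergence turns the hypothesis
  into vanishing box integrals. These determine \<open>u\<close> almost everywhere on each closed
  box inside \<open>U\<close>, and countably many such boxes exhaust \<open>U\<close>.\<close>

theorem fundamental_lemma_calculus_of_variations:
  fixes u :: "complex \<Rightarrow> complex"
  assumes U: "open U"
    and loc: "\<And>a b. cbox a b \<subseteq> U \<Longrightarrow> set_integrable lebesgue (cbox a b) u"
    and test: "\<And>\<psi>. test_fun U \<psi> \<Longrightarrow> (LINT z:U|lebesgue. u z * of_real (\<psi> z)) = 0"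
  shows "AE z in lebesgue. z \<in> U \<longrightarrow> u z = 0"
proof -
  have box0: "(LINT z:box a b|lebesgue. u z) = 0" if "cbox a b \<subseteq> U" for a b
  proof -
    have i: "integrable lebesgue (\<lambda>z. indicator (cbox a b) z *\<^sub>R u z)"
      using loc[OF that] by (simp add: set_integrable_def)
    have [measurable]: "box_bump a b n \<in> borel_measurable lebesgue" for n
    proof -
      have "continuous_on UNIV (box_bump a b n)"
        using test_fun_box_bump[OF that, of n] unfolding test_fun_def smooth_fun_def
        by (metis continuous_at_imp_continuous_on differentiable_imp_continuous_within empty_subsetI fold_simps(1) list.set(1))
      then show ?thesis
        by (intro measurable_completion) (auto intro: borel_measurable_continuous_onI)
    qed
    define v where "v z = indicator (cbox a b) z *\<^sub>R u z" for z
    have i': "integrable lebesgue v" using i by (simp add: v_def[abs_def])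
    have [measurable]: "box a b \<in> sets lebesgue" by simp
    have [measurable]: "v \<in> borel_measurable lebesgue"
      using i' by (rule borel_measurable_integrable)
    have "(\<lambda>n. LINT z|lebesgue. v z * of_real (box_bump a b n z)) \<longlonglongrightarrow> (LINT z|lebesgue. v z * of_real (indicator (box a b) z))"
    proof (rule integral_dominated_convergence[where w="\<lambda>z. norm (v z)"])
      show "(\<lambda>z. v z * complex_of_real (indicator (box a b) z)) \<in> borel_measurable lebesgue"
        by measurable
      show "AE z in lebesgue. (\<lambda>n. v z * of_real (box_bump a b n z)) \<longlonglongrightarrow> v z * of_real (indicator (box a b) z)"
        by (intro AE_I2 tendsto_intros tendsto_of_real box_bump_tendsto)
      show "AE z in lebesgue. norm (v z * of_real (box_bump a b n z)) \<le> norm (v z)" for n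
        by (intro AE_I2) (auto simp: norm_mult box_bump_bounds intro!: mult_right_le_one_le)
    qed (use i' in \<open>auto intro!: integrable_norm\<close>)
    moreover have "(LINT z|lebesgue. v z * of_real (box_bump a b n z)) = 0" for n
    proof -
      have "(LINT z|lebesgue. v z * of_real (box_bump a b n z)) = (LINT z:U|lebesgue. u z * of_real (box_bump a b n z))"
        unfolding set_lebesgue_integral_def
      proof (rule Bochner_Integration.integral_cong)
        fix z
        show "v z * of_real (box_bump a b n z) = indicator U z *\<^sub>R (u z * of_real (box_bump a b n z))"
          unfolding v_def using that box_bump_nonzero[of a b n z] box_subset_cbox[of a b]
          by (cases "box_bump a b n z = 0") (auto split: split_indicator)
      qed simp
      then show ?thesis using test[OF test_fun_box_bump[OF that]] by simp
    qed
    ultimately have "(LINT z|lebesgue. v z * of_real (indicator (box a b) z)) = 0"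
      by (simp add: LIMSEQ_const_iff)
    also have "(\<lambda>z. v z * of_real (indicator (box a b) z)) = (\<lambda>z. indicator (box a b) z *\<^sub>R u z)"
      using box_subset_cbox[of a b] by (auto simp: v_def fun_eq_iff split: split_indicator)
    finally show ?thesis by (simp add: set_lebesgue_integral_def)
  qed
  have AEbox: "AE z in lebesgue. z \<in> cbox a b \<longrightarrow> u z = 0" if ab: "cbox a b \<subseteq> U" for a b
  proof -
    let ?v = "\<lambda>z. indicator (box a b) z *\<^sub>R u z"
    have eq: "?v = (\<lambda>z. indicator (box a b) z *\<^sub>R (indicator (cbox a b) z *\<^sub>R u z))"
      using box_subset_cbox[of a b] by (auto simp: fun_eq_iff split: split_indicator)
    have "integrable lebesgue ?v"
      by (subst eq) (rule integrable_mult_indicator[OF _ loc[OF ab, unfolded set_integrable_def]], simp)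
    then have "AE z in lebesgue. ?v z = 0"
    proof (rule AE_zero_if_box_integrals_zero)
      show "(LINT z|lebesgue. ?v z) = 0"
        using box0[OF ab] by (simp add: set_lebesgue_integral_def)
      fix c d
      obtain e f where ef: "box c d \<inter> box a b = box e f"
        using box_Int_box by blast
      \<comment> \<open>A nonempty open box has \<open>cbox e f\<close> as its closure, which keeps
        it inside \<open>cbox a b\<close>; an empty one says nothing about \<open>cbox e f\<close>,
        but its integral is 0 anyway.\<close>
      have "(LINT z:box e f|lebesgue. u z) = 0"
      proof (cases "box e f = {}")
        case False
        then have "cbox e f = closure (box e f)" by simp
        also have "\<dots> \<subseteq> closure (box a b)" using ef by (intro closure_mono) auto
        also have "\<dots> \<subseteq> cbox a b" by (intro closure_minimal box_subset_cbox) auto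
        finally show ?thesis using ab by (intro box0) auto
      qed (simp add: set_lebesgue_integral_def)
      moreover have "(LINT z:box c d|lebesgue. ?v z) = (LINT z:box e f|lebesgue. u z)"
        unfolding set_lebesgue_integral_def ef[symmetric]
        by (rule Bochner_Integration.integral_cong) (auto split: split_indicator)
      ultimately show "(LINT z:box c d|lebesgue. ?v z) = 0" by simp
    qed
    moreover have "AE z in lebesgue. z \<notin> cbox a b - box a b"
      using negligible_frontier_interval[of a b] by (intro AE_not_in) (simp add: negligible_iff_null_sets)
    ultimately show ?thesis
      by eventually_elim (auto split: split_indicator_asm)
  qed
  obtain D where D: "countable D" "D \<subseteq> Pow U" "\<And>X. X \<in> D \<Longrightarrow> \<exists>a b. X = cbox a b" "\<Union>D = U"
    using open_countable_Union_open_cbox[OF U] by metis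
  have "AE z in lebesgue. \<forall>X\<in>D. z \<in> X \<longrightarrow> u z = 0"
    using D AEbox by (subst AE_ball_countable) (auto, metis PowD subsetD)
  then show ?thesis
    by eventually_elim (use D in auto)
qed

lemma set_integrable_test_fun_mult:
  fixes g :: "complex \<Rightarrow> complex"
  assumes \<psi>: "test_fun U \<psi>"
    and loc: "\<And>K. compact K \<Longrightarrow> K \<subseteq> U \<Longrightarrow> set_integrable lebesgue K g"
  shows "set_integrable lebesgue U (\<lambda>z. g z * of_real (\<psi> z))"
proof -
  define K where "K = closure {z. \<psi> z \<noteq> 0}"
  have K: "compact K" "K \<subseteq> U" using \<psi> by (auto simp: test_fun_def K_def)
  have \<psi>0: "\<psi> z = 0" if "z \<notin> K" for z
    using that closure_subset[of "{z. \<psi> z \<noteq> 0}"] by (auto simp: K_def)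
  have cont: "continuous_on UNIV \<psi>"
    using \<psi> unfolding test_fun_def smooth_fun_def
    by (metis continuous_at_imp_continuous_on differentiable_imp_continuous_within empty_subsetI fold_simps(1) list.set(1))
  have [measurable]: "\<psi> \<in> borel_measurable lebesgue"
    using cont by (intro measurable_completion) (auto intro: borel_measurable_continuous_onI)
  have "compact (\<psi> ` K)"
    by (intro compact_continuous_image K continuous_on_subset[OF cont]) auto
  then obtain C where C: "C > 0" "\<And>z. z \<in> K \<Longrightarrow> \<bar>\<psi> z\<bar> \<le> C"
    by (force dest!: compact_imp_bounded simp: bounded_pos)
  define k where "k z = indicator K z *\<^sub>R g z" for z
  have k: "integrable lebesgue k"
    using loc[OF K] by (simp add: set_integrable_def k_def[abs_def])
  then have [measurable]: "k \<in> borel_measurable lebesgue"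
    by (rule borel_measurable_integrable)
  have "integrable lebesgue (\<lambda>z. k z * of_real (\<psi> z))"
  proof (rule Bochner_Integration.integrable_bound)
    show "integrable lebesgue (\<lambda>z. C * norm (k z))" using k by simp
    show "AE z in lebesgue. norm (k z * of_real (\<psi> z)) \<le> norm (C * norm (k z))"
      using C by (intro AE_I2) (auto simp: k_def norm_mult mult.commute intro!: mult_right_mono split: split_indicator)
  qed measurable
  also have "(\<lambda>z. k z * of_real (\<psi> z)) = (\<lambda>z. indicator U z *\<^sub>R (g z * of_real (\<psi> z)))"
    using K \<psi>0 by (auto simp: k_def fun_eq_iff split: split_indicator)
  finally show ?thesis by (simp add: set_integrable_def)
qed

theorem weak_deriv_on_unique:
  fixes g k :: "complex \<Rightarrow> complex"
  assumes U: "open U"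
    and g: "\<And>K. compact K \<Longrightarrow> K \<subseteq> U \<Longrightarrow> set_integrable lebesgue K g"
    and k: "\<And>K. compact K \<Longrightarrow> K \<subseteq> U \<Longrightarrow> set_integrable lebesgue K k"
    and "weak_deriv_on U v h g" "weak_deriv_on U v h k"
  shows "AE z in lebesgue. z \<in> U \<longrightarrow> g z = k z"
proof -
  have "AE z in lebesgue. z \<in> U \<longrightarrow> g z - k z = 0"
  proof (rule fundamental_lemma_calculus_of_variations[OF U])
    show "set_integrable lebesgue (cbox a b) (\<lambda>z. g z - k z)" if "cbox a b \<subseteq> U" for a b
      using g k that by (intro set_integral_diff) auto
    fix \<psi> assume \<psi>: "test_fun U \<psi>"
    have "(LINT z:U|lebesgue. (g z - k z) * of_real (\<psi> z)) =
      (LINT z:U|lebesgue. g z * of_real (\<psi> z) - k z * of_real (\<psi> z))"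
      by (simp add: left_diff_distrib)
    also have "\<dots> = (LINT z:U|lebesgue. g z * of_real (\<psi> z)) - (LINT z:U|lebesgue. k z * of_real (\<psi> z))"
      using g k by (intro set_integral_diff set_integrable_test_fun_mult[OF \<psi>])
    also have "\<dots> = 0"
      using assms(4,5) \<psi> unfolding weak_deriv_on_def by (metis diff_self neg_equal_iff_equal)
    finally show "(LINT z:U|lebesgue. (g z - k z) * of_real (\<psi> z)) = 0" .
  qed
  then show ?thesis by simp
qed

text \<open>On a set of finite measure \<open>norm (g z)\<close> is dominated by
  \<open>1 + norm (g z) powr p\<close>. This provides the local integrability under which weak
  derivatives are compared.\<close>

lemma Lp_on_imp_set_integrable:
  assumes L: "Lp_on U p g" and p: "1 < p" and U: "U \<in> sets lebesgue" "emeasure lebesgue U < \<infinity>"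
    and K: "K \<in> sets lebesgue" "K \<subseteq> U"
  shows "set_integrable lebesgue K g"
proof -
  have "(\<lambda>z. indicator U z *\<^sub>R g z) \<in> borel_measurable lebesgue"
    using L U by (simp add: Lp_on_def borel_measurable_restrict_space_iff)
  then have [measurable]: "(\<lambda>z. indicator U z *\<^sub>R g z) \<in> borel_measurable lebesgue" .
  have "integrable lebesgue (\<lambda>z. indicator U z *\<^sub>R g z)"
  proof (rule integrableI_bounded)
    have "(\<integral>\<^sup>+z. ennreal (norm (indicator U z *\<^sub>R g z)) \<partial>lebesgue) \<le> (\<integral>\<^sup>+z. indicator U z + ennreal (indicator U z * norm (g z) powr p) \<partial>lebesgue)"
    proof (rule nn_integral_mono)
      fix z
      have "norm (g z) \<le> 1 + norm (g z) powr p"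
      proof (cases "norm (g z) \<le> 1")
        case False
        then have "norm (g z) powr 1 \<le> norm (g z) powr p" using p by (intro powr_mono) auto
        then show ?thesis using False by simp
      qed (simp add: add_increasing2)
      then have "ennreal (norm (g z)) \<le> 1 + ennreal (norm (g z) powr p)"
        by (metis ennreal_1 ennreal_leI ennreal_plus powr_ge_zero zero_le_one)
      then show "ennreal (norm (indicator U z *\<^sub>R g z)) \<le> indicator U z + ennreal (indicator U z * norm (g z) powr p)"
        by (auto split: split_indicator)
    qed
    also have "\<dots> = emeasure lebesgue U + (\<integral>\<^sup>+z. ennreal (indicator U z * norm (g z) powr p) \<partial>lebesgue)"
    proof (subst nn_integral_add)
      have "(\<lambda>z. ennreal (norm (indicator U z *\<^sub>R g z) powr p)) \<in> borel_measurable lebesgue" by measurable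
      also have "(\<lambda>z. ennreal (norm (indicator U z *\<^sub>R g z) powr p)) = (\<lambda>z. ennreal (indicator U z * norm (g z) powr p))"
        using p by (auto simp: fun_eq_iff split: split_indicator)
      finally show "(\<lambda>z. ennreal (indicator U z * norm (g z) powr p)) \<in> borel_measurable lebesgue" .
    qed (use U in auto)
    also have "\<dots> < \<infinity>" using L U by (simp add: Lp_on_def)
    finally show "(\<integral>\<^sup>+z. ennreal (norm (indicator U z *\<^sub>R g z)) \<partial>lebesgue) < \<infinity>" .
  qed measurable
  then have "set_integrable lebesgue U g" by (simp add: set_integrable_def)
  then show ?thesis using K set_integrable_subset by blast
qed

lemma Lp_on_ball_le:
  assumes "continuous_on (ball 0 1) k" "\<And>z. norm z < 1 \<Longrightarrow> norm (k z) powr p \<le> F z"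
    "(\<integral>\<^sup>+z. ennreal (indicator (ball 0 1) z * F z) \<partial>lborel) < \<infinity>"
  shows "Lp_on (ball 0 1) p k"
proof -
  have "(\<integral>\<^sup>+z. ennreal (indicator (ball 0 1) z * norm (k z) powr p) \<partial>lebesgue) \<le> (\<integral>\<^sup>+z. ennreal (indicator (ball 0 1) z * F z) \<partial>lborel)"
    unfolding nn_integral_completion using assms(2)
    by (intro nn_integral_mono ennreal_leI) (auto split: split_indicator)
  moreover have "k \<in> borel_measurable (lebesgue_on (ball 0 1))"
    using assms(1) by (rule continuous_imp_measurable_on_sets_lebesgue) auto
  ultimately show ?thesis
    using assms(3) by (simp add: Lp_on_def le_less_trans)
qed

lemma powr_add_le:
  fixes a b p :: real
  assumes "0 \<le> a" "0 \<le> b" "0 \<le> p"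
  shows "(a + b) powr p \<le> 2 powr p * (a powr p + b powr p)"
proof -
  have "(a + b) powr p \<le> (2 * max a b) powr p"
    using assms by (intro powr_mono2) auto
  also have "\<dots> = 2 powr p * max a b powr p" using assms by (simp add: powr_mult)
  also have "\<dots> \<le> 2 powr p * (a powr p + b powr p)"
    by (intro mult_left_mono) (auto simp: max_def)
  finally show ?thesis .
qed

section \<open>The Sobolev condition in terms of the gradient\<close>

context circle_map
begin

text \<open>The operator norm of the derivative of the harmonic extension. The value 0 off the open
  disk turns integrals over the disk into integrals over the plane, and later over all positive
  radii.\<close>

definition G :: "complex \<Rightarrow> real" where
  "G z = (if norm z < 1 then norm (\<alpha> z) + norm (\<beta> z) else 0)"

lemma G_nonneg [simp]: "0 \<le> G z"
  by (simp add: G_def)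

lemma borel_measurable_G [measurable]: "G \<in> borel_measurable borel"
proof -
  have "(\<lambda>z. indicator (ball 0 1) z *\<^sub>R (norm (\<alpha> z) + norm (\<beta> z))) \<in> borel_measurable borel"
    by (intro borel_measurable_continuous_on_indicator continuous_intros continuous_on_\<alpha> continuous_on_\<beta>) auto
  also have "(\<lambda>z. indicator (ball 0 1) z *\<^sub>R (norm (\<alpha> z) + norm (\<beta> z))) = G"
    by (auto simp: G_def fun_eq_iff split: split_indicator)
  finally show ?thesis .
qed

definition dh :: "complex \<Rightarrow> complex \<Rightarrow> complex" where
  "dh v z = \<alpha> z * v + cnj (\<beta> z * v)"

lemma continuous_on_dh: "continuous_on (ball 0 1) (dh v)"
  unfolding dh_def[abs_def] by (intro continuous_intros continuous_on_\<alpha> continuous_on_\<beta>)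

lemma norm_dh_le_mult: "norm z < 1 \<Longrightarrow> norm (dh v z) \<le> G z * norm v"
  unfolding dh_def G_def by (rule order_trans[OF norm_triangle_ineq]) (simp add: norm_mult distrib_right)

lemma norm_dh_le: "norm v = 1 \<Longrightarrow> norm z < 1 \<Longrightarrow> norm (dh v z) \<le> G z"
  using norm_dh_le_mult[of z v] by simp

lemma weak_deriv_on_dh: "v \<in> {1, \<i>} \<Longrightarrow> weak_deriv_on (ball 0 1) v (harmonic_ext f) (dh v)"
  using harmonic_ext_has_derivative continuous_on_dh[of v]
  unfolding dh_def[abs_def] by (intro weak_deriv_on_classical) auto

lemma set_integrable_dh:
  assumes "compact K" "K \<subseteq> ball 0 1"
  shows "set_integrable lebesgue K (dh v)"
  using borel_integrable_compact[OF assms(1) continuous_on_subset[OF continuous_on_dh assms(2)]]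
  by (simp add: set_integrable_def integrable_completion)

text \<open>Weak partial derivatives agree almost everywhere with the classical \<open>dh 1\<close>
  and \<open>dh \<i>\<close>, and these are comparable with \<open>G\<close> in both directions. The
  function itself is bounded by 1 on a set of finite measure.\<close>

theorem sobolev_harmonic_ext_iff:
  assumes p: "1 < p"
  shows "sobolev_W1p (ball 0 1) p (harmonic_ext f) \<longleftrightarrow> (\<integral>\<^sup>+z. ennreal (G z powr p) \<partial>lborel) < \<infinity>"
proof
  assume fin: "(\<integral>\<^sup>+z. ennreal (G z powr p) \<partial>lborel) < \<infinity>"
  have Gp: "(\<lambda>z. ennreal (indicator (ball 0 1) z * G z powr p)) = (\<lambda>z. ennreal (G z powr p))"
    using p by (auto simp: fun_eq_iff G_def split: split_indicator)
  have "Lp_on (ball 0 1) p (dh v)" if "norm v = 1" for v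
    using that p fin by (intro Lp_on_ball_le[where F="\<lambda>z. G z powr p"] continuous_on_dh powr_mono2 norm_dh_le) (auto simp: Gp)
  moreover have "Lp_on (ball 0 1) p (harmonic_ext f)"
  proof (rule Lp_on_ball_le[where F="\<lambda>_. 1"])
    show "norm (harmonic_ext f z) powr p \<le> 1" if "norm z < 1" for z
      using powr_mono2[OF _ _ norm_harmonic_ext_le[OF that], of p] p by simp
    have "(\<integral>\<^sup>+z. ennreal (indicator (ball (0::complex) 1) z * 1) \<partial>lborel) = emeasure lborel (ball (0::complex) 1)"
      by (simp add: ennreal_indicator)
    also have "\<dots> < \<infinity>" by (rule emeasure_bounded_finite) simp
    finally show "(\<integral>\<^sup>+z. ennreal (indicator (ball (0::complex) 1) z * 1) \<partial>lborel) < \<infinity>" .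
  qed (rule continuous_on_harmonic_ext)
  ultimately show "sobolev_W1p (ball 0 1) p (harmonic_ext f)"
    unfolding sobolev_W1p_def using weak_deriv_on_dh by (metis insertCI norm_ii norm_one)
next
  assume "sobolev_W1p (ball 0 1) p (harmonic_ext f)"
  then obtain g1 g2 where g: "Lp_on (ball 0 1) p g1" "Lp_on (ball 0 1) p g2"
    "weak_deriv_on (ball 0 1) 1 (harmonic_ext f) g1" "weak_deriv_on (ball 0 1) \<i> (harmonic_ext f) g2"
    unfolding sobolev_W1p_def by blast
  have fin: "emeasure lebesgue (ball (0::complex) 1) < \<infinity>"
    using emeasure_bounded_finite[of "ball (0::complex) 1"] by simp
  have loc: "set_integrable lebesgue K k" if "Lp_on (ball 0 1) p k" "compact K" "K \<subseteq> ball 0 1" for K k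
    using Lp_on_imp_set_integrable[OF that(1) p _ fin _ that(3)] that(2) lmeasurable_compact by auto
  have eq1: "AE z in lebesgue. z \<in> ball 0 1 \<longrightarrow> g1 z = dh 1 z"
    using g(1,3) by (intro weak_deriv_on_unique[where h="harmonic_ext f" and v=1] weak_deriv_on_dh loc set_integrable_dh) auto
  have eq2: "AE z in lebesgue. z \<in> ball 0 1 \<longrightarrow> g2 z = dh \<i> z"
    using g(2,4) by (intro weak_deriv_on_unique[where h="harmonic_ext f" and v=\<i>] weak_deriv_on_dh loc set_integrable_dh) auto
  \<comment> \<open>Solving \<open>dh 1 z = \<alpha> z + cnj (\<beta> z)\<close> and
    \<open>dh \<i> z = \<i> * (\<alpha> z - cnj (\<beta> z))\<close> for the two terms bounds the
    operator norm by the partial derivatives.\<close>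
  have G_le: "G z powr p \<le> 2 powr p * (norm (dh 1 z) powr p + norm (dh \<i> z) powr p)" if "norm z < 1" for z
  proof -
    have "2 * \<alpha> z = dh 1 z - \<i> * dh \<i> z" "2 * cnj (\<beta> z) = dh 1 z + \<i> * dh \<i> z"
      by (simp_all add: dh_def algebra_simps)
    then have "norm (2 * \<alpha> z) \<le> norm (dh 1 z) + norm (dh \<i> z)" "norm (2 * cnj (\<beta> z)) \<le> norm (dh 1 z) + norm (dh \<i> z)"
      by (metis norm_triangle_ineq4 norm_mult norm_ii mult_1, metis norm_triangle_ineq norm_mult norm_ii mult_1)
    then have "G z \<le> norm (dh 1 z) + norm (dh \<i> z)"
      using that by (simp add: G_def norm_mult)
    then have "G z powr p \<le> (norm (dh 1 z) + norm (dh \<i> z)) powr p"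
      using p by (intro powr_mono2) auto
    also have "\<dots> \<le> 2 powr p * (norm (dh 1 z) powr p + norm (dh \<i> z) powr p)"
      using p by (intro powr_add_le) auto
    finally show ?thesis .
  qed
  let ?B = "ball 0 1 :: complex set"
  have m: "(\<lambda>z. ennreal (indicator ?B z * norm (dh v z) powr p)) \<in> borel_measurable lebesgue" for v
  proof -
    have "(\<lambda>z. indicator ?B z *\<^sub>R norm (dh v z) powr p) \<in> borel_measurable borel"
      using p by (intro borel_measurable_continuous_on_indicator continuous_on_powr' continuous_on_norm continuous_on_dh continuous_on_const) auto
    then show ?thesis by (intro measurable_completion) simp
  qed
  have int: "(\<integral>\<^sup>+z. ennreal (indicator ?B z * norm (dh v z) powr p) \<partial>lebesgue) < \<infinity>" if "v \<in> {1, \<i>}" for v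
  proof -
    define k where "k = (if v = 1 then g1 else g2)"
    have k: "Lp_on ?B p k" "AE z in lebesgue. z \<in> ball 0 1 \<longrightarrow> k z = dh v z"
      using that g(1,2) eq1 eq2 by (auto simp: k_def)
    have "(\<integral>\<^sup>+z. ennreal (indicator ?B z * norm (dh v z) powr p) \<partial>lebesgue) = (\<integral>\<^sup>+z. ennreal (indicator ?B z * norm (k z) powr p) \<partial>lebesgue)"
      using k(2) by (intro nn_integral_cong_AE) (auto elim!: eventually_mono split: split_indicator)
    then show ?thesis using k(1) by (simp add: Lp_on_def)
  qed
  have "(\<integral>\<^sup>+z. ennreal (G z powr p) \<partial>lborel) = (\<integral>\<^sup>+z. ennreal (G z powr p) \<partial>lebesgue)"
    by (simp add: nn_integral_completion)
  also have "\<dots> \<le> (\<integral>\<^sup>+z. ennreal (2 powr p) * (ennreal (indicator ?B z * norm (dh 1 z) powr p) + ennreal (indicator ?B z * norm (dh \<i> z) powr p)) \<partial>lebesgue)"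
  proof (rule nn_integral_mono)
    fix z
    show "ennreal (G z powr p) \<le> ennreal (2 powr p) * (ennreal (indicator ?B z * norm (dh 1 z) powr p) + ennreal (indicator ?B z * norm (dh \<i> z) powr p))"
    proof (cases "norm z < 1")
      case True
      then show ?thesis using G_le[OF True]
        by (simp add: ennreal_plus[symmetric] ennreal_mult[symmetric] ennreal_leI del: ennreal_plus)
    qed (use p in \<open>simp add: G_def\<close>)
  qed
  also have "\<dots> = ennreal (2 powr p) * ((\<integral>\<^sup>+z. ennreal (indicator ?B z * norm (dh 1 z) powr p) \<partial>lebesgue) + (\<integral>\<^sup>+z. ennreal (indicator ?B z * norm (dh \<i> z) powr p) \<partial>lebesgue))"
    using m by (simp add: nn_integral_cmult nn_integral_add)
  also have "\<dots> < \<infinity>"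
    using int[of 1] int[of \<i>] by (simp add: ennreal_mult_less_top)
  finally show "(\<integral>\<^sup>+z. ennreal (G z powr p) \<partial>lborel) < \<infinity>" .
qed

end

section \<open>From the Douglas condition to the Sobolev space\<close>

context circle_map
begin

text \<open>Subtracting the value at \<open>t\<close> leaves the same
  \<open>norm (\<phi> \<theta> - \<phi> t)\<close> in both Cauchy integrals; each contributes 9, and
  the factor \<open>1 / (2 * pi)\<close> is bounded by 1. The constant stands on the left because
  \<open>Holder_nn_integral\<close> expects a bare integral on the right.\<close>

lemma G_le_kernel:
  assumes r: "0 < r" "r < 1"
  shows "ennreal (G (of_real r * cis t) / 18) \<le>
    (\<integral>\<^sup>+\<theta>. ennreal (norm (\<phi> \<theta> - \<phi> t) * (1 - r + norm (cis \<theta> - cis t)) powr (-2)) * indicator {0..2*pi} \<theta> \<partial>lborel)"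
    (is "_ \<le> ?I")
proof -
  define z where "z = of_real r * cis t"
  have z: "norm z < 1" using r by (simp add: z_def norm_mult)
  have zt: "norm (z - cis t) = 1 - r"
  proof -
    have "z - cis t = of_real (r - 1) * cis t" by (simp add: z_def algebra_simps)
    then show ?thesis using r by (simp add: norm_mult del: of_real_diff)
  qed
  \<comment> \<open>The distance from \<open>z\<close> to \<open>cis \<theta>\<close> is at least
    \<open>1 - r\<close> and, by the triangle inequality, at least the chord minus
    \<open>1 - r\<close>. Three copies of it therefore cover \<open>1 - r\<close> plus the chord,
    and 9 is the square of 3.\<close>
  have ker: "1 / (norm (cis \<theta> - z))\<^sup>2 \<le> 9 * (1 - r + norm (cis \<theta> - cis t)) powr (-2)" for \<theta>
  proof -
    have "norm (cis \<theta> - cis t) \<le> norm (cis \<theta> - z) + (1 - r)"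
      using norm_triangle_ineq[of "cis \<theta> - z" "z - cis t"] zt by simp
    moreover have "1 - r \<le> norm (cis \<theta> - z)"
      using norm_triangle_ineq2[of "cis \<theta>" z] r by (simp add: z_def norm_mult)
    ultimately have le: "1 - r + norm (cis \<theta> - cis t) \<le> 3 * norm (cis \<theta> - z)" by simp
    have pos: "0 < 1 - r + norm (cis \<theta> - cis t)" using r by (simp add: add_pos_nonneg)
    have "(1 - r + norm (cis \<theta> - cis t))\<^sup>2 \<le> (3 * norm (cis \<theta> - z))\<^sup>2"
      using le pos by (intro power_mono) auto
    then have "1 / (3 * norm (cis \<theta> - z))\<^sup>2 \<le> 1 / (1 - r + norm (cis \<theta> - cis t))\<^sup>2"
      using pos by (intro divide_left_mono) (auto intro!: mult_pos_pos intro: less_le_trans)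
    moreover have "(1 - r + norm (cis \<theta> - cis t)) powr (-2) = 1 / (1 - r + norm (cis \<theta> - cis t))\<^sup>2"
      using pos by (simp add: powr_minus powr_numeral divide_inverse)
    ultimately show ?thesis by (simp add: power_mult_distrib)
  qed
  have bound: "ennreal (norm (cauchy_int_deriv g z)) \<le> ennreal 9 * ?I"
    if g: "continuous_on UNIV g" and D: "\<And>\<theta>. norm (g \<theta> - g t) = norm (\<phi> \<theta> - \<phi> t)" for g
  proof -
    have "ennreal (norm (cauchy_int_deriv g z)) \<le>
      (\<integral>\<^sup>+\<theta>. ennreal (norm (g \<theta> - g t) / (norm (cis \<theta> - z))\<^sup>2) * indicator {0..2*pi} \<theta> \<partial>lborel)"
      by (rule norm_cauchy_int_deriv_le[OF g z])
    also have "\<dots> \<le> (\<integral>\<^sup>+\<theta>. ennreal 9 * (ennreal (norm (\<phi> \<theta> - \<phi> t) * (1 - r + norm (cis \<theta> - cis t)) powr (-2)) * indicator {0..2*pi} \<theta>) \<partial>lborel)"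
    proof (rule nn_integral_mono)
      fix \<theta>
      have "norm (g \<theta> - g t) / (norm (cis \<theta> - z))\<^sup>2 = norm (\<phi> \<theta> - \<phi> t) * (1 / (norm (cis \<theta> - z))\<^sup>2)"
        by (simp add: D)
      also have "\<dots> \<le> norm (\<phi> \<theta> - \<phi> t) * (9 * (1 - r + norm (cis \<theta> - cis t)) powr (-2))"
        by (intro mult_left_mono ker) auto
      finally have "ennreal (norm (g \<theta> - g t) / (norm (cis \<theta> - z))\<^sup>2) \<le> ennreal (9 * (norm (\<phi> \<theta> - \<phi> t) * (1 - r + norm (cis \<theta> - cis t)) powr (-2)))"
        by (intro ennreal_leI) (simp only: mult_ac)
      also have "\<dots> = ennreal 9 * ennreal (norm (\<phi> \<theta> - \<phi> t) * (1 - r + norm (cis \<theta> - cis t)) powr (-2))"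
        by (rule ennreal_mult) auto
      finally show "ennreal (norm (g \<theta> - g t) / (norm (cis \<theta> - z))\<^sup>2) * indicator {0..2*pi} \<theta> \<le>
         ennreal 9 * (ennreal (norm (\<phi> \<theta> - \<phi> t) * (1 - r + norm (cis \<theta> - cis t)) powr (-2)) * indicator {0..2*pi} \<theta>)"
        by (auto split: split_indicator)
    qed
    also have "\<dots> = ennreal 9 * ?I"
      by (rule nn_integral_cmult) measurable
    finally show ?thesis .
  qed
  have pi1: "x / (2 * pi) \<le> x" if "x \<ge> 0" for x :: real
  proof -
    have "x * 1 \<le> x * (2 * pi)" using that pi_gt3 by (intro mult_left_mono) auto
    then show ?thesis by (simp add: field_simps)
  qed
  have "ennreal (G z) \<le> ennreal (norm (cauchy_int_deriv \<phi> z)) + ennreal (norm (cauchy_int_deriv (\<lambda>\<theta>. cnj (\<phi> \<theta>)) z))"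
    using z pi1 by (auto simp: G_def \<alpha>_def \<beta>_def norm_divide norm_mult ennreal_plus[symmetric] simp del: ennreal_plus intro!: ennreal_leI add_mono)
  also have "\<dots> \<le> ennreal 9 * ?I + ennreal 9 * ?I"
    by (intro add_mono bound continuous_intros continuous_\<phi>) (auto simp: complex_cnj_diff[symmetric] simp del: complex_cnj_diff)
  also have "\<dots> = ennreal 18 * ?I"
    by (simp add: distrib_right[symmetric])
  finally have "ennreal (1/18) * ennreal (G z) \<le> ennreal (1/18) * (ennreal 18 * ?I)"
    by (rule mult_left_mono) simp
  also have "\<dots> = ?I"
    by (simp add: mult.assoc[symmetric] ennreal_mult[symmetric] del: ennreal_numeral)
  finally show ?thesis
    by (simp add: z_def ennreal_mult[symmetric])
qed

text \<open>
  Hoelder's inequality with exponents \<open>1 + 1/(2p)\<close> and \<open>1 - 1/(2p)\<close>: the second power of the kernel is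
  still integrable, and the first leaves a power of \<open>1 - r\<close> that is integrable at \<open>r = 1\<close>.
\<close>

lemma G_powr_le_kernel:
  assumes p: "1 < p"
  obtains C where "C > 0"
    "\<And>r t. 0 < r \<Longrightarrow> r < 1 \<Longrightarrow> t \<in> {0..2*pi} \<Longrightarrow> ennreal (G (of_real r * cis t) powr p) \<le>
      ennreal C * (\<integral>\<^sup>+\<theta>. ennreal ((1 - r) powr (-1/2) * (1 - r + norm (cis \<theta> - cis t)) powr (-p - 1/2) *
        norm (\<phi> \<theta> - \<phi> t) powr p) * indicator {0..2*pi} \<theta> \<partial>lborel)"
proof -
  \<comment> \<open>\<open>b\<close> is the exponent \<open>1 - 1/(2*p)\<close> times the conjugate
    \<open>p / (p - 1)\<close>. It exceeds 1, as \<open>nn_integral_cis_kernel_le\<close> demands,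
    and \<open>(1 - b) * (p - 1) = -1/2\<close> is the power of \<open>1 - r\<close> left
    over.\<close>
  define b where "b = (p - 1/2) / (p - 1)"
  define C1 where "C1 = 6 * 2 powr b / (b - 1)"
  have b: "1 < b" using p by (simp add: b_def field_simps)
  then have C1: "C1 > 0" by (simp add: C1_def)
  let ?q = "1 - 1/(2*p)"
  show ?thesis
  proof (rule that[of "18 powr p * C1 powr (p - 1)"])
    show "0 < 18 powr p * C1 powr (p - 1)" using C1 by simp
    fix r t :: real assume r: "0 < r" "r < 1" and t: "t \<in> {0..2*pi}"
    define W where "W \<theta> = 1 - r + norm (cis \<theta> - cis t)" for \<theta>
    have [measurable]: "W \<in> borel_measurable borel" unfolding W_def[abs_def] by measurable
    let ?a = "G (of_real r * cis t) / 18"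
    let ?u = "\<lambda>\<theta>. norm (\<phi> \<theta> - \<phi> t) * W \<theta> powr (-(1 + 1/(2*p))) * indicator {0..2*pi} \<theta>"
    let ?v = "\<lambda>\<theta>. W \<theta> powr (- ?q) * indicator {0..2*pi} \<theta>"
    have "ennreal (?a powr p) \<le> ennreal ((C1 * (1 - r) powr (1 - b)) powr (p - 1)) * (\<integral>\<^sup>+\<theta>. ennreal (?u \<theta> powr p) \<partial>lborel)"
    proof (rule Holder_nn_integral[where g = ?v])
      have "W \<theta> powr (-(1 + 1/(2*p))) * W \<theta> powr (- ?q) = W \<theta> powr (-2)" for \<theta>
        by (simp add: powr_add[symmetric])
      then have uv: "?u \<theta> * ?v \<theta> = norm (\<phi> \<theta> - \<phi> t) * W \<theta> powr (-2) * indicator {0..2*pi} \<theta>" for \<theta>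
        by (auto split: split_indicator)
      have "(\<integral>\<^sup>+\<theta>. ennreal (?u \<theta> * ?v \<theta>) \<partial>lborel) = (\<integral>\<^sup>+\<theta>. ennreal (norm (\<phi> \<theta> - \<phi> t) * W \<theta> powr (-2)) * indicator {0..2*pi} \<theta> \<partial>lborel)"
        unfolding uv by (intro nn_integral_cong) (auto split: split_indicator)
      then show "ennreal ?a \<le> (\<integral>\<^sup>+\<theta>. ennreal (?u \<theta> * ?v \<theta>) \<partial>lborel)"
        using G_le_kernel[OF r, of t] by (simp add: W_def)
      have "- ?q * (p / (p - 1)) = - b"
        using p by (simp add: b_def field_simps)
      then have "?v \<theta> powr (p / (p - 1)) = W \<theta> powr (-b) * indicator {0..2*pi} \<theta>" for \<theta>
        by (auto simp: powr_powr split: split_indicator)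
      then have "(\<integral>\<^sup>+\<theta>. ennreal (?v \<theta> powr (p / (p - 1))) \<partial>lborel) = (\<integral>\<^sup>+\<theta>. ennreal (W \<theta> powr (-b)) * indicator {0..2*pi} \<theta> \<partial>lborel)"
        by (intro nn_integral_cong) (auto split: split_indicator)
      also have "\<dots> \<le> ennreal (C1 * (1 - r) powr (1 - b))"
        unfolding W_def C1_def using r b t by (intro nn_integral_cis_kernel_le) auto
      finally show "(\<integral>\<^sup>+\<theta>. ennreal (?v \<theta> powr (p / (p - 1))) \<partial>lborel) \<le> ennreal (C1 * (1 - r) powr (1 - b))" .
    qed (use p r C1 in auto)
    also have "(C1 * (1 - r) powr (1 - b)) powr (p - 1) = C1 powr (p - 1) * (1 - r) powr (-1/2)"
    proof -
      have "(1 - b) * (p - 1) = -1/2" using p by (simp add: b_def field_simps)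
      then show ?thesis using C1 r by (simp add: powr_mult powr_powr)
    qed
    also have "(\<integral>\<^sup>+\<theta>. ennreal (?u \<theta> powr p) \<partial>lborel) = (\<integral>\<^sup>+\<theta>. ennreal (W \<theta> powr (-p - 1/2) * norm (\<phi> \<theta> - \<phi> t) powr p) * indicator {0..2*pi} \<theta> \<partial>lborel)"
    proof (rule nn_integral_cong)
      fix \<theta>
      have "-(1 + 1/(2*p)) * p = -p - 1/2" using p by (simp add: field_simps)
      then have "(W \<theta> powr (-(1 + 1/(2*p)))) powr p = W \<theta> powr (-p - 1/2)"
        by (simp only: powr_powr)
      then show "ennreal (?u \<theta> powr p) = ennreal (W \<theta> powr (-p - 1/2) * norm (\<phi> \<theta> - \<phi> t) powr p) * indicator {0..2*pi} \<theta>"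
        using p by (auto simp: powr_mult mult.commute split: split_indicator)
    qed
    finally have "ennreal (18 powr p) * ennreal (?a powr p) \<le> ennreal (18 powr p) * (ennreal (C1 powr (p - 1) * (1 - r) powr (-1/2)) *
        (\<integral>\<^sup>+\<theta>. ennreal (W \<theta> powr (-p - 1/2) * norm (\<phi> \<theta> - \<phi> t) powr p) * indicator {0..2*pi} \<theta> \<partial>lborel))"
      by (rule mult_left_mono) simp
    also have "\<dots> = ennreal (18 powr p * C1 powr (p - 1)) * (ennreal ((1 - r) powr (-1/2)) *
        (\<integral>\<^sup>+\<theta>. ennreal (W \<theta> powr (-p - 1/2) * norm (\<phi> \<theta> - \<phi> t) powr p) * indicator {0..2*pi} \<theta> \<partial>lborel))"
      by (simp add: ennreal_mult ac_simps)
    also have "ennreal ((1 - r) powr (-1/2)) *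
        (\<integral>\<^sup>+\<theta>. ennreal (W \<theta> powr (-p - 1/2) * norm (\<phi> \<theta> - \<phi> t) powr p) * indicator {0..2*pi} \<theta> \<partial>lborel)
      = (\<integral>\<^sup>+\<theta>. ennreal ((1 - r) powr (-1/2)) * (ennreal (W \<theta> powr (-p - 1/2) * norm (\<phi> \<theta> - \<phi> t) powr p) * indicator {0..2*pi} \<theta>) \<partial>lborel)"
      by (rule nn_integral_cmult[symmetric]) measurable
    also have "\<dots> = (\<integral>\<^sup>+\<theta>. ennreal ((1 - r) powr (-1/2) * W \<theta> powr (-p - 1/2) *
        norm (\<phi> \<theta> - \<phi> t) powr p) * indicator {0..2*pi} \<theta> \<partial>lborel)"
      by (intro nn_integral_cong) (auto simp: ennreal_mult[symmetric] mult.assoc split: split_indicator)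
    also have "ennreal (18 powr p) * ennreal (?a powr p) = ennreal (G (of_real r * cis t) powr p)"
      by (simp add: ennreal_mult[symmetric] powr_divide)
    finally show "ennreal (G (of_real r * cis t) powr p) \<le>
      ennreal (18 powr p * C1 powr (p - 1)) * (\<integral>\<^sup>+\<theta>. ennreal ((1 - r) powr (-1/2) * (1 - r + norm (cis \<theta> - cis t)) powr (-p - 1/2) *
        norm (\<phi> \<theta> - \<phi> t) powr p) * indicator {0..2*pi} \<theta> \<partial>lborel)"
      by (simp add: W_def)
  qed
qed

lemma douglas_imp_energy_finite:
  assumes p: "1 < p" and D: "douglas_cond p f"
  shows "(\<integral>\<^sup>+z. ennreal (G z powr p) \<partial>lborel) < \<infinity>"
proof (rule G_powr_le_kernel[OF p])
  fix C assume C: "C > 0"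
    "\<And>r t. 0 < r \<Longrightarrow> r < 1 \<Longrightarrow> t \<in> {0..2*pi} \<Longrightarrow> ennreal (G (of_real r * cis t) powr p) \<le>
      ennreal C * (\<integral>\<^sup>+\<theta>. ennreal ((1 - r) powr (-1/2) * (1 - r + norm (cis \<theta> - cis t)) powr (-p - 1/2) *
        norm (\<phi> \<theta> - \<phi> t) powr p) * indicator {0..2*pi} \<theta> \<partial>lborel)"
  let ?k = "\<lambda>t \<theta> d. ennreal (d powr (-1/2) * (d + norm (cis \<theta> - cis t)) powr (-p - 1/2)) * indicator {0<..} d"
  let ?D = "\<lambda>t \<theta>. ennreal (norm (\<phi> \<theta> - \<phi> t) powr p) * indicator {0..2*pi} \<theta>"
  let ?Q = "\<lambda>t \<theta>. ennreal (norm ((\<phi> t - \<phi> \<theta>) / (cis t - cis \<theta>)) powr p) * indicator {0..2*pi} \<theta>"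
  have inner: "(\<integral>\<^sup>+r. ennreal r * ennreal (G (of_real r * cis t) powr p) * indicator {0<..} r \<partial>lborel) \<le>
      ennreal (3 * C) * (\<integral>\<^sup>+\<theta>. ?Q t \<theta> \<partial>lborel)" if t: "t \<in> {0..2*pi}" for t
  proof -
    have "(\<integral>\<^sup>+r. ennreal r * ennreal (G (of_real r * cis t) powr p) * indicator {0<..} r \<partial>lborel) \<le>
      (\<integral>\<^sup>+r. ennreal C * (\<integral>\<^sup>+\<theta>. ?k t \<theta> (1 + (-1) * r) * ?D t \<theta> \<partial>lborel) \<partial>lborel)"
    proof (rule nn_integral_mono)
      fix r :: real
      show "ennreal r * ennreal (G (of_real r * cis t) powr p) * indicator {0<..} r \<le> ennreal C * (\<integral>\<^sup>+\<theta>. ?k t \<theta> (1 + (-1) * r) * ?D t \<theta> \<partial>lborel)"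
      proof (cases "0 < r \<and> r < 1")
        case True
        \<comment> \<open>The Jacobian \<open>r\<close> is at most 1 and is dropped.\<close>
        have "ennreal r * ennreal (G (of_real r * cis t) powr p) * indicator {0<..} r \<le> 1 * ennreal (G (of_real r * cis t) powr p) * 1"
          using True by (intro mult_mono) (auto split: split_indicator)
        also have "\<dots> \<le> ennreal C * (\<integral>\<^sup>+\<theta>. ennreal ((1 - r) powr (-1/2) * (1 - r + norm (cis \<theta> - cis t)) powr (-p - 1/2) *
          norm (\<phi> \<theta> - \<phi> t) powr p) * indicator {0..2*pi} \<theta> \<partial>lborel)"
          using C(2)[of r t] True t by simp
        also have "\<dots> = ennreal C * (\<integral>\<^sup>+\<theta>. ?k t \<theta> (1 + (-1) * r) * ?D t \<theta> \<partial>lborel)"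
          using True by - (rule arg_cong[where f="\<lambda>x. ennreal C * x"], rule nn_integral_cong, auto simp: ennreal_mult split: split_indicator)
        finally show ?thesis .
      next
        case False
        then have "r \<le> 0 \<or> G (of_real r * cis t) = 0" by (auto simp: G_def norm_mult)
        then show ?thesis using p by auto
      qed
    qed
    also have "\<dots> = ennreal C * (\<integral>\<^sup>+r. (\<integral>\<^sup>+\<theta>. ?k t \<theta> (1 + (-1) * r) * ?D t \<theta> \<partial>lborel) \<partial>lborel)"
      by (rule nn_integral_cmult) measurable
    also have "(\<integral>\<^sup>+r. (\<integral>\<^sup>+\<theta>. ?k t \<theta> (1 + (-1) * r) * ?D t \<theta> \<partial>lborel) \<partial>lborel) = (\<integral>\<^sup>+d. (\<integral>\<^sup>+\<theta>. ?k t \<theta> d * ?D t \<theta> \<partial>lborel) \<partial>lborel)"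
      by (subst nn_integral_real_affine[where c="-1" and t=1 and f="\<lambda>d. (\<integral>\<^sup>+\<theta>. ?k t \<theta> d * ?D t \<theta> \<partial>lborel)"]) auto
    also have "\<dots> = (\<integral>\<^sup>+\<theta>. (\<integral>\<^sup>+d. ?k t \<theta> d * ?D t \<theta> \<partial>lborel) \<partial>lborel)"
      by (rule lborel_pair.Fubini') measurable
    also have "\<dots> \<le> (\<integral>\<^sup>+\<theta>. ennreal 3 * ?Q t \<theta> \<partial>lborel)"
    proof (rule nn_integral_mono)
      fix \<theta> :: real
      have "(\<integral>\<^sup>+d. ?k t \<theta> d * ?D t \<theta> \<partial>lborel) = (\<integral>\<^sup>+d. ?k t \<theta> d \<partial>lborel) * ?D t \<theta>"
        by (rule nn_integral_multc) measurable
      also have "\<dots> \<le> ennreal 3 * ?Q t \<theta>"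
      \<comment> \<open>On the diagonal the integral of the kernel is infinite, but it multiplies
        \<open>norm (\<phi> \<theta> - \<phi> t) powr p = 0\<close>, and the product is 0.\<close>
      proof (cases "cis \<theta> = cis t")
        case True
        then have "\<phi> \<theta> = \<phi> t" by (simp add: \<phi>_def)
        then show ?thesis using p by simp
      next
        case False
        let ?\<rho> = "norm (cis \<theta> - cis t)"
        have "(\<integral>\<^sup>+d. ?k t \<theta> d \<partial>lborel) \<le> ennreal (3 * ?\<rho> powr (-p))"
          using False p by (intro nn_integral_powr_product_le) auto
        then have "(\<integral>\<^sup>+d. ?k t \<theta> d \<partial>lborel) * ?D t \<theta> \<le> ennreal (3 * ?\<rho> powr (-p)) * ?D t \<theta>"
          by (rule mult_right_mono) simp
        also have "\<dots> = ennreal 3 * ?Q t \<theta>"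
        proof -
          have "norm ((\<phi> t - \<phi> \<theta>) / (cis t - cis \<theta>)) powr p = norm (\<phi> \<theta> - \<phi> t) powr p * ?\<rho> powr (-p)"
            unfolding norm_divide by (simp add: powr_divide powr_minus_divide norm_minus_commute)
          then show ?thesis
            by (auto simp: ennreal_mult ac_simps split: split_indicator)
        qed
        finally show ?thesis .
      qed
      finally show "(\<integral>\<^sup>+d. ?k t \<theta> d * ?D t \<theta> \<partial>lborel) \<le> ennreal 3 * ?Q t \<theta>" .
    qed
    also have "\<dots> = ennreal 3 * (\<integral>\<^sup>+\<theta>. ?Q t \<theta> \<partial>lborel)"
      by (rule nn_integral_cmult) measurable
    finally have "(\<integral>\<^sup>+r. ennreal r * ennreal (G (of_real r * cis t) powr p) * indicator {0<..} r \<partial>lborel) \<le>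
        ennreal C * (ennreal 3 * (\<integral>\<^sup>+\<theta>. ?Q t \<theta> \<partial>lborel))"
      by (simp add: mult_left_mono)
    also have "\<dots> = ennreal (3 * C) * (\<integral>\<^sup>+\<theta>. ?Q t \<theta> \<partial>lborel)"
      using C(1) by (simp add: ennreal_mult) (simp only: mult_ac)
    finally show ?thesis .
  qed
  have "(\<integral>\<^sup>+z. ennreal (G z powr p) \<partial>lborel) =
    (\<integral>\<^sup>+t. (\<integral>\<^sup>+r. ennreal r * ennreal (G (of_real r * cis t) powr p) * indicator {0<..} r \<partial>lborel) * indicator {0..2*pi} t \<partial>lborel)"
    by (rule nn_integral_polar) measurable
  also have "\<dots> \<le> (\<integral>\<^sup>+t. ennreal (3 * C) * ((\<integral>\<^sup>+\<theta>. ?Q t \<theta> \<partial>lborel) * indicator {0..2*pi} t) \<partial>lborel)"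
    using inner by (intro nn_integral_mono) (auto split: split_indicator)
  also have "\<dots> = ennreal (3 * C) * (\<integral>\<^sup>+t. (\<integral>\<^sup>+\<theta>. ?Q t \<theta> \<partial>lborel) * indicator {0..2*pi} t \<partial>lborel)"
    by (rule nn_integral_cmult) measurable
  also have "(\<integral>\<^sup>+t. (\<integral>\<^sup>+\<theta>. ?Q t \<theta> \<partial>lborel) * indicator {0..2*pi} t \<partial>lborel) =
     (\<integral>\<^sup>+ s. \<integral>\<^sup>+ t. ennreal (indicator {0..2*pi} s * indicator {0..2*pi} t *
        norm ((f (cis s) - f (cis t)) / (cis s - cis t)) powr p) \<partial>lborel \<partial>lborel)"
    by (intro nn_integral_cong) (auto simp: \<phi>_def intro!: nn_integral_cong split: split_indicator)
  also have "ennreal (3 * C) * \<dots> < \<infinity>"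
    using D unfolding douglas_cond_def by (simp add: ennreal_mult_less_top)
  finally show ?thesis .
qed

end

section \<open>From the Sobolev space to the Douglas condition\<close>

text \<open>Avoids powers of sums: once one of the three terms dominates \<open>a / 3\<close>, the
  p-th power estimates apply to that term alone and keep a real number on the left.\<close>

lemma ennreal_le_add3_imp_le_max:
  assumes "ennreal a \<le> x + y + z"
  shows "ennreal (a / 3) \<le> max x (max y z)"
proof -
  let ?m = "max x (max y z)"
  have "x + y + z \<le> ?m + ?m + ?m"
    by (intro add_mono) (auto simp: le_max_iff_disj)
  also have "\<dots> = ennreal 3 * ?m"
    using distrib_right[of 1 2 ?m] distrib_right[of 1 1 ?m] by (simp add: add.assoc)
  finally have "ennreal (1/3) * ennreal a \<le> ennreal (1/3) * (ennreal 3 * ?m)"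
    using assms by (intro mult_left_mono) auto
  also have "\<dots> = ?m"
    by (simp add: mult.assoc[symmetric] ennreal_mult[symmetric] del: ennreal_numeral)
  finally show ?thesis by (simp add: ennreal_mult'[symmetric])
qed

context circle_map
begin

text \<open>\<open>G\<close> is the operator norm of the derivative, so at speed at most 1 the
  fundamental theorem of calculus bounds the increment by the integral of \<open>G\<close>. Radial
  segments have speed 1, the arc has speed \<open>1 - s\<close>.\<close>

lemma harmonic_ext_curve_bound:
  assumes ab: "a \<le> b"
    and der: "\<And>x. x \<in> {a..b} \<Longrightarrow> (\<gamma> has_vector_derivative \<gamma>' x) (at x within {a..b})"
    and \<gamma>': "\<And>x. x \<in> {a..b} \<Longrightarrow> norm (\<gamma>' x) \<le> 1"
    and \<gamma>: "\<And>x. x \<in> {a..b} \<Longrightarrow> norm (\<gamma> x) < 1"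
  shows "ennreal (norm (harmonic_ext f (\<gamma> b) - harmonic_ext f (\<gamma> a))) \<le>
    (\<integral>\<^sup>+x. ennreal (G (\<gamma> x)) * indicator {a..b} x \<partial>lborel)"
proof -
  let ?k = "\<lambda>x. dh (\<gamma>' x) (\<gamma> x)"
  have k: "(?k has_integral (harmonic_ext f (\<gamma> b) - harmonic_ext f (\<gamma> a))) {a..b}"
  proof (rule fundamental_theorem_of_calculus[OF ab])
    fix x assume x: "x \<in> {a..b}"
    have "(harmonic_ext f has_derivative (\<lambda>v. dh v (\<gamma> x))) (at (\<gamma> x) within \<gamma> ` {a..b})"
      unfolding dh_def by (rule has_derivative_at_withinI[OF harmonic_ext_has_derivative[OF \<gamma>[OF x]]])
    from vector_derivative_diff_chain_within[OF der[OF x] this]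
    show "((\<lambda>x. harmonic_ext f (\<gamma> x)) has_vector_derivative dh (\<gamma>' x) (\<gamma> x)) (at x within {a..b})"
      by (simp add: o_def)
  qed
  have "continuous_on {a..b} \<gamma>"
    unfolding continuous_on_eq_continuous_within by (intro ballI has_vector_derivative_continuous[OF der])
  then have "continuous_on {a..b} (\<lambda>x. norm (\<alpha> (\<gamma> x)) + norm (\<beta> (\<gamma> x)))"
    using \<gamma> by (intro continuous_intros continuous_on_compose2[OF continuous_on_\<alpha>] continuous_on_compose2[OF continuous_on_\<beta>]) auto
  then have "continuous_on {a..b} (\<lambda>x. G (\<gamma> x))"
    by (rule continuous_on_eq) (use \<gamma> in \<open>auto simp: G_def\<close>)
  then have G: "(\<lambda>x. G (\<gamma> x)) integrable_on {a..b}"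
    by (rule integrable_continuous_interval)
  have "norm (integral {a..b} ?k) \<le> integral {a..b} (\<lambda>x. G (\<gamma> x))"
  proof (rule integral_norm_bound_integral[OF _ G])
    show "?k integrable_on {a..b}" using k by blast
    fix x assume x: "x \<in> {a..b}"
    have "norm (?k x) \<le> G (\<gamma> x) * norm (\<gamma>' x)"
      by (rule norm_dh_le_mult[OF \<gamma>[OF x]])
    also have "\<dots> \<le> G (\<gamma> x) * 1"
      by (intro mult_left_mono \<gamma>'[OF x]) simp
    finally show "norm (?k x) \<le> G (\<gamma> x)" by simp
  qed
  then have "ennreal (norm (harmonic_ext f (\<gamma> b) - harmonic_ext f (\<gamma> a))) \<le> ennreal (integral {a..b} (\<lambda>x. G (\<gamma> x)))"
    using integral_unique[OF k] by (intro ennreal_leI) simp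
  also have "\<dots> = (\<integral>\<^sup>+x. ennreal (G (\<gamma> x)) * indicator {a..b} x \<partial>lborel)"
    using G by (intro nn_integral_has_integral_lebesgue'[symmetric]) (auto simp: integrable_integral)
  finally show ?thesis .
qed

definition g :: "real \<Rightarrow> real \<Rightarrow> real" where
  "g d t = G (of_real (1 - d) * cis t)"

lemma g_nonneg [simp]: "0 \<le> g d t" by (simp add: g_def)

lemma g_0 [simp]: "g 0 t = 0" by (simp add: g_def G_def)

lemma g_periodic: "g d (2 * pi + t) = g d t"
  by (simp add: g_def cis_mult[symmetric])

lemma borel_measurable_g [measurable (raw)]:
  assumes [measurable]: "a \<in> borel_measurable M" "b \<in> borel_measurable M"
  shows "(\<lambda>x. g (a x) (b x)) \<in> borel_measurable M"
  unfolding g_def by measurable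

text \<open>The curve bound serves every radius \<open>R < 1\<close> with an estimate independent of
  \<open>R\<close>, and the radial limit carries it to the circle. An infinite right side leaves
  nothing to prove.\<close>

lemma radial_bound:
  assumes s: "0 < s" "s < 1"
  shows "ennreal (norm (\<phi> t - harmonic_ext f (of_real (1 - s) * cis t))) \<le> (\<integral>\<^sup>+d. ennreal (g d t) * indicator {0..s} d \<partial>lborel)"
proof (cases "(\<integral>\<^sup>+d. ennreal (g d t) * indicator {0..s} d \<partial>lborel)")
  case (real n)
  let ?c = "harmonic_ext f (of_real (1 - s) * cis t)"
  have b: "norm (harmonic_ext f (of_real R * cis t) - ?c) \<le> n" if R: "1 - s < R" "R < 1" for R
  proof -
    have "ennreal (norm (harmonic_ext f (of_real R * cis t) - ?c)) \<le> (\<integral>\<^sup>+x. ennreal (G (of_real x * cis t)) * indicator {1 - s..R} x \<partial>lborel)"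
    proof (rule harmonic_ext_curve_bound[where \<gamma> = "\<lambda>x. of_real x * cis t" and \<gamma>' = "\<lambda>_. cis t"])
      show "((\<lambda>x. of_real x * cis t) has_vector_derivative cis t) (at x within {1 - s..R})" for x
        by (rule has_vector_derivative_real_field) (auto intro!: derivative_eq_intros)
    qed (use R s in \<open>auto simp: norm_mult\<close>)
    also have "\<dots> \<le> (\<integral>\<^sup>+x. ennreal (G (of_real x * cis t)) * indicator {1 - s..1} x \<partial>lborel)"
      using R by (intro nn_integral_mono) (auto split: split_indicator)
    also have "\<dots> = (\<integral>\<^sup>+d. ennreal (g d t) * indicator {0..s} d \<partial>lborel)"
      by (subst nn_integral_real_affine[where c="-1" and t=1]) (auto simp: g_def intro!: nn_integral_cong split: split_indicator)
    finally show ?thesis using real by simp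
  qed
  have "((\<lambda>R. norm (harmonic_ext f (of_real R * cis t) - ?c)) \<longlongrightarrow> norm (\<phi> t - ?c)) (at_left 1)"
    by (intro tendsto_intros harmonic_ext_radial_limit)
  moreover have "\<forall>\<^sub>F R in at_left 1. norm (harmonic_ext f (of_real R * cis t) - ?c) \<le> n"
    unfolding eventually_at_left_field using s b by (intro exI[of _ "1 - s"]) auto
  ultimately have "norm (\<phi> t - ?c) \<le> n"
    by (rule tendsto_upperbound) simp
  then show ?thesis unfolding real by (rule ennreal_leI)
qed simp

lemma arc_bound:
  assumes s: "0 < s" "s < 1"
  shows "ennreal (norm (harmonic_ext f (of_real (1 - s) * cis (t + s)) - harmonic_ext f (of_real (1 - s) * cis t)))
    \<le> (\<integral>\<^sup>+x. ennreal (g s (t + x)) * indicator {0..s} x \<partial>lborel)"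
proof -
  let ?\<gamma> = "\<lambda>x. of_real (1 - s) * cis (t + x)"
  have "ennreal (norm (harmonic_ext f (?\<gamma> s) - harmonic_ext f (?\<gamma> 0))) \<le> (\<integral>\<^sup>+x. ennreal (G (?\<gamma> x)) * indicator {0..s} x \<partial>lborel)"
  proof (rule harmonic_ext_curve_bound[where \<gamma>' = "\<lambda>x. of_real (1 - s) * (\<i> * cis (t + x))"])
    fix x
    have "((\<lambda>w. of_real (1 - s) * exp (\<i> * (of_real t + w))) has_field_derivative of_real (1 - s) * (\<i> * cis (t + x))) (at (of_real x))"
      by (auto intro!: derivative_eq_intros simp: cis_conv_exp)
    from has_vector_derivative_real_field[OF this]
    show "(?\<gamma> has_vector_derivative of_real (1 - s) * (\<i> * cis (t + x))) (at x within {0..s})"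
      by (simp add: cis_conv_exp)
  qed (use s in \<open>auto simp: norm_mult simp del: of_real_diff\<close>)
  then show ?thesis by (simp add: g_def)
qed

text \<open>Hoelder's inequality with the weight \<open>d\<close> to the power \<open>(p - 1)/(2p)\<close>, as in the proof of Hardy's inequality.\<close>

lemma hardy_step:
  assumes p: "1 < p" and s: "0 < s" and c: "0 \<le> c"
    "ennreal c \<le> (\<integral>\<^sup>+d. ennreal (g d t) * indicator {0..s} d \<partial>lborel)"
  shows "ennreal (c powr p) \<le> ennreal ((2 * s powr (1/2)) powr (p - 1)) *
    (\<integral>\<^sup>+d. ennreal (g d t powr p * d powr ((p - 1) / 2)) * indicator {0..s} d \<partial>lborel)"
proof -
  define k where "k = (p - 1) / (2 * p)"
  have kp: "k * p = (p - 1) / 2" "- k * (p / (p - 1)) = -1/2"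
    using p by (auto simp: k_def field_simps)
  let ?u = "\<lambda>d. g d t * d powr k * indicator {0..s} d"
  let ?v = "\<lambda>d. d powr (-k) * indicator {0..s} d"
  have "ennreal (c powr p) \<le> ennreal ((2 * s powr (1/2)) powr (p - 1)) * (\<integral>\<^sup>+d. ennreal (?u d powr p) \<partial>lborel)"
  proof (rule Holder_nn_integral[where g="?v"])
    \<comment> \<open>At \<open>d = 0\<close> the two weights do not cancel, but there
      \<open>g 0 t = 0\<close>.\<close>
    have uv: "ennreal (?u d * ?v d) = ennreal (g d t) * indicator {0..s} d" for d
    proof (cases "d \<in> {0<..s}")
      case True
      then have "d powr k * d powr (-k) = 1" by (simp add: powr_add[symmetric])
      then show ?thesis using True by (simp add: mult.assoc)
    qed (auto split: split_indicator simp: less_le)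
    show "ennreal c \<le> (\<integral>\<^sup>+d. ennreal (?u d * ?v d) \<partial>lborel)"
      unfolding uv by fact
    have vq: "ennreal (?v d powr (p / (p - 1))) = ennreal (d powr (-1/2)) * indicator {0..s} d" for d
      using kp(2) by (auto simp: powr_powr split: split_indicator)
    show "(\<integral>\<^sup>+d. ennreal (?v d powr (p / (p - 1))) \<partial>lborel) \<le> ennreal (2 * s powr (1/2))"
      unfolding vq using s by (subst nn_integral_powr_from_0) (auto simp: mult.commute)
  qed (use p s c in \<open>auto\<close>)
  also have "(\<integral>\<^sup>+d. ennreal (?u d powr p) \<partial>lborel) = (\<integral>\<^sup>+d. ennreal (g d t powr p * d powr ((p - 1) / 2)) * indicator {0..s} d \<partial>lborel)"
    using p by (intro nn_integral_cong) (auto simp: powr_mult powr_powr kp split: split_indicator)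
  finally show ?thesis .
qed

text \<open>Jensen's inequality for the average over an interval of length \<open>s\<close>:
  Hoelder's inequality with the indicator as second factor, whose integral is
  \<open>s\<close>.\<close>

lemma jensen_step:
  assumes p: "1 < p" and s: "0 < s" and c: "0 \<le> c"
    "ennreal c \<le> (\<integral>\<^sup>+x. ennreal (g s (t + x)) * indicator {0..s} x \<partial>lborel)"
  shows "ennreal (c powr p) \<le> ennreal (s powr (p - 1)) *
    (\<integral>\<^sup>+x. ennreal (g s (t + x) powr p) * indicator {0..s} x \<partial>lborel)"
proof -
  let ?u = "\<lambda>x. g s (t + x) * indicator {0..s} x"
  let ?v = "\<lambda>x. indicator {0..s} x :: real"
  have "ennreal (c powr p) \<le> ennreal (s powr (p - 1)) * (\<integral>\<^sup>+x. ennreal (?u x powr p) \<partial>lborel)"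
  proof (rule Holder_nn_integral[where g="?v"])
    have uv: "ennreal (?u x * ?v x) = ennreal (g s (t + x)) * indicator {0..s} x" for x
      by (auto split: split_indicator)
    show "ennreal c \<le> (\<integral>\<^sup>+x. ennreal (?u x * ?v x) \<partial>lborel)"
      unfolding uv by fact
    have vq: "ennreal (?v x powr (p / (p - 1))) = indicator {0..s} x" for x
      by (auto split: split_indicator)
    show "(\<integral>\<^sup>+x. ennreal (?v x powr (p / (p - 1))) \<partial>lborel) \<le> ennreal s"
      unfolding vq using s by simp
  qed (use p s c in \<open>auto\<close>)
  also have "(\<integral>\<^sup>+x. ennreal (?u x powr p) \<partial>lborel) = (\<integral>\<^sup>+x. ennreal (g s (t + x) powr p) * indicator {0..s} x \<partial>lborel)"
    using p by (intro nn_integral_cong) (auto split: split_indicator)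
  finally show ?thesis .
qed


section \<open>Integrated difference quotients\<close>

definition E :: "real \<Rightarrow> real \<Rightarrow> ennreal" where
  "E p t = (\<integral>\<^sup>+d. ennreal (g d t powr p) * indicator {0..1/2} d \<partial>lborel)"

text \<open>The angle \<open>s\<close> stands in for the chord. Confinement to
  \<open>0 < s \<le> 1/2\<close> keeps all paths in the collar of depth 1/2, away from the centre,
  and allows \<open>s\<close> to be integrated over the whole line.\<close>

definition J :: "real \<Rightarrow> real \<Rightarrow> real \<Rightarrow> ennreal" where
  "J p t s = ennreal ((norm (\<phi> (t + s) - \<phi> t) / s) powr p) * indicator {0<..1/2} s"

text \<open>
  Up to constants, \<open>H1\<close> and \<open>H2\<close> bound the contributions to \<open>J\<close> of a radial segment and of the arc.
\<close>

definition H1 :: "real \<Rightarrow> real \<Rightarrow> real \<Rightarrow> ennreal" where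
  "H1 p t s = (\<integral>\<^sup>+d. ennreal (g d t powr p * d powr ((p - 1) / 2)) * indicator {0..s} d \<partial>lborel)
     * (ennreal (s powr (-(p + 1) / 2)) * indicator {0<..1/2} s)"

definition H2 :: "real \<Rightarrow> real \<Rightarrow> real \<Rightarrow> ennreal" where
  "H2 p t s = (\<integral>\<^sup>+x. ennreal (g s (t + x) powr p) * indicator {0..s} x \<partial>lborel)
     * (ennreal (1 / s) * indicator {0<..1/2} s)"

lemma borel_measurable_EJH [measurable (raw)]:
  assumes [measurable]: "a \<in> borel_measurable M" "b \<in> borel_measurable M"
  shows "(\<lambda>x. E p (a x)) \<in> borel_measurable M" "(\<lambda>x. J p (a x) (b x)) \<in> borel_measurable M"
    "(\<lambda>x. H1 p (a x) (b x)) \<in> borel_measurable M" "(\<lambda>x. H2 p (a x) (b x)) \<in> borel_measurable M"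
  unfolding E_def J_def H1_def H2_def indicator_def atLeastAtMost_iff greaterThanAtMost_iff
  by measurable

text \<open>The increment is at most the sum of three path integrals, hence three times the largest,
  whence \<open>3 powr p\<close>. The Hardy step turns \<open>s powr (-p)\<close> into the exponent
  \<open>-(p + 1) / 2\<close> of \<open>H1\<close>, and the Jensen step into the
  \<open>1 / s\<close> of \<open>H2\<close>.\<close>

lemma J_le:
  assumes p: "1 < p"
  shows "J p t s \<le> ennreal (3 powr p * 2 powr (p - 1)) * (H1 p t s + H2 p t s + H1 p (t + s) s)"
proof (cases "s \<in> {0<..1/2}")
  case True
  then have s: "0 < s" "s < 1" by auto
  let ?z = "of_real (1 - s) * cis t" and ?w = "of_real (1 - s) * cis (t + s)"
  define a where "a = norm (\<phi> (t + s) - \<phi> t)"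
  let ?N1 = "\<lambda>t. \<integral>\<^sup>+d. ennreal (g d t) * indicator {0..s} d \<partial>lborel"
  let ?N2 = "\<integral>\<^sup>+x. ennreal (g s (t + x)) * indicator {0..s} x \<partial>lborel"
  have "a \<le> norm (\<phi> t - harmonic_ext f ?z) + norm (harmonic_ext f ?w - harmonic_ext f ?z) + norm (\<phi> (t + s) - harmonic_ext f ?w)"
    unfolding a_def by norm
  then have "ennreal a \<le> ennreal (norm (\<phi> t - harmonic_ext f ?z)) + ennreal (norm (harmonic_ext f ?w - harmonic_ext f ?z)) + ennreal (norm (\<phi> (t + s) - harmonic_ext f ?w))"
    by (simp add: ennreal_plus[symmetric] ennreal_leI del: ennreal_plus)
  also have "\<dots> \<le> ?N1 t + ?N2 + ?N1 (t + s)"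
    using s by (intro add_mono radial_bound arc_bound)
  finally have "ennreal (a / 3) \<le> max (?N1 t) (max ?N2 (?N1 (t + s)))"
    by (rule ennreal_le_add3_imp_le_max)
  then consider "ennreal (a / 3) \<le> ?N1 t" | "ennreal (a / 3) \<le> ?N2" | "ennreal (a / 3) \<le> ?N1 (t + s)"
    by (auto simp: le_max_iff_disj)
  note cs = this
  have a3: "0 \<le> a / 3" by (simp add: a_def)
  have J: "J p t s = ennreal (3 powr p * s powr (-p)) * ennreal ((a / 3) powr p)"
  proof -
    have "(a / s) powr p = 3 powr p * s powr (-p) * (a / 3) powr p"
      using s a3 by (simp add: powr_divide powr_minus_divide)
    then show ?thesis using True by (simp add: J_def a_def ennreal_mult[symmetric])
  qed
  have hardy: "J p t s \<le> ennreal (3 powr p * 2 powr (p - 1)) * H1 p \<tau> s" if "ennreal (a / 3) \<le> ?N1 \<tau>" for \<tau>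
  proof -
    let ?I = "\<integral>\<^sup>+d. ennreal (g d \<tau> powr p * d powr ((p - 1) / 2)) * indicator {0..s} d \<partial>lborel"
    have "J p t s \<le> ennreal (3 powr p * s powr (-p)) * (ennreal ((2 * s powr (1/2)) powr (p - 1)) * ?I)"
      unfolding J by (intro mult_left_mono hardy_step p s a3 that) simp
    also have "\<dots> = ennreal (3 powr p * s powr (-p) * (2 * s powr (1/2)) powr (p - 1)) * ?I"
      by (simp add: ennreal_mult mult.assoc)
    also have "3 powr p * s powr (-p) * (2 * s powr (1/2)) powr (p - 1) = 3 powr p * 2 powr (p - 1) * s powr (-(p + 1) / 2)"
    proof -
      have "s powr (-p) * s powr ((p - 1) / 2) = s powr (-p + (p - 1) / 2)"
        by (simp only: powr_add)
      also have "-p + (p - 1) / 2 = -(p + 1) / 2" by (simp add: field_simps)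
      finally show ?thesis using s by (simp add: powr_mult powr_powr)
    qed
    also have "ennreal (3 powr p * 2 powr (p - 1) * s powr (-(p + 1) / 2)) * ?I = ennreal (3 powr p * 2 powr (p - 1)) * H1 p \<tau> s"
      using True by (simp add: H1_def ennreal_mult ac_simps)
    finally show ?thesis .
  qed
  have jensen: "J p t s \<le> ennreal (3 powr p * 2 powr (p - 1)) * H2 p t s" if "ennreal (a / 3) \<le> ?N2"
  proof -
    let ?I = "\<integral>\<^sup>+x. ennreal (g s (t + x) powr p) * indicator {0..s} x \<partial>lborel"
    have "J p t s \<le> ennreal (3 powr p * s powr (-p)) * (ennreal (s powr (p - 1)) * ?I)"
      unfolding J by (intro mult_left_mono jensen_step p s a3 that) simp
    also have "\<dots> = ennreal (3 powr p * s powr (-p) * s powr (p - 1)) * ?I"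
      by (simp add: ennreal_mult mult.assoc)
    also have "3 powr p * s powr (-p) * s powr (p - 1) = 3 powr p * (1 / s)"
    proof -
      have "s powr (-p) * s powr (p - 1) = s powr (-1)" by (simp add: powr_add[symmetric])
      also have "\<dots> = 1 / s" using s by (simp add: powr_minus_divide)
      finally show ?thesis by (simp only: mult.assoc)
    qed
    \<comment> \<open>Only the Hardy step produces \<open>2 powr (p - 1)\<close>, which is at least
      1; it is inserted here so that one constant serves all three cases.\<close>
    also have "ennreal (3 powr p * (1 / s)) * ?I \<le> ennreal (3 powr p * 2 powr (p - 1) * (1 / s)) * ?I"
      using s p ge_one_powr_ge_zero[of 2 "p - 1"]
      by (intro mult_right_mono ennreal_leI) (auto simp: mult_le_cancel_left1 intro!: divide_right_mono)
    also have "\<dots> = ennreal (3 powr p * 2 powr (p - 1)) * H2 p t s"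
    proof -
      have "ennreal (3 powr p * 2 powr (p - 1) * (1 / s)) = ennreal (3 powr p * 2 powr (p - 1)) * ennreal (1 / s)"
        using s by (intro ennreal_mult) auto
      moreover have "indicator {0<..1/2} s = (1 :: ennreal)" using True by simp
      ultimately show ?thesis
        unfolding H2_def by (simp only: mult_1 mult_1_right mult_ac)
    qed
    finally show ?thesis .
  qed
  show ?thesis
    using cs
  proof cases
    case 1
    show ?thesis
      by (rule order_trans[OF hardy[OF 1] mult_left_mono]) (auto simp: add.assoc)
  next
    case 2
    show ?thesis
      by (rule order_trans[OF jensen[OF 2] mult_left_mono]) (auto intro!: add_increasing2 add_increasing)
  next
    case 3
    show ?thesis
      by (rule order_trans[OF hardy[OF 3] mult_left_mono]) (auto intro!: add_increasing)
  qed
qed (simp add: J_def)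

text \<open>The change of order behind Hardy's inequality: for fixed \<open>d\<close> the variable
  \<open>s\<close> runs over \<open>s \<ge> d\<close>, and since \<open>-(p + 1) / 2 < -1\<close>
  the power has the integral \<open>2 / (p - 1) * d powr (-((p - 1) / 2))\<close> up to infinity,
  which cancels the weight in \<open>H1\<close>.\<close>

lemma nn_integral_H1_le:
  assumes p: "1 < p"
  shows "(\<integral>\<^sup>+s. H1 p t s \<partial>lborel) \<le> ennreal (2 / (p - 1)) * E p t"
proof -
  let ?A = "\<lambda>d. ennreal (g d t powr p * d powr ((p - 1) / 2))"
  let ?B = "\<lambda>s. ennreal (s powr (-(p + 1) / 2)) * indicator {0<..1/2} s"
  have "(\<integral>\<^sup>+s. H1 p t s \<partial>lborel) = (\<integral>\<^sup>+s. \<integral>\<^sup>+d. ?A d * indicator {0..s} d * ?B s \<partial>lborel \<partial>lborel)"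
    unfolding H1_def by (intro nn_integral_cong nn_integral_multc[symmetric]) measurable
  also have "\<dots> = (\<integral>\<^sup>+d. \<integral>\<^sup>+s. ?A d * indicator {0..s} d * ?B s \<partial>lborel \<partial>lborel)"
    by (rule lborel_pair.Fubini') (auto simp: split_beta' indicator_def cong: if_cong)
  also have "\<dots> \<le> (\<integral>\<^sup>+d. ennreal (2 / (p - 1)) * (ennreal (g d t powr p) * indicator {0..1/2} d) \<partial>lborel)"
  proof (rule nn_integral_mono)
    fix d :: real
    show "(\<integral>\<^sup>+s. ?A d * indicator {0..s} d * ?B s \<partial>lborel) \<le> ennreal (2 / (p - 1)) * (ennreal (g d t powr p) * indicator {0..1/2} d)"
    proof (cases "0 < d \<and> d \<le> 1/2")
      case True
      have "(\<integral>\<^sup>+s. ?A d * indicator {0..s} d * ?B s \<partial>lborel) \<le> (\<integral>\<^sup>+s. ?A d * (ennreal (s powr (-(p + 1) / 2)) * indicator {d..} s) \<partial>lborel)"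
        by (intro nn_integral_mono) (auto split: split_indicator)
      also have "\<dots> = ?A d * (\<integral>\<^sup>+s. ennreal (s powr (-(p + 1) / 2)) * indicator {d..} s \<partial>lborel)"
        by (rule nn_integral_cmult) measurable
      also have "(\<integral>\<^sup>+s. ennreal (s powr (-(p + 1) / 2)) * indicator {d..} s \<partial>lborel) = ennreal (- (d powr (-(p + 1) / 2 + 1)) / (-(p + 1) / 2 + 1))"
        using p True by (intro nn_integral_powr_to_inf) (auto simp: field_simps)
      also have "- (d powr (-(p + 1) / 2 + 1)) / (-(p + 1) / 2 + 1) = (2 / (p - 1)) * d powr (-((p - 1) / 2))"
      proof -
        have e: "-(p + 1) / 2 + 1 = -((p - 1) / 2)" by (simp add: field_simps)
        show ?thesis unfolding e using p by (simp add: field_simps)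
      qed
      also have "?A d * ennreal ((2 / (p - 1)) * d powr (-((p - 1) / 2))) = ennreal (2 / (p - 1)) * ennreal (g d t powr p)"
      proof -
        have "d powr ((p - 1) / 2) * d powr (-((p - 1) / 2)) = 1"
          using True by (simp add: powr_add[symmetric])
        then have "g d t powr p * d powr ((p - 1) / 2) * ((2 / (p - 1)) * d powr (-((p - 1) / 2))) = 2 / (p - 1) * g d t powr p"
          by (simp add: algebra_simps)
        then show ?thesis using p by (simp only: ennreal_mult[symmetric] g_nonneg powr_ge_zero mult_nonneg_nonneg divide_nonneg_nonneg)
      qed
      finally show ?thesis using True by simp
    next
      case False
      \<comment> \<open>For \<open>d = 0\<close> the integrand vanishes because
        \<open>g 0 t = 0\<close>; for negative \<open>d\<close> and for \<open>d > 1/2\<close> no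
        \<open>s\<close> passes both indicators.\<close>
      have z: "?A d * indicator {0..s} d * ?B s = 0" for s
        using False p by (cases "d = 0") (auto split: split_indicator)
      show ?thesis unfolding z by simp
    qed
  qed
  also have "\<dots> = ennreal (2 / (p - 1)) * E p t"
    unfolding E_def by (rule nn_integral_cmult) measurable
  finally show ?thesis .
qed

text \<open>The shift by \<open>s \<le> 1/2\<close> leaves \<open>{0..2*pi}\<close> but stays within
  two periods; periodicity later reduces these to one.\<close>

lemma nn_integral_H1_shift_le:
  "(\<integral>\<^sup>+t. (\<integral>\<^sup>+s. H1 p (t + s) s \<partial>lborel) * indicator {0..2*pi} t \<partial>lborel)
     \<le> (\<integral>\<^sup>+t. (\<integral>\<^sup>+s. H1 p t s \<partial>lborel) * indicator {0..4*pi} t \<partial>lborel)"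
proof -
  have "(\<integral>\<^sup>+t. (\<integral>\<^sup>+s. H1 p (t + s) s \<partial>lborel) * indicator {0..2*pi} t \<partial>lborel)
      = (\<integral>\<^sup>+t. \<integral>\<^sup>+s. H1 p (t + s) s * indicator {0..2*pi} t \<partial>lborel \<partial>lborel)"
    by (intro nn_integral_cong nn_integral_multc[symmetric]) measurable
  also have "\<dots> = (\<integral>\<^sup>+s. \<integral>\<^sup>+t. H1 p (t + s) s * indicator {0..2*pi} t \<partial>lborel \<partial>lborel)"
    by (rule lborel_pair.Fubini') measurable
  also have "\<dots> \<le> (\<integral>\<^sup>+s. \<integral>\<^sup>+t. H1 p t s * indicator {0..4*pi} t \<partial>lborel \<partial>lborel)"
  proof (rule nn_integral_mono)
    fix s :: real
    have "(\<integral>\<^sup>+t. H1 p (t + s) s * indicator {0..2*pi} t \<partial>lborel) \<le> (\<integral>\<^sup>+t. H1 p (s + t) s * indicator {0..4*pi} (s + t) \<partial>lborel)"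
      using pi_gt3 by (intro nn_integral_mono) (auto simp: H1_def add.commute split: split_indicator)
    also have "\<dots> = (\<integral>\<^sup>+t. H1 p t s * indicator {0..4*pi} t \<partial>lborel)"
      by (rule nn_integral_real_shift) measurable
    finally show "(\<integral>\<^sup>+t. H1 p (t + s) s * indicator {0..2*pi} t \<partial>lborel) \<le> (\<integral>\<^sup>+t. H1 p t s * indicator {0..4*pi} t \<partial>lborel)" .
  qed
  also have "\<dots> = (\<integral>\<^sup>+t. \<integral>\<^sup>+s. H1 p t s * indicator {0..4*pi} t \<partial>lborel \<partial>lborel)"
    by (rule lborel_pair.Fubini') measurable
  also have "\<dots> = (\<integral>\<^sup>+t. (\<integral>\<^sup>+s. H1 p t s \<partial>lborel) * indicator {0..4*pi} t \<partial>lborel)"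
    by (intro nn_integral_cong nn_integral_multc) measurable
  finally show ?thesis .
qed

text \<open>For fixed \<open>s\<close>, the integral over \<open>t\<close> of each translate by
  \<open>x\<close> is at most the integral over two periods, so integration over \<open>x\<close> in
  \<open>{0..s}\<close> gives a factor \<open>s\<close> that cancels \<open>1 / s\<close>.\<close>

lemma nn_integral_H2_le:
  "(\<integral>\<^sup>+t. (\<integral>\<^sup>+s. H2 p t s \<partial>lborel) * indicator {0..2*pi} t \<partial>lborel)
     \<le> (\<integral>\<^sup>+t. E p t * indicator {0..4*pi} t \<partial>lborel)"
proof -
  have "(\<integral>\<^sup>+t. (\<integral>\<^sup>+s. H2 p t s \<partial>lborel) * indicator {0..2*pi} t \<partial>lborel)
      = (\<integral>\<^sup>+t. \<integral>\<^sup>+s. H2 p t s * indicator {0..2*pi} t \<partial>lborel \<partial>lborel)"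
    by (intro nn_integral_cong nn_integral_multc[symmetric]) measurable
  also have "\<dots> = (\<integral>\<^sup>+s. \<integral>\<^sup>+t. H2 p t s * indicator {0..2*pi} t \<partial>lborel \<partial>lborel)"
    by (rule lborel_pair.Fubini') measurable
  also have "\<dots> \<le> (\<integral>\<^sup>+s. \<integral>\<^sup>+t. ennreal (g s t powr p) * indicator {0..1/2} s * indicator {0..4*pi} t \<partial>lborel \<partial>lborel)"
  proof (rule nn_integral_mono)
    fix s :: real
    let ?M = "\<integral>\<^sup>+t. ennreal (g s t powr p) * indicator {0..4*pi} t \<partial>lborel"
    show "(\<integral>\<^sup>+t. H2 p t s * indicator {0..2*pi} t \<partial>lborel) \<le> (\<integral>\<^sup>+t. ennreal (g s t powr p) * indicator {0..1/2} s * indicator {0..4*pi} t \<partial>lborel)"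
    proof (cases "s \<in> {0<..1/2}")
      case True
      have "(\<integral>\<^sup>+t. H2 p t s * indicator {0..2*pi} t \<partial>lborel)
          = (\<integral>\<^sup>+t. ennreal (1 / s) * (\<integral>\<^sup>+x. ennreal (g s (t + x) powr p) * indicator {0..s} x * indicator {0..2*pi} t \<partial>lborel) \<partial>lborel)"
        using True by (intro nn_integral_cong, subst nn_integral_multc) (auto simp: H2_def mult_ac)
      also have "\<dots> = ennreal (1 / s) * (\<integral>\<^sup>+t. \<integral>\<^sup>+x. ennreal (g s (t + x) powr p) * indicator {0..s} x * indicator {0..2*pi} t \<partial>lborel \<partial>lborel)"
        by (rule nn_integral_cmult) measurable
      also have "(\<integral>\<^sup>+t. \<integral>\<^sup>+x. ennreal (g s (t + x) powr p) * indicator {0..s} x * indicator {0..2*pi} t \<partial>lborel \<partial>lborel)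
        = (\<integral>\<^sup>+x. \<integral>\<^sup>+t. ennreal (g s (t + x) powr p) * indicator {0..s} x * indicator {0..2*pi} t \<partial>lborel \<partial>lborel)"
        by (rule lborel_pair.Fubini') measurable
      finally have "(\<integral>\<^sup>+t. H2 p t s * indicator {0..2*pi} t \<partial>lborel) = ennreal (1 / s) *
         (\<integral>\<^sup>+x. \<integral>\<^sup>+t. ennreal (g s (t + x) powr p) * indicator {0..s} x * indicator {0..2*pi} t \<partial>lborel \<partial>lborel)" .
      also have "\<dots> \<le> ennreal (1 / s) * (\<integral>\<^sup>+x. ?M * indicator {0..s} x \<partial>lborel)"
      proof (intro mult_left_mono nn_integral_mono)
        fix x :: real
        have "(\<integral>\<^sup>+t. ennreal (g s (t + x) powr p) * indicator {0..s} x * indicator {0..2*pi} t \<partial>lborel)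
           \<le> (\<integral>\<^sup>+t. (ennreal (g s (x + t) powr p) * indicator {0..4*pi} (x + t)) * indicator {0..s} x \<partial>lborel)"
          using True pi_gt3 by (intro nn_integral_mono) (auto simp: add.commute split: split_indicator)
        also have "\<dots> = (\<integral>\<^sup>+t. ennreal (g s (x + t) powr p) * indicator {0..4*pi} (x + t) \<partial>lborel) * indicator {0..s} x"
          by (rule nn_integral_multc) measurable
        also have "(\<integral>\<^sup>+t. ennreal (g s (x + t) powr p) * indicator {0..4*pi} (x + t) \<partial>lborel) = ?M"
          by (rule nn_integral_real_shift) measurable
        finally show "(\<integral>\<^sup>+t. ennreal (g s (t + x) powr p) * indicator {0..s} x * indicator {0..2*pi} t \<partial>lborel) \<le> ?M * indicator {0..s} x" .
      qed simp
      also have "(\<integral>\<^sup>+x. ?M * indicator {0..s} x \<partial>lborel) = ?M * ennreal s"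
        using True by (simp add: nn_integral_cmult)
      also have "ennreal (1 / s) * (?M * ennreal s) = (ennreal (1 / s) * ennreal s) * ?M"
        by (simp only: mult_ac)
      also have "ennreal (1 / s) * ennreal s = 1"
        using True by (simp add: ennreal_mult[symmetric])
      finally show ?thesis using True by simp
    qed (simp add: H2_def)
  qed
  also have "\<dots> = (\<integral>\<^sup>+t. \<integral>\<^sup>+s. ennreal (g s t powr p) * indicator {0..1/2} s * indicator {0..4*pi} t \<partial>lborel \<partial>lborel)"
    by (rule lborel_pair.Fubini') measurable
  also have "\<dots> = (\<integral>\<^sup>+t. E p t * indicator {0..4*pi} t \<partial>lborel)"
    unfolding E_def by (intro nn_integral_cong nn_integral_multc) measurable
  finally show ?thesis .
qed

text \<open>\<open>E\<close> lacks the Jacobian \<open>1 - d\<close> of polar coordinates, which is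
  at least 1/2 for \<open>d \<le> 1/2\<close>; hence the factor 2. The second period repeats the
  first.\<close>

lemma nn_integral_E_finite:
  assumes fin: "(\<integral>\<^sup>+z. ennreal (G z powr p) \<partial>lborel) < \<infinity>"
  shows "(\<integral>\<^sup>+t. E p t * indicator {0..4*pi} t \<partial>lborel) < \<infinity>"
proof -
  have E_le: "E p t \<le> ennreal 2 * (\<integral>\<^sup>+r. ennreal r * ennreal (G (of_real r * cis t) powr p) * indicator {0<..} r \<partial>lborel)" for t
  proof -
    have "E p t \<le> (\<integral>\<^sup>+d. ennreal 2 * (ennreal (1 + (-1) * d) * ennreal (G (of_real (1 + (-1) * d) * cis t) powr p) * indicator {0<..} (1 + (-1) * d)) \<partial>lborel)"
      unfolding E_def
    proof (rule nn_integral_mono)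
      fix d :: real
      have "ennreal (g d t powr p) \<le> ennreal 2 * (ennreal (1 - d) * ennreal (g d t powr p))" if "0 \<le> d" "d \<le> 1/2"
      proof -
        have "1 * g d t powr p \<le> (2 * (1 - d)) * g d t powr p"
          using that by (intro mult_right_mono) auto
        then have "ennreal (g d t powr p) \<le> ennreal (2 * ((1 - d) * g d t powr p))"
          by (intro ennreal_leI) (simp only: mult.assoc mult_1)
        also have "\<dots> = ennreal 2 * (ennreal (1 - d) * ennreal (g d t powr p))"
          using that by (simp only: ennreal_mult powr_ge_zero mult_nonneg_nonneg diff_ge_0_iff_ge)
        finally show ?thesis .
      qed
      then show "ennreal (g d t powr p) * indicator {0..1/2} d \<le>
         ennreal 2 * (ennreal (1 + (-1) * d) * ennreal (G (of_real (1 + (-1) * d) * cis t) powr p) * indicator {0<..} (1 + (-1) * d))"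
        by (auto simp: g_def split: split_indicator)
    qed
    also have "\<dots> = ennreal 2 * (\<integral>\<^sup>+d. ennreal (1 + (-1) * d) * ennreal (G (of_real (1 + (-1) * d) * cis t) powr p) * indicator {0<..} (1 + (-1) * d) \<partial>lborel)"
      by (rule nn_integral_cmult) measurable
    also have "(\<integral>\<^sup>+d. ennreal (1 + (-1) * d) * ennreal (G (of_real (1 + (-1) * d) * cis t) powr p) * indicator {0<..} (1 + (-1) * d) \<partial>lborel)
       = (\<integral>\<^sup>+r. ennreal r * ennreal (G (of_real r * cis t) powr p) * indicator {0<..} r \<partial>lborel)"
      by (subst (2) nn_integral_real_affine[where c="-1" and t=1]) auto
    finally show ?thesis .
  qed
  have per: "E p (2 * pi + t) = E p t" for t
    by (simp add: E_def g_periodic)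
  have base: "(\<integral>\<^sup>+t. E p t * indicator {0..2*pi} t \<partial>lborel) < \<infinity>"
  proof -
    have "(\<integral>\<^sup>+t. E p t * indicator {0..2*pi} t \<partial>lborel) \<le>
      (\<integral>\<^sup>+t. ennreal 2 * ((\<integral>\<^sup>+r. ennreal r * ennreal (G (of_real r * cis t) powr p) * indicator {0<..} r \<partial>lborel) * indicator {0..2*pi} t) \<partial>lborel)"
      using E_le by (intro nn_integral_mono) (auto split: split_indicator)
    also have "\<dots> = ennreal 2 * (\<integral>\<^sup>+t. (\<integral>\<^sup>+r. ennreal r * ennreal (G (of_real r * cis t) powr p) * indicator {0<..} r \<partial>lborel) * indicator {0..2*pi} t \<partial>lborel)"
      by (rule nn_integral_cmult) measurable
    also have "(\<integral>\<^sup>+t. (\<integral>\<^sup>+r. ennreal r * ennreal (G (of_real r * cis t) powr p) * indicator {0<..} r \<partial>lborel) * indicator {0..2*pi} t \<partial>lborel) = (\<integral>\<^sup>+z. ennreal (G z powr p) \<partial>lborel)"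
      by (rule nn_integral_polar[symmetric]) measurable
    also have "ennreal 2 * \<dots> < \<infinity>" using fin by (simp add: ennreal_mult_less_top)
    finally show ?thesis .
  qed
  have "(\<integral>\<^sup>+t. E p t * indicator {0..4*pi} t \<partial>lborel) \<le> (\<integral>\<^sup>+t. E p t * indicator {0..2*pi} t + E p t * indicator {2*pi..4*pi} t \<partial>lborel)"
    by (intro nn_integral_mono) (auto split: split_indicator)
  also have "\<dots> = (\<integral>\<^sup>+t. E p t * indicator {0..2*pi} t \<partial>lborel) + (\<integral>\<^sup>+t. E p t * indicator {2*pi..4*pi} t \<partial>lborel)"
    by (rule nn_integral_add) measurable
  also have "(\<integral>\<^sup>+t. E p t * indicator {2*pi..4*pi} t \<partial>lborel) = (\<integral>\<^sup>+t. E p (2*pi + t) * indicator {2*pi..4*pi} (2*pi + t) \<partial>lborel)"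
    by (rule nn_integral_real_shift[symmetric]) measurable
  also have "\<dots> = (\<integral>\<^sup>+t. E p t * indicator {0..2*pi} t \<partial>lborel)"
    by (intro nn_integral_cong) (auto simp: per split: split_indicator)
  finally show ?thesis using base by (simp add: le_less_trans)
qed

lemma nn_integral_J_finite:
  assumes p: "1 < p" and fin: "(\<integral>\<^sup>+z. ennreal (G z powr p) \<partial>lborel) < \<infinity>"
  shows "(\<integral>\<^sup>+t. (\<integral>\<^sup>+s. J p t s \<partial>lborel) * indicator {0..2*pi} t \<partial>lborel) < \<infinity>"
proof -
  let ?C = "ennreal (3 powr p * 2 powr (p - 1))"
  let ?E = "\<integral>\<^sup>+t. E p t * indicator {0..4*pi} t \<partial>lborel"
  let ?i = "indicator {0..2*pi} :: real \<Rightarrow> ennreal"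
  have H1: "(\<integral>\<^sup>+t. (\<integral>\<^sup>+s. H1 p t s \<partial>lborel) * indicator {0..4*pi} t \<partial>lborel) \<le> ennreal (2 / (p - 1)) * ?E"
  proof -
    have "(\<integral>\<^sup>+t. (\<integral>\<^sup>+s. H1 p t s \<partial>lborel) * indicator {0..4*pi} t \<partial>lborel) \<le> (\<integral>\<^sup>+t. ennreal (2 / (p - 1)) * (E p t * indicator {0..4*pi} t) \<partial>lborel)"
      using nn_integral_H1_le[OF p] by (intro nn_integral_mono) (auto split: split_indicator)
    also have "\<dots> = ennreal (2 / (p - 1)) * ?E"
      by (rule nn_integral_cmult) measurable
    finally show ?thesis .
  qed
  have H1': "(\<integral>\<^sup>+t. (\<integral>\<^sup>+s. H1 p t s \<partial>lborel) * ?i t \<partial>lborel) \<le> ennreal (2 / (p - 1)) * ?E"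
    by (rule order_trans[OF nn_integral_mono H1]) (auto split: split_indicator)
  have inner: "(\<integral>\<^sup>+s. J p t s \<partial>lborel) \<le> ?C * ((\<integral>\<^sup>+s. H1 p t s \<partial>lborel) + (\<integral>\<^sup>+s. H2 p t s \<partial>lborel) + (\<integral>\<^sup>+s. H1 p (t + s) s \<partial>lborel))" for t
  proof -
    have "(\<integral>\<^sup>+s. J p t s \<partial>lborel) \<le> (\<integral>\<^sup>+s. ?C * (H1 p t s + H2 p t s + H1 p (t + s) s) \<partial>lborel)"
      by (intro nn_integral_mono J_le p)
    also have "\<dots> = ?C * ((\<integral>\<^sup>+s. H1 p t s \<partial>lborel) + (\<integral>\<^sup>+s. H2 p t s \<partial>lborel) + (\<integral>\<^sup>+s. H1 p (t + s) s \<partial>lborel))"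
      by (subst nn_integral_cmult, measurable, subst nn_integral_add, measurable, subst nn_integral_add, measurable)
    finally show ?thesis .
  qed
  have "(\<integral>\<^sup>+t. (\<integral>\<^sup>+s. J p t s \<partial>lborel) * ?i t \<partial>lborel) \<le>
    (\<integral>\<^sup>+t. ?C * ((\<integral>\<^sup>+s. H1 p t s \<partial>lborel) * ?i t + (\<integral>\<^sup>+s. H2 p t s \<partial>lborel) * ?i t + (\<integral>\<^sup>+s. H1 p (t + s) s \<partial>lborel) * ?i t) \<partial>lborel)"
    using inner by (intro nn_integral_mono) (auto split: split_indicator)
  also have "\<dots> = ?C * ((\<integral>\<^sup>+t. (\<integral>\<^sup>+s. H1 p t s \<partial>lborel) * ?i t \<partial>lborel) + (\<integral>\<^sup>+t. (\<integral>\<^sup>+s. H2 p t s \<partial>lborel) * ?i t \<partial>lborel) + (\<integral>\<^sup>+t. (\<integral>\<^sup>+s. H1 p (t + s) s \<partial>lborel) * ?i t \<partial>lborel))"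
    by (subst nn_integral_cmult, measurable, subst nn_integral_add, measurable, subst nn_integral_add, measurable)
  also have "\<dots> \<le> ?C * (ennreal (2 / (p - 1)) * ?E + ?E + ennreal (2 / (p - 1)) * ?E)"
    by (intro mult_left_mono add_mono H1' nn_integral_H2_le order_trans[OF nn_integral_H1_shift_le H1]) auto
  also have "\<dots> < \<infinity>"
    using nn_integral_E_finite[OF fin] by (simp add: ennreal_mult_less_top)
  finally show ?thesis .
qed


section \<open>Back from angles to chords\<close>

lemma \<phi>_periodic: "\<phi> (x + 2 * pi * of_int k) = \<phi> x"
  by (simp add: \<phi>_def)

lemma difference_quotient_le_J:
  assumes x: "0 < s - t + 2 * pi * of_int k" "s - t + 2 * pi * of_int k \<le> 1/2"
    and \<rho>: "(s - t + 2 * pi * of_int k) / 2 \<le> norm (cis s - cis t)" and p: "0 < p"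
  shows "ennreal (norm ((\<phi> s - \<phi> t) / (cis s - cis t)) powr p) \<le> ennreal (2 powr p) * J p t (- t + 2 * pi * of_int k + s)"
proof -
  let ?x = "s - t + 2 * pi * of_int k"
  have \<phi>: "\<phi> (t + ?x) = \<phi> s"
    using \<phi>_periodic[of s k] by (simp add: algebra_simps)
  have "norm ((\<phi> s - \<phi> t) / (cis s - cis t)) = norm (\<phi> s - \<phi> t) / norm (cis s - cis t)"
    by (rule norm_divide)
  also have "\<dots> \<le> norm (\<phi> s - \<phi> t) / (?x / 2)"
    using x \<rho> by (intro divide_left_mono mult_pos_pos) auto
  finally have "norm ((\<phi> s - \<phi> t) / (cis s - cis t)) powr p \<le> (2 * (norm (\<phi> s - \<phi> t) / ?x)) powr p"
    using p by (intro powr_mono2) (auto simp: mult.commute)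
  also have "\<dots> = 2 powr p * (norm (\<phi> s - \<phi> t) / ?x) powr p"
    by (rule powr_mult)
  finally have "ennreal (norm ((\<phi> s - \<phi> t) / (cis s - cis t)) powr p) \<le> ennreal (2 powr p) * ennreal ((norm (\<phi> s - \<phi> t) / ?x) powr p)"
    by (simp add: ennreal_mult[symmetric] ennreal_leI)
  moreover have "- t + 2 * pi * of_int k + s = ?x" by simp
  ultimately show ?thesis
    using x \<phi> by (simp only: J_def) simp
qed

text \<open>A suitable \<open>k\<close> reduces to an angle of modulus at most \<open>pi\<close>.
  Positive angles up to 1/2 are seen from \<open>t\<close>, negative ones from \<open>s\<close>, and
  for larger ones the quotient is bounded outright. Summing over all \<open>k\<close> frees the
  bound from the choice.\<close>

lemma difference_quotient_le:
  assumes s: "s \<in> {0..2*pi}" and t: "t \<in> {0..2*pi}" and p: "1 < p"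
  shows "ennreal (norm ((\<phi> s - \<phi> t) / (cis s - cis t)) powr p) \<le>
    ennreal (8 powr p) + (\<Sum>k\<in>{-1, 0, 1::int}. ennreal (2 powr p) * J p t (- t + 2 * pi * of_int k + s)
       + ennreal (2 powr p) * J p s (- s + 2 * pi * of_int k + t))"
    (is "?Q \<le> _ + (\<Sum>k\<in>_. ?A k + ?B k)")
proof -
  obtain k :: int where k: "k \<in> {-1, 0, 1}" "\<bar>s - t + 2 * pi * of_int k\<bar> / 2 \<le> norm (cis s - cis t)"
    using norm_cis_diff_ge_periodic[OF s t] by metis
  have mem: "?A j + ?B j \<le> (\<Sum>k\<in>{-1, 0, 1::int}. ?A k + ?B k)" if "j \<in> {-1, 0, 1}" for j
    using that by (intro member_le_sum) auto
  consider "\<bar>s - t + 2 * pi * of_int k\<bar> > 1/2" | "0 < s - t + 2 * pi * of_int k" "s - t + 2 * pi * of_int k \<le> 1/2"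
    | "s - t + 2 * pi * of_int k < 0" "- 1/2 \<le> s - t + 2 * pi * of_int k" | "s - t + 2 * pi * of_int k = 0"
    by linarith
  then show ?thesis
  proof cases
    case 1
    \<comment> \<open>A chord of at least 1/4 and a numerator of at most 2 give the constant
      8.\<close>
    then have "1/4 \<le> \<bar>s - t + 2 * pi * of_int k\<bar> / 2" by simp
    then have \<rho>: "1/4 \<le> norm (cis s - cis t)" using k(2) by (rule order_trans)
    have "norm ((\<phi> s - \<phi> t) / (cis s - cis t)) = norm (\<phi> s - \<phi> t) / norm (cis s - cis t)"
      by (rule norm_divide)
    also have "\<dots> \<le> 2 / (1/4)"
      using \<rho> norm_triangle_ineq4[of "\<phi> s" "\<phi> t"] by (intro frac_le) auto
    finally have "norm ((\<phi> s - \<phi> t) / (cis s - cis t)) powr p \<le> 8 powr p"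
      using p by (intro powr_mono2) auto
    then show ?thesis by (intro add_increasing2 ennreal_leI) auto
  next
    case 2
    then have "?Q \<le> ?A k"
      using k p by (intro difference_quotient_le_J) auto
    also have "\<dots> \<le> ?A k + ?B k" by simp
    also note mem[OF k(1)]
    finally show ?thesis by (rule add_increasing[rotated]) simp
  next
    case 3
    \<comment> \<open>With \<open>s\<close> and \<open>t\<close> exchanged the angle is positive,
      and its index is \<open>- k\<close>.\<close>
    have "?Q = ennreal (norm ((\<phi> t - \<phi> s) / (cis t - cis s)) powr p)"
      by (simp add: norm_divide norm_minus_commute)
    also have "\<dots> \<le> ?B (- k)"
      using k p 3 by (intro difference_quotient_le_J) (auto simp: norm_minus_commute)
    also have "\<dots> \<le> ?A (- k) + ?B (- k)" by simp
    also have "\<dots> \<le> (\<Sum>k\<in>{-1, 0, 1::int}. ?A k + ?B k)"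
      using k(1) by (intro mem) auto
    finally show ?thesis by (rule add_increasing[rotated]) simp
  next
    case 4
    \<comment> \<open>The values of \<phi> coincide, so the quotient is 0, even where the
      denominator vanishes.\<close>
    then have "\<phi> s = \<phi> t"
      using \<phi>_periodic[of s k] by (simp add: algebra_simps)
    then show ?thesis using p by simp
  qed
qed

text \<open>Each pair contributes a constant and six translated copies of \<open>J\<close>. With the
  shifted variable running over the whole line, translations do not matter, so all six copies have
  the same integral, which \<open>nn_integral_J_finite\<close> bounds.\<close>

lemma energy_finite_imp_douglas:
  assumes p: "1 < p" and fin: "(\<integral>\<^sup>+z. ennreal (G z powr p) \<partial>lborel) < \<infinity>"
  shows "douglas_cond p f"
proof -
  let ?i = "indicator {0..2*pi} :: real \<Rightarrow> ennreal"
  let ?c = "\<lambda>k t. - t + 2 * pi * real_of_int k"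
  let ?JJ = "\<integral>\<^sup>+t. (\<integral>\<^sup>+s. J p t s \<partial>lborel) * ?i t \<partial>lborel"
  let ?A = "\<lambda>k s t. J p t (?c k t + s) * ?i t"
  let ?B = "\<lambda>k s t. J p s (?c k s + t) * ?i s"
  let ?Z = "ennreal (2 powr p)"
  let ?K = "\<lambda>s t. ennreal (8 powr p) * ?i s * ?i t"
  have A: "(\<integral>\<^sup>+s. \<integral>\<^sup>+t. ?A k s t \<partial>lborel \<partial>lborel) = ?JJ" for k
  proof -
    have "(\<integral>\<^sup>+s. \<integral>\<^sup>+t. ?A k s t \<partial>lborel \<partial>lborel) = (\<integral>\<^sup>+t. \<integral>\<^sup>+s. ?A k s t \<partial>lborel \<partial>lborel)"
      by (rule lborel_pair.Fubini') measurable
    also have "\<dots> = (\<integral>\<^sup>+t. (\<integral>\<^sup>+s. J p t (?c k t + s) \<partial>lborel) * ?i t \<partial>lborel)"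
      by (intro nn_integral_cong nn_integral_multc) measurable
    also have "\<dots> = ?JJ"
      by (intro nn_integral_cong arg_cong2[where f="(*)"] nn_integral_real_shift refl) measurable
    finally show ?thesis .
  qed
  have B: "(\<integral>\<^sup>+s. \<integral>\<^sup>+t. ?B k s t \<partial>lborel \<partial>lborel) = ?JJ" for k
  proof -
    have "(\<integral>\<^sup>+s. \<integral>\<^sup>+t. ?B k s t \<partial>lborel \<partial>lborel) = (\<integral>\<^sup>+s. (\<integral>\<^sup>+t. J p s (?c k s + t) \<partial>lborel) * ?i s \<partial>lborel)"
      by (intro nn_integral_cong nn_integral_multc) measurable
    also have "\<dots> = ?JJ"
      by (intro nn_integral_cong arg_cong2[where f="(*)"] nn_integral_real_shift refl) measurable
    finally show ?thesis .
  qed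
  have "(\<integral>\<^sup>+ s. \<integral>\<^sup>+ t. ennreal (indicator {0..2*pi} s * indicator {0..2*pi} t *
        norm ((f (cis s) - f (cis t)) / (cis s - cis t)) powr p) \<partial>lborel \<partial>lborel)
     \<le> (\<integral>\<^sup>+s. \<integral>\<^sup>+t. ?K s t + (\<Sum>k\<in>{-1, 0, 1::int}. ?Z * ?A k s t + ?Z * ?B k s t) \<partial>lborel \<partial>lborel)"
  proof (intro nn_integral_mono)
    fix s t :: real
    show "ennreal (indicator {0..2*pi} s * indicator {0..2*pi} t * norm ((f (cis s) - f (cis t)) / (cis s - cis t)) powr p)
       \<le> ?K s t + (\<Sum>k\<in>{-1, 0, 1::int}. ?Z * ?A k s t + ?Z * ?B k s t)"
    proof (cases "s \<in> {0..2*pi} \<and> t \<in> {0..2*pi}")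
      case True
      then have i: "?i s = 1" "?i t = 1" "indicator {0..2*pi} s = (1::real)" "indicator {0..2*pi} t = (1::real)" by auto
      show ?thesis
        unfolding i mult_1_right mult_1 using difference_quotient_le[of s t p] True p unfolding \<phi>_def by auto
    qed (auto split: split_indicator)
  qed
  also have "\<dots> = (\<integral>\<^sup>+s. \<integral>\<^sup>+t. ?K s t \<partial>lborel \<partial>lborel) +
     (\<Sum>k\<in>{-1, 0, 1::int}. ?Z * (\<integral>\<^sup>+s. \<integral>\<^sup>+t. ?A k s t \<partial>lborel \<partial>lborel) + ?Z * (\<integral>\<^sup>+s. \<integral>\<^sup>+t. ?B k s t \<partial>lborel \<partial>lborel))"
    by (simp add: nn_integral_add nn_integral_sum nn_integral_cmult)
  also have "\<dots> = (\<integral>\<^sup>+s. \<integral>\<^sup>+t. ?K s t \<partial>lborel \<partial>lborel) + (\<Sum>k\<in>{-1, 0, 1::int}. ?Z * ?JJ + ?Z * ?JJ)"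
    unfolding A B ..
  also have "(\<integral>\<^sup>+s. \<integral>\<^sup>+t. ?K s t \<partial>lborel \<partial>lborel) = ennreal (8 powr p) * ennreal (2 * pi) * ennreal (2 * pi)"
    by (simp add: nn_integral_cmult nn_integral_multc)
  also have "ennreal (8 powr p) * ennreal (2 * pi) * ennreal (2 * pi) + (\<Sum>k\<in>{-1, 0, 1::int}. ?Z * ?JJ + ?Z * ?JJ) < \<infinity>"
    using nn_integral_J_finite[OF p fin] by (simp add: ennreal_mult_less_top)
  finally show ?thesis unfolding douglas_cond_def .
qed

end

theorem theorem1p2:
  fixes f :: "complex \<Rightarrow> complex" and p :: real
  assumes "\<exists>g. homeomorphism (sphere 0 1) (sphere 0 1) f g"
    and "1 < p"
  shows "sobolev_W1p (ball 0 1) p (harmonic_ext f) \<longleftrightarrow> douglas_cond p f"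
proof -
  obtain g where g: "homeomorphism (sphere 0 1) (sphere 0 1) f g"
    using assms(1) by blast
  interpret circle_map f
  proof
    show "continuous_on (sphere 0 1) f"
      using g by (rule homeomorphism_cont1)
    show "norm (f z) = 1" if "norm z = 1" for z
      using homeomorphism_image1[OF g] that by (metis dist_0_norm imageI mem_sphere)
  qed
  show ?thesis
    unfolding sobolev_harmonic_ext_iff[OF assms(2)]
    using douglas_imp_energy_finite energy_finite_imp_douglas assms(2) by blast
qed

end
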